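(* Let $E$ be a complex Banach space admitting a projective approximating sequence $\{E_t,p_t\}_{t\in\mathcal T}$. Suppose that $\{T_t\}_{t\in\mathcal T}$ is a collection of metric currents such that (1) $T_t\in N_k(E_t)$ for every $t$; (2) $(p_t|_{E_{t'}})_\sharp T_{t'}=T_t$ for all $t,t'\in\mathcal T$ with $t'>t$; (3) there are finite Radon measures $\mu,\nu$ on $E$ with $\|T_t\|\le(p_t)_*\mu$ and $\|dT_t\|\le(p_t)_*\nu$ for every $t$. Then there exists $T\in N_k(E)$ such that $(p_t)_\sharp T=T_t$ for every $t\in\mathcal T$.
   Context: A Banach space $E$ has the projective approximation property if there exist a constant $a$ and a family $\{E_t\}_{t\in\mathcal T}$ of finite-dimensional subspaces, directed by inclusion ($\mathcal T$ ordered accordingly), with $\bigcup_tE_t$ dense in $E$, and continuous linear projections $p_t:E\to E_t$ with $\|p_t\|\le a$. Such a family $\{E_t,p_t\}$ is a projective approximating sequence if $\mathcal T$ is countable and $p_t\circ p_s=p_{\min\{s,t\}}$ for all $s,t$. Metric currents (Ambrosio–Kirchheim) on a complete metric space $Z$: with $\mathscr E^k(Z)=\mathrm{Lip}_b(Z)\times[\mathrm{Lip}(Z)]^k$ (complex-valued), a $k$-dimensional metric current is a multilinear $T:\mathscr E^k(Z)\to\mathbb C$, continuous under pointwise convergence with uniformly bounded Lipschitz constants, local ($T(f,\pi)=0$ if some $\pi_j$ is constant near $\mathrm{supp} f$), with finite mass: there is a finite Radon measure $\mu$ with $|T(f,\pi)|\le\prod_j\mathrm{Lip}(\pi_j)\int|f|d\mu$;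 the least such is $\|T\|$. Boundary $dT(f,\pi_1,\dots,\pi_{k-1})=T(1,f,\pi_1,\dots,\pi_{k-1})$. $N_k(Z)$: currents $T$ with $dT$ of finite mass. Pushforward $\phi_\sharp T(f,\pi)=T(f\circ\phi,\pi\circ\phi)$; for a measure, $(p_t)_*\mu$ is the image measure. *)

theory Defs
  imports "HOL-Analysis.Analysis"
begin

section \<open>Complex Banach spaces, modelled as real Banach spaces with a complex structure\<close>

definition cscale :: "('a::real_vector \<Rightarrow> 'a) \<Rightarrow> complex \<Rightarrow> 'a \<Rightarrow> 'a" where
  "cscale J c x = Re c *\<^sub>R x + Im c *\<^sub>R J x"

definition complex_structure :: "('a::real_normed_vector \<Rightarrow> 'a) \<Rightarrow> bool" where
  "complex_structure J \<longleftrightarrow> linear J \<and> (\<forall>x. J (J x) = - x) \<and>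
     (\<forall>c x. norm (cscale J c x) = cmod c * norm x)"

definition complex_subspace :: "('a::real_vector \<Rightarrow> 'a) \<Rightarrow> 'a set \<Rightarrow> bool" where
  "complex_subspace J S \<longleftrightarrow> subspace S \<and> J ` S \<subseteq> S"

definition finite_dim_subspace :: "'a::real_vector set \<Rightarrow> bool" where
  "finite_dim_subspace S \<longleftrightarrow> (\<exists>B. finite B \<and> span B = S)"

definition complex_linear :: "('a::real_vector \<Rightarrow> 'a) \<Rightarrow> ('a \<Rightarrow> 'a) \<Rightarrow> bool" where
  "complex_linear J p \<longleftrightarrow> linear p \<and> (\<forall>x. p (J x) = J (p x))"

definition proj_approx_seq ::
  "('a::banach \<Rightarrow> 'a) \<Rightarrow> 'i::linorder set \<Rightarrow> ('i \<Rightarrow> 'a set) \<Rightarrow> ('i \<Rightarrow> 'a \<Rightarrow> 'a) \<Rightarrow> bool" where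
  "proj_approx_seq J Ts E p \<longleftrightarrow>
     countable Ts \<and>
     (\<forall>t\<in>Ts. complex_subspace J (E t) \<and> finite_dim_subspace (E t)) \<and>
     (\<forall>s\<in>Ts. \<forall>t\<in>Ts. \<exists>u\<in>Ts. E s \<subseteq> E u \<and> E t \<subseteq> E u) \<and>
     (\<forall>s\<in>Ts. \<forall>t\<in>Ts. s \<le> t \<longleftrightarrow> E s \<subseteq> E t) \<and>
     closure (\<Union>t\<in>Ts. E t) = UNIV \<and>
     (\<exists>a. \<forall>t\<in>Ts. bounded_linear (p t) \<and> complex_linear J (p t) \<and>
          range (p t) = E t \<and> (\<forall>x\<in>E t. p t x = x) \<and>
          (\<forall>x. norm (p t x) \<le> a * norm x)) \<and>
     (\<forall>s\<in>Ts. \<forall>t\<in>Ts. p t \<circ> p s = p (min s t))"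

text \<open>A k-current on S is a map T f \<pi>, where f is a bounded Lipschitz function on S
  and \<pi> j (j < k) are Lipschitz functions on S; only the restrictions to S matter.\<close>

type_synonym 'a current = "('a \<Rightarrow> complex) \<Rightarrow> (nat \<Rightarrow> 'a \<Rightarrow> complex) \<Rightarrow> complex"

definition Lipf :: "'a::metric_space set \<Rightarrow> ('a \<Rightarrow> complex) \<Rightarrow> bool" where
  "Lipf S f \<longleftrightarrow> (\<exists>L. L-lipschitz_on S f)"

definition Lipb :: "'a::metric_space set \<Rightarrow> ('a \<Rightarrow> complex) \<Rightarrow> bool" where
  "Lipb S f \<longleftrightarrow> Lipf S f \<and> bounded (f ` S)"

definition lipconst :: "'a::metric_space set \<Rightarrow> ('a \<Rightarrow> complex) \<Rightarrow> real" where
  "lipconst S f = Inf {L. L-lipschitz_on S f}"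

definition adm :: "nat \<Rightarrow> 'a::metric_space set \<Rightarrow> ('a \<Rightarrow> complex) \<Rightarrow> (nat \<Rightarrow> 'a \<Rightarrow> complex) \<Rightarrow> bool" where
  "adm k S f \<pi> \<longleftrightarrow> Lipb S f \<and> (\<forall>j<k. Lipf S (\<pi> j))"

definition finite_radon_on :: "'a::metric_space set \<Rightarrow> 'a measure \<Rightarrow> bool" where
  "finite_radon_on S \<mu> \<longleftrightarrow> sets \<mu> = sets borel \<and> emeasure \<mu> UNIV < \<infinity> \<and>
     emeasure \<mu> (UNIV - S) = 0 \<and>
     (\<forall>A\<in>sets borel. emeasure \<mu> A = (SUP K\<in>{K. compact K \<and> K \<subseteq> A}. emeasure \<mu> K))"

definition mass_bound :: "nat \<Rightarrow> 'a::metric_space set \<Rightarrow> 'a current \<Rightarrow> 'a measure \<Rightarrow> bool" where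
  "mass_bound k S T \<mu> \<longleftrightarrow> finite_radon_on S \<mu> \<and>
     (\<forall>f \<pi>. adm k S f \<pi> \<longrightarrow>
        ennreal (cmod (T f \<pi>)) \<le>
          ennreal (\<Prod>j<k. lipconst S (\<pi> j)) * (\<integral>\<^sup>+ x. ennreal (cmod (f x)) * indicator S x \<partial>\<mu>))"

definition has_finite_mass :: "nat \<Rightarrow> 'a::metric_space set \<Rightarrow> 'a current \<Rightarrow> bool" where
  "has_finite_mass k S T \<longleftrightarrow> (\<exists>\<mu>. mass_bound k S T \<mu>)"

definition measure_le :: "'a::topological_space measure \<Rightarrow> 'a measure \<Rightarrow> bool" where
  "measure_le \<mu> \<nu> \<longleftrightarrow> (\<forall>A\<in>sets borel. emeasure \<mu> A \<le> emeasure \<nu> A)"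

definition current_mass :: "nat \<Rightarrow> 'a::metric_space set \<Rightarrow> 'a current \<Rightarrow> 'a measure" where
  "current_mass k S T = (THE \<mu>. mass_bound k S T \<mu> \<and> (\<forall>\<nu>. mass_bound k S T \<nu> \<longrightarrow> measure_le \<mu> \<nu>))"

definition metric_current :: "nat \<Rightarrow> 'a::metric_space set \<Rightarrow> 'a current \<Rightarrow> bool" where
  "metric_current k S T \<longleftrightarrow>
     \<comment> \<open>T depends only on the restrictions of its arguments to S\<close>
     (\<forall>f \<pi> g \<sigma>. adm k S f \<pi> \<longrightarrow> (\<forall>x\<in>S. f x = g x) \<longrightarrow> (\<forall>j<k. \<forall>x\<in>S. \<pi> j x = \<sigma> j x)
        \<longrightarrow> T f \<pi> = T g \<sigma>) \<and>
     \<comment> \<open>multilinearity\<close>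
     (\<forall>f g \<pi> a b. adm k S f \<pi> \<longrightarrow> Lipb S g \<longrightarrow>
        T (\<lambda>x. a * f x + b * g x) \<pi> = a * T f \<pi> + b * T g \<pi>) \<and>
     (\<forall>f \<pi> j g h a b. adm k S f \<pi> \<longrightarrow> j < k \<longrightarrow> Lipf S g \<longrightarrow> Lipf S h \<longrightarrow>
        T f (\<pi>(j := (\<lambda>x. a * g x + b * h x))) = a * T f (\<pi>(j := g)) + b * T f (\<pi>(j := h))) \<and>
     \<comment> \<open>continuity under pointwise convergence with uniformly bounded Lipschitz constants\<close>
     (\<forall>f \<pi> \<pi>s. adm k S f \<pi> \<longrightarrow> (\<forall>n. \<forall>j<k. Lipf S (\<pi>s n j)) \<longrightarrow>
        (\<forall>j<k. \<forall>x\<in>S. (\<lambda>n. \<pi>s n j x) \<longlonglongrightarrow> \<pi> j x) \<longrightarrow>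
        (\<exists>L. \<forall>n. \<forall>j<k. lipconst S (\<pi>s n j) \<le> L) \<longrightarrow>
        (\<lambda>n. T f (\<pi>s n)) \<longlonglongrightarrow> T f \<pi>) \<and>
     \<comment> \<open>locality\<close>
     (\<forall>f \<pi> j. adm k S f \<pi> \<longrightarrow> j < k \<longrightarrow>
        (\<exists>U c. open U \<and> closure {x\<in>S. f x \<noteq> 0} \<inter> S \<subseteq> U \<and> (\<forall>x\<in>U \<inter> S. \<pi> j x = c)) \<longrightarrow>
        T f \<pi> = 0) \<and>
     \<comment> \<open>finite mass\<close>
     has_finite_mass k S T"

definition bdry :: "'a current \<Rightarrow> 'a current" where
  "bdry T = (\<lambda>f \<pi>. T (\<lambda>_. 1) (\<lambda>j. if j = 0 then f else \<pi> (j - 1)))"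

definition normal_current :: "nat \<Rightarrow> 'a::metric_space set \<Rightarrow> 'a current \<Rightarrow> bool" where
  "normal_current k S T \<longleftrightarrow> metric_current k S T \<and> (0 < k \<longrightarrow> has_finite_mass (k - 1) S (bdry T))"

definition push :: "('a \<Rightarrow> 'b) \<Rightarrow> 'a current \<Rightarrow> 'b current" where
  "push \<phi> T = (\<lambda>f \<pi>. T (f \<circ> \<phi>) (\<lambda>j. \<pi> j \<circ> \<phi>))"

end

theory Submission
  imports Defs
begin

text \<open>
  The limit current is \<open>T(f, \<pi>) = lim T\<^sub>t(f, \<pi>)\<close> along a cofinal sequence of indices. Since
  \<open>T\<^sub>s(f, \<pi>) = T\<^sub>t(f \<circ> p\<^sub>s, \<pi> \<circ> p\<^sub>s)\<close> for \<open>s \<le> t\<close>, both the existence of the limit and its continuity in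
  \<open>\<pi>\<close> follow from a bound, uniform in \<open>t\<close>, of \<open>T\<^sub>t(f, \<pi>) - T\<^sub>t(f, \<sigma>)\<close> by the integrals of the truncated differences
  \<open>min \<bar>\<pi>\<^sub>j - \<sigma>\<^sub>j\<bar> 3\<close> against the two mass measures; dominated convergence for \<open>\<mu>\<close> and \<open>\<nu>\<close> then applies because
  \<open>p\<^sub>t x \<longlonglongrightarrow> x\<close>. The bound comes from moving the slot of the difference to the front (currents are
  alternating) and integrating by parts. Both facts follow from the chain rule for one real function, which needs
  only locality and finite mass. To use the hypothesis on the mass measures one also has to show that a least
  mass bound exists, as the mass is defined by a definite description.
\<close>

section \<open>Lipschitz functions\<close>

text \<open>The continuity axiom is qualitative: for each \<open>T\<^sub>t\<close> separately it
  gives convergence without a rate, so it says nothing uniform in \<open>t\<close>. Only the two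
  mass measures control all \<open>T\<^sub>t\<close> simultaneously, and continuity of the limit has
  to be rederived from them. A difference in a slot enters the mass bound through its Lipschitz
  constant, which does not become small. Integration by parts makes it enter through its values
  instead, at the price of a boundary term, whence the second measure. Lipschitz functions may be
  unbounded while the measures are merely finite, so these values are truncated before they are
  integrated.

  The chain rule is applied to the square, which gives the product rule, and to sines of high
  frequency, which gives alternation; complex functions follow by bilinearity.

  Two mass bounds need not be comparable as measures. Yet a current obeys the smaller of the two:
  the first argument is split by a Lipschitz cutoff and each half is estimated by its own measure.
  The bounds thus admit minima, and a least one can be found by minimising total mass.\<close>

lemma lipconst_le: "L-lipschitz_on S f \<Longrightarrow> lipconst S f \<le> L"
  unfolding lipconst_def
  by (rule cInf_lower) (auto intro!: bdd_belowI[of _ 0] dest: lipschitz_on_nonneg)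

text \<open>The infimum is attained: for two points at positive distance, the quotient of the
  distances is a lower bound of all Lipschitz constants, hence of their infimum.\<close>

lemma lipconst_lipschitz_on:
  assumes "Lipf S f"
  shows "(lipconst S f)-lipschitz_on S f"
proof -
  let ?X = "{L. L-lipschitz_on S f}"
  have ne: "?X \<noteq> {}" using assms by (auto simp: Lipf_def)
  show ?thesis
  proof (rule lipschitz_onI)
    show "0 \<le> lipconst S f"
      unfolding lipconst_def using ne
      by (intro cInf_greatest) (auto dest: lipschitz_on_nonneg)
    fix x y assume xy: "x \<in> S" "y \<in> S"
    show "dist (f x) (f y) \<le> lipconst S f * dist x y"
    proof (cases "dist x y = 0")
      case False
      then have pos: "dist x y > 0" by simp
      have "dist (f x) (f y) / dist x y \<le> Inf ?X"
      proof (rule cInf_greatest[OF ne])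
        fix L assume "L \<in> ?X"
        then have "dist (f x) (f y) \<le> L * dist x y" using xy by (auto dest: lipschitz_onD)
        then show "dist (f x) (f y) / dist x y \<le> L" using pos by (simp add: field_simps)
      qed
      then show ?thesis using pos by (simp add: lipconst_def field_simps)
    qed auto
  qed
qed

lemma lipconst_nonneg: "Lipf S f \<Longrightarrow> 0 \<le> lipconst S f"
  using lipconst_lipschitz_on lipschitz_on_nonneg by blast

lemma LipfI: "L-lipschitz_on S f \<Longrightarrow> Lipf S f"
  by (auto simp: Lipf_def)

lemma LipbI: "L-lipschitz_on S f \<Longrightarrow> (\<And>x. x \<in> S \<Longrightarrow> cmod (f x) \<le> B) \<Longrightarrow> Lipb S f"
  by (auto simp: Lipb_def Lipf_def bounded_iff)

lemma LipbE:
  assumes "Lipb S f"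
  obtains L B where "L-lipschitz_on S f" "0 \<le> B" "\<And>x. x \<in> S \<Longrightarrow> cmod (f x) \<le> B"
proof -
  obtain L B where "L-lipschitz_on S f" "\<And>x. x \<in> S \<Longrightarrow> cmod (f x) \<le> B"
    using assms by (auto simp: Lipb_def Lipf_def bounded_iff)
  then show thesis using that[of L "max 0 B"] by (auto simp: le_max_iff_disj)
qed

lemma Lipf_of_Lipb: "Lipb S f \<Longrightarrow> Lipf S f"
  by (simp add: Lipb_def)

lemma Lipf_continuous_on: "Lipf S f \<Longrightarrow> continuous_on S f"
  by (auto simp: Lipf_def intro: lipschitz_on_continuous_on)

lemma Lipf_subset: "Lipf S f \<Longrightarrow> A \<subseteq> S \<Longrightarrow> Lipf A f"
  by (auto simp: Lipf_def intro: lipschitz_on_subset)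

lemma Lipb_subset: "Lipb S f \<Longrightarrow> A \<subseteq> S \<Longrightarrow> Lipb A f"
  by (auto simp: Lipb_def intro: Lipf_subset bounded_subset image_mono)

text \<open>The constant is made explicit because the estimate in \<open>slot_zero_bound\<close> has
  to be uniform over all currents of the system.\<close>

lemma lipschitz_on_mult_bounded:
  fixes f g :: "'a::metric_space \<Rightarrow> 'b::real_normed_algebra"
  assumes "C-lipschitz_on S f" "D-lipschitz_on S g"
    and "\<And>x. x \<in> S \<Longrightarrow> norm (f x) \<le> A" "\<And>x. x \<in> S \<Longrightarrow> norm (g x) \<le> B" "0 \<le> A" "0 \<le> B"
  shows "(A * D + B * C)-lipschitz_on S (\<lambda>x. f x * g x)"
proof (rule lipschitz_onI)
  have C: "0 \<le> C" "0 \<le> D" using assms(1,2) lipschitz_on_nonneg by auto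
  then show "0 \<le> A * D + B * C" using assms by simp
  fix x y assume xy: "x \<in> S" "y \<in> S"
  have "f x * g x - f y * g y = f x * (g x - g y) + (f x - f y) * g y"
    by (simp add: algebra_simps)
  then have "dist (f x * g x) (f y * g y) \<le> norm (f x) * norm (g x - g y) + norm (f x - f y) * norm (g y)"
    by (metis dist_norm norm_add_rule_thm norm_mult_ineq)
  also have "\<dots> \<le> A * (D * dist x y) + (C * dist x y) * B"
    using lipschitz_onD[OF assms(1) xy] lipschitz_onD[OF assms(2) xy] assms(3)[OF xy(1)] assms(4)[OF xy(2)] assms(5,6) C
    by (intro add_mono mult_mono) (auto simp: dist_norm)
  finally show "dist (f x * g x) (f y * g y) \<le> (A * D + B * C) * dist x y"
    by (simp add: algebra_simps)
qed

lemma Lipf_compose: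
  assumes "Lipf S f" "L-lipschitz_on UNIV h"
  shows "Lipf S (\<lambda>x. h (f x))"
  using assms lipschitz_on_compose2[of _ S f L h] lipschitz_on_subset[of L UNIV h]
  by (auto simp: Lipf_def)

lemma Lipf_const: "Lipf S (\<lambda>x. c)"
  by (rule LipfI[OF lipschitz_on_constant])

lemma lipschitz_on_cmult_complex:
  fixes f :: "'a::metric_space \<Rightarrow> complex"
  assumes "L-lipschitz_on S f"
  shows "(cmod c * L)-lipschitz_on S (\<lambda>x. c * f x)"
proof (rule lipschitz_onI)
  show "0 \<le> cmod c * L" using lipschitz_on_nonneg[OF assms] by simp
  fix x y assume "x \<in> S" "y \<in> S"
  then have "dist (f x) (f y) \<le> L * dist x y" using assms by (auto dest: lipschitz_onD)
  then show "dist (c * f x) (c * f y) \<le> cmod c * L * dist x y"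
    by (simp add: dist_norm norm_mult mult_left_mono mult.assoc flip: right_diff_distrib)
qed

lemma Lipf_cmult: "Lipf S f \<Longrightarrow> Lipf S (\<lambda>x. c * f x)"
  using lipschitz_on_cmult_complex by (fastforce simp: Lipf_def)

lemma Lipf_add: "Lipf S f \<Longrightarrow> Lipf S g \<Longrightarrow> Lipf S (\<lambda>x. f x + g x)"
  by (auto simp: Lipf_def intro: lipschitz_on_add)

lemma Lipf_diff: "Lipf S f \<Longrightarrow> Lipf S g \<Longrightarrow> Lipf S (\<lambda>x. f x - g x)"
  by (auto simp: Lipf_def intro: lipschitz_on_diff)

lemma Lipb_const: "Lipb S (\<lambda>x. c)"
  by (rule LipbI[OF lipschitz_on_constant, of _ _ "cmod c"]) simp

lemma Lipb_mult:
  assumes "Lipb S f" "Lipb S g"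
  shows "Lipb S (\<lambda>x. f x * g x)"
proof -
  obtain L B where f: "L-lipschitz_on S f" "0 \<le> B" "\<And>x. x \<in> S \<Longrightarrow> cmod (f x) \<le> B"
    using LipbE[OF assms(1)] by blast
  obtain L' B' where g: "L'-lipschitz_on S g" "0 \<le> B'" "\<And>x. x \<in> S \<Longrightarrow> cmod (g x) \<le> B'"
    using LipbE[OF assms(2)] by blast
  show ?thesis
    using f g by (intro LipbI[OF lipschitz_on_mult_bounded[OF f(1) g(1) f(3) g(3)], of "B * B'"])
      (auto simp: norm_mult intro!: mult_mono)
qed

lemma Lipb_cmult: "Lipb S f \<Longrightarrow> Lipb S (\<lambda>x. c * f x)"
  by (rule Lipb_mult[OF Lipb_const])

lemma Lipb_add: "Lipb S f \<Longrightarrow> Lipb S g \<Longrightarrow> Lipb S (\<lambda>x. f x + g x)"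
  by (auto simp: Lipb_def Lipf_add bounded_plus_comp)

lemma Lipb_diff: "Lipb S f \<Longrightarrow> Lipb S g \<Longrightarrow> Lipb S (\<lambda>x. f x - g x)"
  by (auto simp: Lipb_def Lipf_diff bounded_minus_comp)

lemma lipschitz_on_of_real_iff [simp]:
  "L-lipschitz_on S (\<lambda>x. complex_of_real (g x)) \<longleftrightarrow> L-lipschitz_on S g"
  by (auto simp: lipschitz_on_def dist_norm simp flip: of_real_diff)

lemma Lipf_Re_Im:
  assumes "Lipf S u"
  shows "Lipf S (\<lambda>x. complex_of_real (Re (u x)))" "Lipf S (\<lambda>x. complex_of_real (Im (u x)))"
proof -
  have "1-lipschitz_on UNIV (\<lambda>z. complex_of_real (Re z))" "1-lipschitz_on UNIV (\<lambda>z. complex_of_real (Im z))"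
    using abs_Re_le_cmod abs_Im_le_cmod
    by (auto intro!: lipschitz_onI simp: dist_norm simp flip: of_real_diff minus_complex.simps)
  from Lipf_compose[OF assms this(1)] Lipf_compose[OF assms this(2)]
  show "Lipf S (\<lambda>x. complex_of_real (Re (u x)))" "Lipf S (\<lambda>x. complex_of_real (Im (u x)))" .
qed

lemma Lipb_Re_Im:
  assumes "Lipb S u"
  shows "Lipb S (\<lambda>x. complex_of_real (Re (u x)))" "Lipb S (\<lambda>x. complex_of_real (Im (u x)))"
proof -
  obtain L B where "\<And>x. x \<in> S \<Longrightarrow> cmod (u x) \<le> B" using LipbE[OF assms] by blast
  then have "\<And>x. x \<in> S \<Longrightarrow> \<bar>Re (u x)\<bar> \<le> B \<and> \<bar>Im (u x)\<bar> \<le> B"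
    by (meson abs_Re_le_cmod abs_Im_le_cmod order_trans)
  then show "Lipb S (\<lambda>x. complex_of_real (Re (u x)))" "Lipb S (\<lambda>x. complex_of_real (Im (u x)))"
    using Lipf_Re_Im[OF Lipf_of_Lipb[OF assms]] by (auto simp: Lipb_def bounded_iff)
qed

text \<open>Transfers a symmetric bilinear identity from real to complex functions: linearity in the
  first argument removes reality there, and symmetry lets the same step be repeated for the second.
  \<open>Q\<close> will be \<open>Lipb S\<close> for the product rule and \<open>Lipf S\<close> for
  alternation.\<close>

lemma complexify:
  fixes P :: "('a \<Rightarrow> complex) \<Rightarrow> ('a \<Rightarrow> complex) \<Rightarrow> bool"
  assumes ReIm: "\<And>u. Q u \<Longrightarrow> Q (\<lambda>x. complex_of_real (Re (u x))) \<and> Q (\<lambda>x. complex_of_real (Im (u x)))"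
    and real: "\<And>u v. Q (\<lambda>x. complex_of_real (u x)) \<Longrightarrow> Q (\<lambda>x. complex_of_real (v x)) \<Longrightarrow>
      P (\<lambda>x. complex_of_real (u x)) (\<lambda>x. complex_of_real (v x))"
    and sym: "\<And>u v. P u v \<Longrightarrow> P v u"
    and lin: "\<And>u1 u2 v. Q u1 \<Longrightarrow> Q u2 \<Longrightarrow> Q v \<Longrightarrow> P u1 v \<Longrightarrow> P u2 v \<Longrightarrow> P (\<lambda>x. u1 x + \<i> * u2 x) v"
    and "Q u" "Q v"
  shows "P u v"
proof -
  have eq: "(\<lambda>x. complex_of_real (Re (u x)) + \<i> * complex_of_real (Im (u x))) = u" for u :: "'a \<Rightarrow> complex"
    by (simp add: complex_eq[symmetric])
  have half: "P u (\<lambda>x. complex_of_real (v x))" if "Q u" "Q (\<lambda>x. complex_of_real (v x))" for u v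
    using lin[OF _ _ that(2) real[OF _ that(2)] real[OF _ that(2)]] ReIm[OF that(1)] eq[of u] by metis
  show ?thesis
    using lin[OF _ _ \<open>Q u\<close> sym[OF half[OF \<open>Q u\<close>]] sym[OF half[OF \<open>Q u\<close>]]] ReIm[OF \<open>Q v\<close>] eq[of v] sym by metis
qed

lemma adm_fun_upd: "adm k S f \<pi> \<Longrightarrow> Lipf S g \<Longrightarrow> adm k S f (\<pi>(j := g))"
  by (auto simp: adm_def)

lemma adm_first: "adm k S f \<pi> \<Longrightarrow> Lipb S g \<Longrightarrow> adm k S g \<pi>"
  by (auto simp: adm_def)

lemma admD: "adm k S f \<pi> \<Longrightarrow> Lipb S f" "adm k S f \<pi> \<Longrightarrow> j < k \<Longrightarrow> Lipf S (\<pi> j)"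
  by (auto simp: adm_def)

lemma adm_subset: "adm k S f \<pi> \<Longrightarrow> A \<subseteq> S \<Longrightarrow> adm k A f \<pi>"
  by (auto simp: adm_def intro: Lipb_subset Lipf_subset)

section \<open>Existence of the mass measure\<close>

text \<open>Countably many compact subsets of \<open>A\<close> exhaust it up to a
  \<open>\<mu>\<close>-null set, which is then \<open>\<nu>\<close>-null. Their finite unions
  \<open>V n\<close> are compact and increase, so continuity from below gives inner regularity of
  \<open>\<nu>\<close>.\<close>

lemma finite_radon_on_absolutely_continuous:
  assumes mu: "finite_radon_on S \<mu>" and ac: "absolutely_continuous \<mu> \<nu>"
    and sets: "sets \<nu> = sets borel" and fin: "emeasure \<nu> UNIV < \<infinity>" and S: "S \<in> sets borel"
  shows "finite_radon_on S \<nu>"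
proof -
  have sets_mu [simp]: "sets \<mu> = sets borel" and fin_mu: "emeasure \<mu> UNIV < \<infinity>"
    and reg: "\<And>A. A \<in> sets borel \<Longrightarrow> emeasure \<mu> A = (SUP K\<in>{K. compact K \<and> K \<subseteq> A}. emeasure \<mu> K)"
    using mu by (auto simp: finite_radon_on_def)
  note [simp] = sets
  have null: "emeasure \<nu> A = 0" if "emeasure \<mu> A = 0" "A \<in> sets borel" for A
    using that ac by (auto simp: absolutely_continuous_def null_sets_def)
  have "emeasure \<nu> A = (SUP K\<in>{K. compact K \<and> K \<subseteq> A}. emeasure \<nu> K)" if A: "A \<in> sets borel" for A
  proof (rule antisym)
    show "(SUP K\<in>{K. compact K \<and> K \<subseteq> A}. emeasure \<nu> K) \<le> emeasure \<nu> A"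
      using A by (intro SUP_least emeasure_mono) auto
    let ?C = "{K. compact K \<and> K \<subseteq> A}"
    have "\<exists>f::nat \<Rightarrow> ennreal. range f \<subseteq> emeasure \<mu> ` ?C \<and> Sup (emeasure \<mu> ` ?C) = Sup (f ` UNIV)"
      by (rule ennreal_SUP_countable_SUP) auto
    then obtain u :: "nat \<Rightarrow> ennreal" where u: "range u \<subseteq> emeasure \<mu> ` ?C" "Sup (emeasure \<mu> ` ?C) = Sup (u ` UNIV)"
      by auto
    then have "\<forall>n. \<exists>K. K \<in> ?C \<and> u n = emeasure \<mu> K" by auto
    then obtain K where K: "\<And>n. K n \<in> ?C" "\<And>n. u n = emeasure \<mu> (K n)" by metis
    have Kb [measurable]: "K n \<in> sets borel" for n using K(1)[of n] by (auto intro: borel_compact)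
    define V where "V n = (\<Union>i\<le>n. K i)" for n
    have V: "V n \<in> ?C" for n using K(1) by (auto simp: V_def intro!: compact_UN)
    have Vb [measurable]: "V n \<in> sets borel" for n by (auto simp: V_def)
    have "emeasure \<mu> A \<le> emeasure \<mu> (\<Union>n. K n)"
      unfolding reg[OF A] u(2) K(2) by (intro SUP_least emeasure_mono) auto
    moreover have sub: "(\<Union>n. K n) \<subseteq> A" using K(1) by auto
    ultimately have "emeasure \<mu> (A - (\<Union>n. K n)) = 0"
      using A fin_mu emeasure_mono[of "\<Union>n. K n" UNIV \<mu>]
      by (subst emeasure_Diff) (auto simp: diff_eq_0_iff_ennreal top_unique)
    then have "emeasure \<nu> (A - (\<Union>n. K n)) = 0" using A by (intro null) auto
    then have "emeasure \<nu> A \<le> emeasure \<nu> (\<Union>n. K n)"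
      using emeasure_subadditive[of "A - (\<Union>n. K n)" \<nu> "\<Union>n. K n"] A sub
      by (auto simp: Un_absorb2)
    also have "(\<Union>n. K n) = (\<Union>n. V n)" by (auto simp: V_def)
    also have "emeasure \<nu> (\<Union>n. V n) = (SUP n. emeasure \<nu> (V n))"
    proof (rule SUP_emeasure_incseq[symmetric])
      show "incseq V" unfolding V_def by (intro monoI UN_mono) auto
    qed auto
    also have "\<dots> \<le> (SUP K\<in>?C. emeasure \<nu> K)" using V by (intro SUP_mono) blast
    finally show "emeasure \<nu> A \<le> (SUP K\<in>?C. emeasure \<nu> K)" .
  qed
  moreover have "emeasure \<nu> (UNIV - S) = 0" using mu S by (intro null) (auto simp: finite_radon_on_def)
  ultimately show ?thesis using fin by (auto simp: finite_radon_on_def)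
qed

lemma borel_measurable_cmod_indicator:
  assumes "S \<in> sets borel" "Lipf S f"
  shows "(\<lambda>x. ennreal (cmod (f x)) * indicator S x) \<in> borel_measurable borel"
proof -
  have "(\<lambda>x. indicator S x *\<^sub>R cmod (f x)) \<in> borel_measurable borel"
    using assms by (intro borel_measurable_continuous_on_indicator continuous_intros Lipf_continuous_on)
  then have "(\<lambda>x. ennreal (indicator S x *\<^sub>R cmod (f x))) \<in> borel_measurable borel"
    by (rule measurable_compose) simp
  then show ?thesis
    by (rule measurable_cong[THEN iffD1, rotated]) (auto simp: indicator_def)
qed

lemma nn_integral_Lipb_finite:
  assumes S: "S \<in> sets borel" and f: "Lipb S f" and sets: "sets M = sets borel" and fin: "emeasure M UNIV < \<infinity>"
  shows "(\<integral>\<^sup>+ x. ennreal (cmod (f x)) * indicator S x \<partial>M) < \<infinity>"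
proof -
  obtain L B where B: "L-lipschitz_on S f" "0 \<le> B" "\<And>x. x \<in> S \<Longrightarrow> cmod (f x) \<le> B" using LipbE[OF f] by blast
  have "(\<integral>\<^sup>+ x. ennreal (cmod (f x)) * indicator S x \<partial>M) \<le> (\<integral>\<^sup>+ x. ennreal B \<partial>M)"
    using B by (intro nn_integral_mono) (auto simp: indicator_def ennreal_leI)
  also have "\<dots> = ennreal B * emeasure M UNIV" using sets_eq_imp_space_eq[OF sets] by simp
  also have "\<dots> < \<infinity>" using fin by (simp add: ennreal_mult_less_top)
  finally show ?thesis .
qed

section \<open>Gluing and minimising mass bounds\<close>

text \<open>Isolates the property of \<open>T\<close> on which gluing rests, so that the same
  argument serves a current and its boundary.\<close>

definition additive_current :: "nat \<Rightarrow> 'a::metric_space set \<Rightarrow> 'a current \<Rightarrow> bool" where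
  "additive_current k S T \<longleftrightarrow>
     (\<forall>f g \<pi>. adm k S f \<pi> \<longrightarrow> Lipb S g \<longrightarrow> T (\<lambda>x. f x + g x) \<pi> = T f \<pi> + T g \<pi>)"

text \<open>Lipschitz cutoffs \<open>\<rho> n\<close> decrease to the indicator of \<open>K\<close>.
  Splitting \<open>f\<close> into \<open>f * \<rho> n\<close> and \<open>f * (1 - \<rho> n)\<close>
  and estimating the pieces by \<open>\<nu>1\<close> and \<open>\<nu>2\<close> leaves the slots, and
  hence the product of Lipschitz constants, untouched; dominated convergence finishes.\<close>

lemma mass_bound_glue_closed:
  assumes T: "additive_current k S T" and S: "S \<in> sets borel"
    and b1: "mass_bound k S T \<nu>1" and b2: "mass_bound k S T \<nu>2" and adm: "adm k S f \<pi>"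
    and K: "closed K" "K \<noteq> {}"
  shows "ennreal (cmod (T f \<pi>)) \<le> ennreal (\<Prod>j<k. lipconst S (\<pi> j)) *
     ((\<integral>\<^sup>+ x. (ennreal (cmod (f x)) * indicator S x) * indicator K x \<partial>\<nu>1) +
      (\<integral>\<^sup>+ x. (ennreal (cmod (f x)) * indicator S x) * indicator (- K) x \<partial>\<nu>2))"
proof -
  let ?P = "ennreal (\<Prod>j<k. lipconst S (\<pi> j))"
  let ?F = "\<lambda>x. ennreal (cmod (f x)) * indicator S x"
  have sets [simp, measurable_cong]: "sets \<nu>1 = sets borel" "sets \<nu>2 = sets borel"
    and fin: "emeasure \<nu>1 UNIV < \<infinity>" "emeasure \<nu>2 UNIV < \<infinity>"
    using b1 b2 by (auto simp: mass_bound_def finite_radon_on_def)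
  have Fm [measurable]: "?F \<in> borel_measurable borel"
    using S admD(1)[OF adm] by (intro borel_measurable_cmod_indicator Lipf_of_Lipb)
  have [measurable]: "K \<in> sets borel" using K by simp
  \<comment> \<open>For empty \<open>K\<close>, \<open>infdist\<close> is 0 by convention and the
    cutoff would be constantly 1; this is why \<open>K\<close> is assumed nonempty.\<close>
  define \<rho> :: "nat \<Rightarrow> 'a \<Rightarrow> real" where "\<rho> n x = max 0 (1 - real n * infdist x K)" for n x
  have \<rho>01: "0 \<le> \<rho> n x" "\<rho> n x \<le> 1" for n x by (auto simp: \<rho>_def infdist_nonneg)
  have \<rho>m [measurable]: "\<rho> n \<in> borel_measurable borel" for n
    unfolding \<rho>_def by (intro borel_measurable_continuous_onI continuous_intros)
  have lip: "(real n)-lipschitz_on S (\<rho> n)" for n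
  proof (rule lipschitz_onI)
    fix x y :: 'a
    have "\<bar>real n * infdist x K - real n * infdist y K\<bar> \<le> real n * dist x y"
      using infdist_triangle_abs[of x K y] by (simp add: abs_mult mult_left_mono flip: right_diff_distrib)
    then show "dist (\<rho> n x) (\<rho> n y) \<le> real n * dist x y" by (auto simp: \<rho>_def dist_real_def)
  qed simp
  have Lr: "Lipb S (\<lambda>x. complex_of_real (\<rho> n x))" for n
    using lip[of n] \<rho>01 by (intro LipbI[of "real n" S _ 1]) auto
  have Lr': "Lipb S (\<lambda>x. complex_of_real (1 - \<rho> n x))" for n
    using Lipb_diff[OF Lipb_const[of S 1] Lr[of n]] by simp
  have lim: "(\<lambda>n. ennreal (\<rho> n x)) \<longlonglongrightarrow> indicator K x" "(\<lambda>n. ennreal (1 - \<rho> n x)) \<longlonglongrightarrow> indicator (- K) x" for x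
  proof -
    have "(\<lambda>n. \<rho> n x) \<longlonglongrightarrow> indicator K x"
    proof (cases "x \<in> K")
      case True then show ?thesis by (simp add: \<rho>_def)
    next
      case False
      then have d: "infdist x K > 0"
        using K by (intro infdist_pos_not_in_closed) auto
      obtain N where N: "real N * infdist x K > 1" using reals_Archimedean3[OF d] by blast
      have "\<rho> n x = 0" if "n \<ge> N" for n
      proof -
        have "real N * infdist x K \<le> real n * infdist x K" using that d by simp
        then show ?thesis using N by (simp add: \<rho>_def)
      qed
      then have "eventually (\<lambda>n. \<rho> n x = 0) sequentially" by (auto simp: eventually_sequentially)
      then show ?thesis using False by (simp add: tendsto_eventually)
    qed
    moreover from tendsto_diff[OF tendsto_const[of 1] this]
    have "(\<lambda>n. 1 - \<rho> n x) \<longlonglongrightarrow> indicator (- K) x" by (cases "x \<in> K") simp_all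
    ultimately show "(\<lambda>n. ennreal (\<rho> n x)) \<longlonglongrightarrow> indicator K x" "(\<lambda>n. ennreal (1 - \<rho> n x)) \<longlonglongrightarrow> indicator (- K) x"
      by (auto dest!: tendsto_ennrealI simp: ennreal_indicator)
  qed
  have bnd: "ennreal (cmod (T f \<pi>)) \<le> ?P * ((\<integral>\<^sup>+ x. ?F x * ennreal (\<rho> n x) \<partial>\<nu>1) + (\<integral>\<^sup>+ x. ?F x * ennreal (1 - \<rho> n x) \<partial>\<nu>2))" for n
  proof -
    let ?f1 = "\<lambda>x. f x * complex_of_real (\<rho> n x)" and ?f2 = "\<lambda>x. f x * complex_of_real (1 - \<rho> n x)"
    have a1: "adm k S ?f1 \<pi>" and a2: "adm k S ?f2 \<pi>"
      using adm_first[OF adm Lipb_mult[OF admD(1)[OF adm] Lr]] adm_first[OF adm Lipb_mult[OF admD(1)[OF adm] Lr']] by auto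
    have e1: "(\<integral>\<^sup>+ x. ennreal (cmod (?f1 x)) * indicator S x \<partial>\<nu>1) = (\<integral>\<^sup>+ x. ?F x * ennreal (\<rho> n x) \<partial>\<nu>1)"
      by (intro nn_integral_cong) (simp add: norm_mult \<rho>01 ennreal_mult mult_ac)
    have e2: "(\<integral>\<^sup>+ x. ennreal (cmod (?f2 x)) * indicator S x \<partial>\<nu>2) = (\<integral>\<^sup>+ x. ?F x * ennreal (1 - \<rho> n x) \<partial>\<nu>2)"
      using \<rho>01 by (intro nn_integral_cong) (simp add: norm_mult ennreal_mult mult_ac del: of_real_diff)
    have "T (\<lambda>x. ?f1 x + ?f2 x) \<pi> = T ?f1 \<pi> + T ?f2 \<pi>"
      using T a1 admD(1)[OF a2] unfolding additive_current_def by blast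
    moreover have "(\<lambda>x. ?f1 x + ?f2 x) = f" by (auto simp: algebra_simps)
    ultimately have "T f \<pi> = T ?f1 \<pi> + T ?f2 \<pi>" by simp
    then have "ennreal (cmod (T f \<pi>)) \<le> ennreal (cmod (T ?f1 \<pi>)) + ennreal (cmod (T ?f2 \<pi>))"
      by (simp add: norm_triangle_ineq flip: ennreal_plus)
    also have "\<dots> \<le> ?P * (\<integral>\<^sup>+ x. ennreal (cmod (?f1 x)) * indicator S x \<partial>\<nu>1) + ?P * (\<integral>\<^sup>+ x. ennreal (cmod (?f2 x)) * indicator S x \<partial>\<nu>2)"
      using b1 b2 a1 a2 by (intro add_mono) (simp_all add: mass_bound_def)
    finally show ?thesis unfolding e1 e2 by (simp add: distrib_left)
  qed
  have Ffin: "?F x < \<infinity>" for x by (simp add: indicator_def)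
  have mono1: "?F x * ennreal (\<rho> n x) \<le> ?F x" "?F x * ennreal (1 - \<rho> n x) \<le> ?F x" for n x
    using \<rho>01[of n x] mult_left_mono[of "ennreal (\<rho> n x)" 1 "?F x"] mult_left_mono[of "ennreal (1 - \<rho> n x)" 1 "?F x"]
    by (auto simp: ennreal_le_1)
  have l1: "(\<lambda>n. \<integral>\<^sup>+ x. ?F x * ennreal (\<rho> n x) \<partial>\<nu>1) \<longlonglongrightarrow> (\<integral>\<^sup>+ x. ?F x * indicator K x \<partial>\<nu>1)"
    using mono1 lim Ffin nn_integral_Lipb_finite[OF S admD(1)[OF adm] sets(1) fin(1)]
    by (intro nn_integral_dominated_convergence[where w = ?F]) (auto intro!: ennreal_tendsto_cmult)
  have l2: "(\<lambda>n. \<integral>\<^sup>+ x. ?F x * ennreal (1 - \<rho> n x) \<partial>\<nu>2) \<longlonglongrightarrow> (\<integral>\<^sup>+ x. ?F x * indicator (- K) x \<partial>\<nu>2)"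
    using mono1 lim Ffin nn_integral_Lipb_finite[OF S admD(1)[OF adm] sets(2) fin(2)]
    by (intro nn_integral_dominated_convergence[where w = ?F]) (auto intro!: ennreal_tendsto_cmult)
  show ?thesis
    by (rule LIMSEQ_le_const[OF ennreal_tendsto_cmult[OF _ tendsto_add[OF l1 l2]]]) (use bnd in auto)
qed

text \<open>Inner regularity of \<open>\<nu>2\<close> gives a compact \<open>K\<close> inside
  \<open>A\<close> with \<open>A - K\<close> of small \<open>\<nu>2\<close>-measure. Passing from
  \<open>A\<close> to \<open>K\<close> shrinks the \<open>\<nu>1\<close>-integral and enlarges the
  \<open>\<nu>2\<close>-integral by at most \<open>B * e\<close>.\<close>

lemma mass_bound_glue:
  assumes T: "additive_current k S T" and S: "S \<in> sets borel"
    and b1: "mass_bound k S T \<nu>1" and b2: "mass_bound k S T \<nu>2" and adm: "adm k S f \<pi>"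
    and A: "A \<in> sets borel"
  shows "ennreal (cmod (T f \<pi>)) \<le> ennreal (\<Prod>j<k. lipconst S (\<pi> j)) *
     ((\<integral>\<^sup>+ x. (ennreal (cmod (f x)) * indicator S x) * indicator A x \<partial>\<nu>1) +
      (\<integral>\<^sup>+ x. (ennreal (cmod (f x)) * indicator S x) * indicator (- A) x \<partial>\<nu>2))" (is "_ \<le> ?P * (?I1 A + ?I2 A)")
proof -
  let ?F = "\<lambda>x. ennreal (cmod (f x)) * indicator S x"
  have sets [simp, measurable_cong]: "sets \<nu>1 = sets borel" "sets \<nu>2 = sets borel"
    and fin: "emeasure \<nu>2 UNIV < \<infinity>"
    and reg: "emeasure \<nu>2 A = (SUP K\<in>{K. compact K \<and> K \<subseteq> A}. emeasure \<nu>2 K)"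
    using b1 b2 A by (auto simp: mass_bound_def finite_radon_on_def)
  have Fm [measurable]: "?F \<in> borel_measurable borel"
    using S admD(1)[OF adm] by (intro borel_measurable_cmod_indicator Lipf_of_Lipb)
  note [measurable] = A
  obtain L B where B: "L-lipschitz_on S f" "0 \<le> B" "\<And>x. x \<in> S \<Longrightarrow> cmod (f x) \<le> B" using LipbE[OF admD(1)[OF adm]] by blast
  have step: "ennreal (cmod (T f \<pi>)) \<le> ?P * (?I1 A + ?I2 A + ennreal B * ennreal e)" if e: "e > 0" for e
  proof -
    have "emeasure \<nu>2 A < \<infinity>" using fin emeasure_mono[of A UNIV \<nu>2] by (auto intro: le_less_trans)
    then have "\<exists>K\<in>{K. compact K \<and> K \<subseteq> A}. emeasure \<nu>2 A < emeasure \<nu>2 K + ennreal e"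
      using e by (intro SUP_approx_ennreal[OF _ _ reg]) auto
    then obtain K where K: "compact K" "K \<subseteq> A" "emeasure \<nu>2 A < emeasure \<nu>2 K + ennreal e" by auto
    have [measurable]: "K \<in> sets borel" using K by (simp add: borel_compact)
    have "emeasure \<nu>2 K < \<infinity>" using fin emeasure_mono[of K UNIV \<nu>2] by (auto intro: le_less_trans)
    then have AK: "emeasure \<nu>2 (A - K) \<le> ennreal e"
      using K by (subst emeasure_Diff) (auto simp: ennreal_minus_le_iff less_imp_le)
    have bK: "ennreal (cmod (T f \<pi>)) \<le> ?P * (?I1 K + ?I2 K)"
    proof (cases "K = {}")
      \<comment> \<open>Gluing along the empty set is the bound by \<open>\<nu>2\<close>
        alone.\<close>
      case True
      then show ?thesis using b2 adm by (simp add: mass_bound_def)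
    next
      case False
      show ?thesis
        using mass_bound_glue_closed[OF T S b1 b2 adm _ False] K(1) compact_imp_closed by blast
    qed
    have "?I1 K \<le> ?I1 A" using K(2) by (intro nn_integral_mono mult_left_mono) (auto simp: indicator_def)
    moreover have "?I2 K \<le> ?I2 A + ennreal B * ennreal e"
    proof -
      have "?I2 K \<le> (\<integral>\<^sup>+ x. ?F x * indicator (- A) x + ennreal B * indicator (A - K) x \<partial>\<nu>2)"
        using K(2) B(2,3) by (intro nn_integral_mono) (auto simp: indicator_def ennreal_leI)
      also have "\<dots> = ?I2 A + ennreal B * emeasure \<nu>2 (A - K)"
        by (subst nn_integral_add) (auto simp: nn_integral_cmult)
      finally show ?thesis using AK by (meson add_left_mono mult_left_mono order_trans zero_le)
    qed
    ultimately have "?I1 K + ?I2 K \<le> ?I1 A + ?I2 A + ennreal B * ennreal e"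
      by (simp add: add.assoc add_mono)
    then show ?thesis using bK by (meson mult_left_mono order_trans zero_le)
  qed
  have "((\<lambda>n. ?P * (?I1 A + ?I2 A + ennreal B * ennreal (inverse (real (Suc n))))) \<longlonglongrightarrow> ?P * (?I1 A + ?I2 A + ennreal B * ennreal 0))"
    by (intro ennreal_tendsto_cmult tendsto_add tendsto_const tendsto_ennrealI LIMSEQ_inverse_real_of_nat) auto
  from LIMSEQ_le_const[OF this] show ?thesis using step by auto
qed


text \<open>The Radon property passes to the density by absolute continuity, so only the mass
  inequality, written as an integral against \<open>\<mu>\<close>, has to be supplied.\<close>

lemma mass_bound_densityI:
  assumes S: "S \<in> sets borel" and mu: "finite_radon_on S \<mu>" and h: "h \<in> borel_measurable borel"
    and fin: "(\<integral>\<^sup>+ x. h x \<partial>\<mu>) < \<infinity>"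
    and bnd: "\<And>f \<pi>. adm k S f \<pi> \<Longrightarrow> ennreal (cmod (T f \<pi>)) \<le>
      ennreal (\<Prod>j<k. lipconst S (\<pi> j)) * (\<integral>\<^sup>+ x. h x * (ennreal (cmod (f x)) * indicator S x) \<partial>\<mu>)"
  shows "mass_bound k S T (density \<mu> h)"
proof -
  have [simp, measurable_cong]: "sets \<mu> = sets borel" using mu by (auto simp: finite_radon_on_def)
  note [measurable] = h
  have sp: "space \<mu> = UNIV" using sets_eq_imp_space_eq[of \<mu> borel] by simp
  have "finite_radon_on S (density \<mu> h)"
    by (rule finite_radon_on_absolutely_continuous[OF mu])
      (use S fin sp in \<open>auto simp: absolutely_continuousI_density emeasure_density\<close>)
  moreover have "(\<integral>\<^sup>+ x. ennreal (cmod (f x)) * indicator S x \<partial>density \<mu> h) =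
      (\<integral>\<^sup>+ x. h x * (ennreal (cmod (f x)) * indicator S x) \<partial>\<mu>)" if "adm k S f \<pi>" for f \<pi>
    using borel_measurable_cmod_indicator[OF S Lipf_of_Lipb[OF admD(1)[OF that]]]
    by (subst nn_integral_density) auto
  ultimately show ?thesis using bnd by (auto simp: mass_bound_def)
qed

text \<open>Gluing along \<open>A = {x. h1 x \<le> h2 x}\<close> selects the smaller density at
  every point.\<close>

lemma mass_bound_density_min:
  assumes T: "additive_current k S T" and S: "S \<in> sets borel" and mu: "finite_radon_on S \<mu>"
    and h1: "h1 \<in> borel_measurable borel" "mass_bound k S T (density \<mu> h1)"
    and h2: "h2 \<in> borel_measurable borel" "mass_bound k S T (density \<mu> h2)"
  shows "mass_bound k S T (density \<mu> (\<lambda>x. min (h1 x) (h2 x)))"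
proof (rule mass_bound_densityI[OF S mu])
  have sets [simp, measurable_cong]: "sets \<mu> = sets borel" using mu by (auto simp: finite_radon_on_def)
  have sp: "space \<mu> = UNIV" using sets_eq_imp_space_eq[of \<mu> borel] by simp
  note [measurable] = h1(1) h2(1)
  show "(\<lambda>x. min (h1 x) (h2 x)) \<in> borel_measurable borel" by simp
  have "(\<integral>\<^sup>+ x. min (h1 x) (h2 x) \<partial>\<mu>) \<le> (\<integral>\<^sup>+ x. h1 x \<partial>\<mu>)"
    by (intro nn_integral_mono) auto
  also have "\<dots> < \<infinity>"
    using h1(2) sp by (auto simp: mass_bound_def finite_radon_on_def emeasure_density)
  finally show "(\<integral>\<^sup>+ x. min (h1 x) (h2 x) \<partial>\<mu>) < \<infinity>" .
  fix f \<pi> assume adm: "adm k S f \<pi>"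
  let ?F = "\<lambda>x. ennreal (cmod (f x)) * indicator S x"
  have [measurable]: "?F \<in> borel_measurable borel"
    using borel_measurable_cmod_indicator[OF S Lipf_of_Lipb[OF admD(1)[OF adm]]] .
  define A where "A = {x. h1 x \<le> h2 x}"
  have A [measurable]: "A \<in> sets borel" unfolding A_def by simp
  have "(\<integral>\<^sup>+ x. ?F x * indicator A x \<partial>density \<mu> h1) + (\<integral>\<^sup>+ x. ?F x * indicator (- A) x \<partial>density \<mu> h2)
      = (\<integral>\<^sup>+ x. h1 x * (?F x * indicator A x) + h2 x * (?F x * indicator (- A) x) \<partial>\<mu>)"
    by (subst (1 2) nn_integral_density) (auto simp: nn_integral_add)
  also have "\<dots> = (\<integral>\<^sup>+ x. min (h1 x) (h2 x) * ?F x \<partial>\<mu>)"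
    by (intro nn_integral_cong) (auto simp: A_def indicator_def min_def)
  finally show "ennreal (cmod (T f \<pi>)) \<le> ennreal (\<Prod>j<k. lipconst S (\<pi> j)) * (\<integral>\<^sup>+ x. min (h1 x) (h2 x) * ?F x \<partial>\<mu>)"
    using mass_bound_glue[OF T S h1(2) h2(2) adm A] by simp
qed

text \<open>An arbitrary bound \<open>\<nu>\<close> may have a part singular to
  \<open>\<mu>\<close>, so it is replaced by the minimum of both measures. On the Hahn set
  \<open>Y\<close> one has \<open>\<nu> \<le> \<mu>\<close>, so \<open>\<nu>\<close> has a density
  \<open>g\<close> there; off \<open>Y\<close> the smaller measure is \<open>\<mu>\<close>, with
  density 1. Gluing along \<open>Y\<close> shows that the minimum is again a mass bound. Comparison
  with all mass bounds is thereby reduced to comparison of densities with respect to one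
  \<open>\<mu>\<close>.\<close>

lemma mass_bound_dominated_density:
  assumes T: "additive_current k S T" and S: "S \<in> sets borel"
    and mu: "mass_bound k S T \<mu>" and nu: "mass_bound k S T \<nu>"
  obtains h where "h \<in> borel_measurable borel" "mass_bound k S T (density \<mu> h)" "measure_le (density \<mu> h) \<nu>"
proof -
  have sets [simp, measurable_cong]: "sets \<mu> = sets borel" "sets \<nu> = sets borel"
    and fin: "emeasure \<mu> UNIV < \<infinity>" "emeasure \<nu> UNIV < \<infinity>" and radon: "finite_radon_on S \<mu>"
    using mu nu by (auto simp: mass_bound_def finite_radon_on_def)
  have sp: "space \<mu> = UNIV" "space \<nu> = UNIV"
    using sets_eq_imp_space_eq[of \<mu> borel] sets_eq_imp_space_eq[of \<nu> borel] by simp_all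
  interpret M: finite_measure \<mu> using fin sp by (intro finite_measureI) auto
  interpret N: finite_measure \<nu> using fin sp by (intro finite_measureI) auto
  obtain Y where Y [measurable]: "Y \<in> sets borel"
    and le: "\<And>X. X \<in> sets borel \<Longrightarrow> X \<subseteq> Y \<Longrightarrow> emeasure \<nu> X \<le> emeasure \<mu> X"
    and ge: "\<And>X. X \<in> sets borel \<Longrightarrow> X \<inter> Y = {} \<Longrightarrow> emeasure \<mu> X \<le> emeasure \<nu> X"
    using finite_unsigned_Hahn_decomposition[OF M.finite_measure_axioms N.finite_measure_axioms] by auto
  have eY: "emeasure (density \<nu> (indicator Y)) B = emeasure \<nu> (B \<inter> Y)" if [measurable]: "B \<in> sets borel" for B
  proof -
    have "emeasure (density \<nu> (indicator Y)) B = (\<integral>\<^sup>+ x. indicator (B \<inter> Y) x \<partial>\<nu>)"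
      by (auto simp: emeasure_density indicator_def intro!: nn_integral_cong)
    then show ?thesis by simp
  qed
  have "absolutely_continuous \<mu> (density \<nu> (indicator Y))"
  proof -
    have "emeasure \<nu> (B \<inter> Y) = 0" if "B \<in> sets borel" "emeasure \<mu> B = 0" for B
      using le[of "B \<inter> Y"] emeasure_mono[of "B \<inter> Y" B \<mu>] that by simp
    then show ?thesis by (auto simp: absolutely_continuous_def null_sets_def eY)
  qed
  then obtain g where "g \<in> borel_measurable \<mu>" and g: "density \<mu> g = density \<nu> (indicator Y)"
    using M.Radon_Nikodym[of "density \<nu> (indicator Y)"] by auto
  then have [measurable]: "g \<in> borel_measurable borel" by simp
  define h where "h x = g x * indicator Y x + indicator (- Y) x" for x
  have h [measurable]: "h \<in> borel_measurable borel" unfolding h_def by measurable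
  have int: "(\<integral>\<^sup>+ x. h x * u x \<partial>\<mu>) = (\<integral>\<^sup>+ x. u x * indicator Y x \<partial>\<nu>) + (\<integral>\<^sup>+ x. u x * indicator (- Y) x \<partial>\<mu>)"
    if [measurable]: "u \<in> borel_measurable borel" for u
  proof -
    have "(\<integral>\<^sup>+ x. h x * u x \<partial>\<mu>) = (\<integral>\<^sup>+ x. g x * (u x * indicator Y x) \<partial>\<mu>) + (\<integral>\<^sup>+ x. u x * indicator (- Y) x \<partial>\<mu>)"
      by (subst nn_integral_add[symmetric]) (auto simp: h_def algebra_simps intro!: nn_integral_cong)
    also have "(\<integral>\<^sup>+ x. g x * (u x * indicator Y x) \<partial>\<mu>) = (\<integral>\<^sup>+ x. u x * indicator Y x \<partial>density \<mu> g)"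
      by (simp add: nn_integral_density)
    also have "\<dots> = (\<integral>\<^sup>+ x. u x * indicator Y x \<partial>\<nu>)"
      unfolding g by (subst nn_integral_density) (auto simp: indicator_def intro!: nn_integral_cong)
    finally show ?thesis .
  qed
  have em: "emeasure (density \<mu> h) B = emeasure \<nu> (B \<inter> Y) + emeasure \<mu> (B - Y)" if [measurable]: "B \<in> sets borel" for B
  proof -
    have "emeasure (density \<mu> h) B = (\<integral>\<^sup>+ x. h x * indicator B x \<partial>\<mu>)" by (simp add: emeasure_density)
    also have "\<dots> = (\<integral>\<^sup>+ x. indicator (B \<inter> Y) x \<partial>\<nu>) + (\<integral>\<^sup>+ x. indicator (B - Y) x \<partial>\<mu>)"
      unfolding int[of "indicator B", simplified]
      by (intro arg_cong2[where f = "(+)"] nn_integral_cong) (auto simp: indicator_def)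
    finally show ?thesis by simp
  qed
  have "measure_le (density \<mu> h) \<nu>"
    unfolding measure_le_def
  proof
    fix B :: "'a set" assume B: "B \<in> sets borel"
    have "emeasure (density \<mu> h) B \<le> emeasure \<nu> (B \<inter> Y) + emeasure \<nu> (B - Y)"
      unfolding em[OF B] using B by (intro add_left_mono ge) auto
    also have "\<dots> = emeasure \<nu> B" using B by (simp add: plus_emeasure Int_Diff_Un Int_Diff_disjoint)
    finally show "emeasure (density \<mu> h) B \<le> emeasure \<nu> B" .
  qed
  moreover have "mass_bound k S T (density \<mu> h)"
  proof (rule mass_bound_densityI[OF S radon h])
    have "(\<integral>\<^sup>+ x. h x \<partial>\<mu>) = emeasure (density \<mu> h) UNIV" using sp by (simp add: emeasure_density)
    also have "\<dots> \<le> emeasure \<nu> UNIV" using \<open>measure_le (density \<mu> h) \<nu>\<close> by (auto simp: measure_le_def)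
    finally show "(\<integral>\<^sup>+ x. h x \<partial>\<mu>) < \<infinity>" using fin by (auto intro: le_less_trans)
    fix f \<pi> assume adm: "adm k S f \<pi>"
    show "ennreal (cmod (T f \<pi>)) \<le> ennreal (\<Prod>j<k. lipconst S (\<pi> j)) * (\<integral>\<^sup>+ x. h x * (ennreal (cmod (f x)) * indicator S x) \<partial>\<mu>)"
      using mass_bound_glue[OF T S nu mu adm Y] int[OF borel_measurable_cmod_indicator[OF S Lipf_of_Lipb[OF admD(1)[OF adm]]]]
      by simp
  qed
  ultimately show thesis using that h by blast
qed

text \<open>Among the densities of a fixed mass bound that are again mass bounds, one of minimal
  integral exists because they are closed under minima and decreasing limits.\<close>
lemma least_mass_bound:
  assumes T: "additive_current k S T" and S: "S \<in> sets borel" and fm: "has_finite_mass k S T"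
  shows "\<exists>\<mu>. mass_bound k S T \<mu> \<and> (\<forall>\<nu>. mass_bound k S T \<nu> \<longrightarrow> measure_le \<mu> \<nu>)"
proof -
  obtain \<mu> where mu: "mass_bound k S T \<mu>" using fm by (auto simp: has_finite_mass_def)
  have sets [simp, measurable_cong]: "sets \<mu> = sets borel" and radon: "finite_radon_on S \<mu>"
    using mu by (auto simp: mass_bound_def finite_radon_on_def)
  have sp: "space \<mu> = UNIV" using sets_eq_imp_space_eq[of \<mu> borel] by simp
  define H where "H = {h. h \<in> borel_measurable borel \<and> mass_bound k S T (density \<mu> h)}"
  define I where "I = (INF h\<in>H. \<integral>\<^sup>+ x. h x \<partial>\<mu>)"
  have fin: "(\<integral>\<^sup>+ x. h x \<partial>\<mu>) < \<infinity>" if "h \<in> H" for h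
    using that sp by (auto simp: H_def mass_bound_def finite_radon_on_def emeasure_density)
  have "density \<mu> (\<lambda>_. 1) = \<mu>" by (rule density_1)
  then have "(\<lambda>_. 1) \<in> H" using mu by (simp add: H_def)
  then have "(\<lambda>h. \<integral>\<^sup>+ x. h x \<partial>\<mu>) ` H \<noteq> {}" by auto
  from ennreal_Inf_countable_INF[OF this] obtain u :: "nat \<Rightarrow> ennreal"
    where u: "range u \<subseteq> (\<lambda>h. \<integral>\<^sup>+ x. h x \<partial>\<mu>) ` H" "I = (INF i. u i)" by (auto simp: I_def)
  then have "\<forall>n. \<exists>h. h \<in> H \<and> u n = (\<integral>\<^sup>+ x. h x \<partial>\<mu>)" by auto
  then obtain h where h: "\<And>n. h n \<in> H" "\<And>n. u n = (\<integral>\<^sup>+ x. h n x \<partial>\<mu>)" by metis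
  have min: "(\<lambda>x. min (h1 x) (h2 x)) \<in> H" if "h1 \<in> H" "h2 \<in> H" for h1 h2
    using that mass_bound_density_min[OF T S radon, of h1 h2] by (auto simp: H_def)
  \<comment> \<open>Running minima turn the minimising sequence into a decreasing one inside
    \<open>H\<close>; as \<open>G n\<close> lies below \<open>h n\<close>, the integral of its limit
    is at most \<open>I\<close>.\<close>
  define G where "G = rec_nat (h 0) (\<lambda>n g x. min (g x) (h (Suc n) x))"
  have G_simps: "G 0 = h 0" "G (Suc n) = (\<lambda>x. min (G n x) (h (Suc n) x))" for n by (auto simp: G_def)
  have GH: "G n \<in> H" for n by (induction n) (auto simp: G_simps h min)
  have Gm [measurable]: "G n \<in> borel_measurable borel" for n using GH by (simp add: H_def)
  have Gh: "G n x \<le> h n x" for n x by (cases n) (auto simp: G_simps)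
  have Gdec: "decseq G" by (intro decseq_SucI) (auto simp: G_simps le_fun_def)
  define g where "g x = (INF n. G n x)" for x
  have gm [measurable]: "g \<in> borel_measurable borel" unfolding g_def by measurable
  have glim: "(\<lambda>n. G n x) \<longlonglongrightarrow> g x" for x
    unfolding g_def using decseqD[OF Gdec] by (intro LIMSEQ_INF) (auto intro!: monotoneI simp: le_fun_def)
  have gint: "(\<integral>\<^sup>+ x. g x \<partial>\<mu>) \<le> I"
    unfolding u h(2)
    by (intro INF_greatest nn_integral_mono) (auto simp: g_def intro: INF_lower2 Gh)
  have gle: "g x \<le> G n x" for n x by (auto simp: g_def intro: INF_lower)
  have gH: "mass_bound k S T (density \<mu> g)"
  proof (rule mass_bound_densityI[OF S radon gm])
    show "(\<integral>\<^sup>+ x. g x \<partial>\<mu>) < \<infinity>"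
      using fin[OF GH[of 0]] nn_integral_mono[of \<mu> g "G 0"] gle by (auto intro: le_less_trans)
    fix f \<pi> assume adm: "adm k S f \<pi>"
    let ?F = "\<lambda>x. ennreal (cmod (f x)) * indicator S x"
    let ?P = "ennreal (\<Prod>j<k. lipconst S (\<pi> j))"
    have Fm [measurable]: "?F \<in> borel_measurable borel"
      using borel_measurable_cmod_indicator[OF S Lipf_of_Lipb[OF admD(1)[OF adm]]] .
    have d: "(\<integral>\<^sup>+ x. ?F x \<partial>density \<mu> (G n)) = (\<integral>\<^sup>+ x. ?F x * G n x \<partial>\<mu>)" for n
      by (subst nn_integral_density, simp, simp, rule nn_integral_cong, rule mult.commute)
    have b: "ennreal (cmod (T f \<pi>)) \<le> ?P * (\<integral>\<^sup>+ x. ?F x * G n x \<partial>\<mu>)" for n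
      unfolding d[symmetric] using GH[of n] adm by (auto simp: H_def mass_bound_def)
    have "(\<integral>\<^sup>+ x. ?F x \<partial>density \<mu> (G 0)) < \<infinity>"
      using GH[of 0] by (intro nn_integral_Lipb_finite[OF S admD(1)[OF adm]]) (auto simp: H_def mass_bound_def finite_radon_on_def)
    then have w: "(\<integral>\<^sup>+ x. ?F x * G 0 x \<partial>\<mu>) < \<infinity>" by (simp only: d)
    have "(\<lambda>n. \<integral>\<^sup>+ x. ?F x * G n x \<partial>\<mu>) \<longlonglongrightarrow> (\<integral>\<^sup>+ x. ?F x * g x \<partial>\<mu>)"
    proof (rule nn_integral_dominated_convergence[OF _ _ _ _ w])
      show "AE x in \<mu>. ?F x * G j x \<le> ?F x * G 0 x" for j
        using decseqD[OF Gdec, of 0 j] by (auto simp: le_fun_def intro!: mult_left_mono)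
      show "AE x in \<mu>. (\<lambda>n. ?F x * G n x) \<longlonglongrightarrow> ?F x * g x"
        by (intro AE_I2 ennreal_tendsto_cmult glim) (simp add: indicator_def)
    qed auto
    from LIMSEQ_le_const[OF ennreal_tendsto_cmult[OF _ this, of ?P]]
    show "ennreal (cmod (T f \<pi>)) \<le> ?P * (\<integral>\<^sup>+ x. g x * ?F x \<partial>\<mu>)"
      using b by (auto simp: mult.commute)
  qed
  then have "g \<in> H" by (simp add: H_def)
  have "measure_le (density \<mu> g) \<nu>" if nu: "mass_bound k S T \<nu>" for \<nu>
  proof -
    obtain h' where h': "h' \<in> borel_measurable borel" "mass_bound k S T (density \<mu> h')" "measure_le (density \<mu> h') \<nu>"
      using mass_bound_dominated_density[OF T S mu nu] .
    note [measurable] = h'(1)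
    have "(\<lambda>x. min (g x) (h' x)) \<in> H" using h' by (intro min \<open>g \<in> H\<close>) (auto simp: H_def)
    then have mI: "I \<le> (\<integral>\<^sup>+ x. min (g x) (h' x) \<partial>\<mu>)" unfolding I_def by (rule INF_lower)
    \<comment> \<open>If \<open>g\<close> exceeded \<open>h'\<close> on a set of positive measure,
      the minimum of both, a member of \<open>H\<close>, would have an integral strictly below the
      infimum \<open>I\<close>.\<close>
    have "AE x in \<mu>. g x \<le> min (g x) (h' x)"
    proof (rule ccontr)
      assume "\<not> ?thesis"
      moreover have "(\<integral>\<^sup>+ x. min (g x) (h' x) \<partial>\<mu>) \<noteq> \<infinity>"
        using fin[OF \<open>(\<lambda>x. min (g x) (h' x)) \<in> H\<close>] by auto
      ultimately have "(\<integral>\<^sup>+ x. min (g x) (h' x) \<partial>\<mu>) < (\<integral>\<^sup>+ x. g x \<partial>\<mu>)"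
        by (intro nn_integral_less) auto
      then show False using mI gint by auto
    qed
    then have ae: "AE x in \<mu>. g x \<le> h' x" by auto
    show ?thesis
      unfolding measure_le_def
    proof
      fix B :: "'a set" assume B [measurable]: "B \<in> sets borel"
      have "emeasure (density \<mu> g) B \<le> emeasure (density \<mu> h') B"
        using ae by (auto simp: emeasure_density intro!: nn_integral_mono_AE mult_right_mono)
      then show "emeasure (density \<mu> g) B \<le> emeasure \<nu> B" using h'(3) B by (auto simp: measure_le_def intro: order_trans)
    qed
  qed
  then show ?thesis using gH by blast
qed

text \<open>The definite description denotes something only once a least bound exists and is unique.
  Uniqueness is antisymmetry of \<open>measure_le\<close> for measures on the Borel sets.\<close>

lemma mass_bound_current_mass:
  assumes "additive_current k S T" "S \<in> sets borel" "has_finite_mass k S T"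
  shows "mass_bound k S T (current_mass k S T)"
proof -
  obtain \<mu> where mu: "mass_bound k S T \<mu>" "\<And>\<nu>. mass_bound k S T \<nu> \<Longrightarrow> measure_le \<mu> \<nu>"
    using least_mass_bound[OF assms] by auto
  have "current_mass k S T = \<mu>"
    unfolding current_mass_def
  proof (rule the_equality)
    fix \<nu> assume nu: "mass_bound k S T \<nu> \<and> (\<forall>\<nu>'. mass_bound k S T \<nu>' \<longrightarrow> measure_le \<nu> \<nu>')"
    then have "measure_le \<nu> \<mu>" "measure_le \<mu> \<nu>" using mu by auto
    moreover have "sets \<nu> = sets borel" "sets \<mu> = sets borel"
      using nu mu(1) by (auto simp: mass_bound_def finite_radon_on_def)
    ultimately show "\<nu> = \<mu>" by (intro measure_eqI) (auto simp: measure_le_def intro: antisym)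
  qed (use mu in auto)
  then show ?thesis using mu(1) by simp
qed

section \<open>Calculus of metric currents\<close>

text \<open>Real-valued form of \<open>mass_bound\<close> for finite Borel measures; this is the
  form in which the image measures \<open>distr \<mu> borel (p t)\<close> enter the
  estimates.\<close>

definition integral_mass_bound :: "nat \<Rightarrow> 'a::metric_space set \<Rightarrow> 'a current \<Rightarrow> 'a measure \<Rightarrow> bool" where
  "integral_mass_bound k S T M \<longleftrightarrow> finite_measure M \<and> sets M = sets borel \<and>
     (\<forall>f \<pi>. adm k S f \<pi> \<longrightarrow> cmod (T f \<pi>) \<le> (\<Prod>j<k. lipconst S (\<pi> j)) * (LINT x:S|M. cmod (f x)))"

lemma set_integrable_bounded_continuous:
  fixes u :: "'a::metric_space \<Rightarrow> real"
  assumes "finite_measure M" "sets M = sets borel" "S \<in> sets borel"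
    and "continuous_on S u" "\<And>x. x \<in> S \<Longrightarrow> \<bar>u x\<bar> \<le> B"
  shows "set_integrable M S u"
proof -
  interpret finite_measure M by fact
  have "(\<lambda>x. indicator S x *\<^sub>R u x) \<in> borel_measurable borel"
    using assms by (intro borel_measurable_continuous_on_indicator) auto
  then have "(\<lambda>x. indicator S x *\<^sub>R u x) \<in> borel_measurable M"
    using assms(2) by (simp cong: measurable_cong_sets)
  then show ?thesis
    unfolding set_integrable_def
    using assms(5) by (intro integrable_const_bound[of _ "max 0 B"]) (auto simp: indicator_def le_max_iff_disj)
qed

lemma nn_integral_cmod_eq_set_integral:
  assumes "finite_measure M" "sets M = sets borel" "S \<in> sets borel" "Lipb S f"
  shows "(\<integral>\<^sup>+ x. ennreal (cmod (f x)) * indicator S x \<partial>M) = ennreal (LINT x:S|M. cmod (f x))"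
proof -
  obtain L B where B: "L-lipschitz_on S f" "0 \<le> B" "\<And>x. x \<in> S \<Longrightarrow> cmod (f x) \<le> B"
    using LipbE[OF assms(4)] by blast
  have "set_integrable M S (\<lambda>x. cmod (f x))"
    using assms B
    by (intro set_integrable_bounded_continuous[where B = B] continuous_intros Lipf_continuous_on Lipf_of_Lipb) auto
  then have "(\<integral>\<^sup>+ x. ennreal (indicator S x *\<^sub>R cmod (f x)) \<partial>M) = ennreal (LINT x:S|M. cmod (f x))"
    unfolding set_integrable_def set_lebesgue_integral_def by (intro nn_integral_eq_integral) auto
  moreover have "(\<lambda>x. ennreal (indicator S x *\<^sub>R cmod (f x))) = (\<lambda>x. ennreal (cmod (f x)) * indicator S x)"
    by (auto simp: indicator_def fun_eq_iff)
  ultimately show ?thesis by simp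
qed

lemma set_integral_cmod_nonneg: "0 \<le> (LINT x:S|M. cmod (f x))"
  unfolding set_lebesgue_integral_def by (intro integral_nonneg_AE) auto

text \<open>For a finite measure and a bounded \<open>f\<close> both sides of the extended
  inequality are finite, so it is one between reals.\<close>

lemma mass_bound_iff_integral_mass_bound:
  assumes "S \<in> sets borel"
  shows "mass_bound k S T M \<longleftrightarrow> finite_radon_on S M \<and> integral_mass_bound k S T M"
proof (cases "finite_radon_on S M")
  case True
  then have M: "sets M = sets borel" "emeasure M UNIV < \<infinity>" by (auto simp: finite_radon_on_def)
  then have "space M = UNIV" using sets_eq_imp_space_eq[of M borel] by simp
  with M have fin: "finite_measure M" by (intro finite_measureI) auto
  have "ennreal (cmod (T f \<pi>)) \<le> ennreal (\<Prod>j<k. lipconst S (\<pi> j)) * (\<integral>\<^sup>+ x. ennreal (cmod (f x)) * indicator S x \<partial>M)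
    \<longleftrightarrow> cmod (T f \<pi>) \<le> (\<Prod>j<k. lipconst S (\<pi> j)) * (LINT x:S|M. cmod (f x))" if "adm k S f \<pi>" for f \<pi>
  proof -
    have "0 \<le> (\<Prod>j<k. lipconst S (\<pi> j))"
      using that by (intro prod_nonneg) (auto simp: admD intro: lipconst_nonneg)
    then show ?thesis
      unfolding nn_integral_cmod_eq_set_integral[OF fin M(1) assms admD(1)[OF that]]
      using set_integral_cmod_nonneg[of M S f] by (simp add: ennreal_le_iff flip: ennreal_mult)
  qed
  then show ?thesis using True fin M by (auto simp: mass_bound_def integral_mass_bound_def)
qed (auto simp: mass_bound_def)

lemma integral_mass_boundD:
  assumes M: "integral_mass_bound k S T M" and S: "S \<in> sets borel" and adm: "adm k S f \<pi>"
    and L: "\<And>j. j < k \<Longrightarrow> (L j)-lipschitz_on S (\<pi> j)"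
    and u: "set_integrable M S u" "\<And>x. x \<in> S \<Longrightarrow> cmod (f x) \<le> u x"
  shows "cmod (T f \<pi>) \<le> (\<Prod>j<k. L j) * (LINT x:S|M. u x)"
proof -
  obtain L' B where B: "L'-lipschitz_on S f" "0 \<le> B" "\<And>x. x \<in> S \<Longrightarrow> cmod (f x) \<le> B"
    using LipbE[OF admD(1)[OF adm]] by blast
  have fi: "set_integrable M S (\<lambda>x. cmod (f x))"
    using M S B adm
    by (intro set_integrable_bounded_continuous[where B = B] continuous_intros Lipf_continuous_on Lipf_of_Lipb)
      (auto simp: integral_mass_bound_def admD)
  have "cmod (T f \<pi>) \<le> (\<Prod>j<k. lipconst S (\<pi> j)) * (LINT x:S|M. cmod (f x))"
    using M adm by (auto simp: integral_mass_bound_def)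
  also have "\<dots> \<le> (\<Prod>j<k. L j) * (LINT x:S|M. u x)"
    using L adm u fi
    by (intro mult_mono prod_mono set_integral_mono prod_nonneg)
      (auto simp: lipconst_le admD lipconst_nonneg set_integral_cmod_nonneg intro: lipschitz_on_nonneg)
  finally show ?thesis .
qed

text \<open>Separates the Lipschitz constant \<open>G\<close> of one slot from those of the others;
  in the chain rule it is the factor that becomes small.\<close>

lemma integral_mass_boundD_upd:
  assumes M: "integral_mass_bound k S T M" and S: "S \<in> sets borel" and adm: "adm k S f \<pi>" and j: "j < k"
    and g: "G-lipschitz_on S g"
    and u: "set_integrable M S u" "\<And>x. x \<in> S \<Longrightarrow> cmod (f x) \<le> u x"
  shows "cmod (T f (\<pi>(j := g))) \<le> G * (\<Prod>i\<in>{..<k} - {j}. lipconst S (\<pi> i)) * (LINT x:S|M. u x)"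
proof -
  have "cmod (T f (\<pi>(j := g))) \<le> (\<Prod>i<k. if i = j then G else lipconst S (\<pi> i)) * (LINT x:S|M. u x)"
    using g adm by (intro integral_mass_boundD[OF M S _ _ u] adm_fun_upd LipfI[OF g])
      (auto simp: admD lipconst_lipschitz_on)
  also have "(\<Prod>i<k. if i = j then G else lipconst S (\<pi> i)) = G * (\<Prod>i\<in>{..<k} - {j}. lipconst S (\<pi> i))"
    using j by (subst prod.remove[of _ j]) (auto intro!: prod.cong)
  finally show ?thesis .
qed

lemma lipschitz_on_interval_deriv:
  fixes \<phi> :: "real \<Rightarrow> real"
  assumes "\<And>y. (\<phi> has_real_derivative \<phi>' y) (at y)" "\<And>y. y \<in> {l..u} \<Longrightarrow> \<bar>\<phi>' y\<bar> \<le> C" "0 \<le> C"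
  shows "C-lipschitz_on {l..u} \<phi>"
proof (rule bounded_derivative_imp_lipschitz)
  show "(\<phi> has_derivative (\<lambda>h. \<phi>' x * h)) (at x within {l..u})" for x
    using assms(1)[of x] by (auto simp: has_field_derivative_def intro: has_derivative_at_withinI)
  show "onorm (\<lambda>h. \<phi>' x * h) \<le> C" if "x \<in> {l..u}" for x
    using assms(2)[OF that] by (intro onorm_le) (auto simp: abs_mult mult_right_mono)
qed (use assms in auto)

section \<open>Multilinearity and locality on a closed set\<close>

text \<open>Closedness makes \<open>S\<close> Borel, so that integrals over it behave well, and
  makes the sets cut out of \<open>S\<close> by continuous inequalities closed in the whole space,
  where the closure in the locality axiom is taken.\<close>

locale closed_current =
  fixes k :: nat and S :: "'a::metric_space set" and T :: "'a current"
  assumes current: "metric_current k S T" and closed: "closed S"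
begin

lemma borel_S: "S \<in> sets borel"
  using closed by simp

lemmas current_axioms = current[unfolded metric_current_def]

lemma T_cong:
  "adm k S f \<pi> \<Longrightarrow> (\<And>x. x \<in> S \<Longrightarrow> f x = g x) \<Longrightarrow> (\<And>j x. j < k \<Longrightarrow> x \<in> S \<Longrightarrow> \<pi> j x = \<sigma> j x) \<Longrightarrow> T f \<pi> = T g \<sigma>"
  by (rule current_axioms[THEN conjunct1, rule_format])

lemma first_lin: "adm k S f \<pi> \<Longrightarrow> Lipb S g \<Longrightarrow> T (\<lambda>x. a * f x + b * g x) \<pi> = a * T f \<pi> + b * T g \<pi>"
  by (rule current_axioms[THEN conjunct2, THEN conjunct1, rule_format])

lemma slot_lin: "adm k S f \<pi> \<Longrightarrow> j < k \<Longrightarrow> Lipf S g \<Longrightarrow> Lipf S h \<Longrightarrow>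
    T f (\<pi>(j := (\<lambda>x. a * g x + b * h x))) = a * T f (\<pi>(j := g)) + b * T f (\<pi>(j := h))"
  by (rule current_axioms[THEN conjunct2, THEN conjunct2, THEN conjunct1, rule_format])

lemma T_tendsto:
  assumes "adm k S f \<pi>" "\<And>n j. j < k \<Longrightarrow> L-lipschitz_on S (\<pi>s n j)"
    "\<And>j x. j < k \<Longrightarrow> x \<in> S \<Longrightarrow> (\<lambda>n. \<pi>s n j x) \<longlonglongrightarrow> \<pi> j x"
  shows "(\<lambda>n. T f (\<pi>s n)) \<longlonglongrightarrow> T f \<pi>"
proof -
  have "\<exists>L. \<forall>n. \<forall>j<k. lipconst S (\<pi>s n j) \<le> L"
    using assms(2) by (auto intro: lipconst_le)
  then show ?thesis
    using assms
    by (intro current_axioms[THEN conjunct2, THEN conjunct2, THEN conjunct2, THEN conjunct1, rule_format])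
      (auto intro: LipfI)
qed

lemma T_local:
  "adm k S f \<pi> \<Longrightarrow> j < k \<Longrightarrow> open U \<Longrightarrow> closure {x\<in>S. f x \<noteq> 0} \<inter> S \<subseteq> U \<Longrightarrow> (\<And>x. x \<in> U \<inter> S \<Longrightarrow> \<pi> j x = c)
    \<Longrightarrow> T f \<pi> = 0"
  by (rule current_axioms[THEN conjunct2, THEN conjunct2, THEN conjunct2, THEN conjunct2, THEN conjunct1, rule_format])
    auto

lemma first_add: "adm k S f \<pi> \<Longrightarrow> Lipb S g \<Longrightarrow> T (\<lambda>x. f x + g x) \<pi> = T f \<pi> + T g \<pi>"
  using first_lin[of f \<pi> g 1 1] by simp

lemma first_diff: "adm k S f \<pi> \<Longrightarrow> Lipb S g \<Longrightarrow> T (\<lambda>x. f x - g x) \<pi> = T f \<pi> - T g \<pi>"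
  using first_lin[of f \<pi> g 1 "-1"] by simp

lemma first_cmult: "adm k S f \<pi> \<Longrightarrow> T (\<lambda>x. a * f x) \<pi> = a * T f \<pi>"
  using first_lin[of f \<pi> "\<lambda>_. 0" a 0] by (simp add: Lipb_const)

lemma slot_add: "adm k S f \<pi> \<Longrightarrow> j < k \<Longrightarrow> Lipf S g \<Longrightarrow> Lipf S h \<Longrightarrow>
    T f (\<pi>(j := (\<lambda>x. g x + h x))) = T f (\<pi>(j := g)) + T f (\<pi>(j := h))"
  using slot_lin[of f \<pi> j g h 1 1] by simp

lemma slot_diff: "adm k S f \<pi> \<Longrightarrow> j < k \<Longrightarrow> Lipf S g \<Longrightarrow> Lipf S h \<Longrightarrow>
    T f (\<pi>(j := (\<lambda>x. g x - h x))) = T f (\<pi>(j := g)) - T f (\<pi>(j := h))"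
  using slot_lin[of f \<pi> j g h 1 "-1"] by simp

lemma slot_cmult: "adm k S f \<pi> \<Longrightarrow> j < k \<Longrightarrow> Lipf S g \<Longrightarrow> T f (\<pi>(j := (\<lambda>x. a * g x))) = a * T f (\<pi>(j := g))"
  using slot_lin[of f \<pi> j g "\<lambda>_. 0" a 0] by (simp add: Lipf_const)

lemma slot_const: "adm k S f \<pi> \<Longrightarrow> j < k \<Longrightarrow> T f (\<pi>(j := (\<lambda>x. c))) = 0"
  by (rule T_local[where U = UNIV and j = j and c = c]) (auto intro: adm_fun_upd Lipf_const)

lemma additive: "additive_current k S T"
  by (auto simp: additive_current_def first_add)

text \<open>The first argument of \<open>bdry T\<close> occupies slot 0 of \<open>T\<close>, so its
  additivity is linearity in that slot.\<close>

lemma additive_bdry: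
  assumes "0 < k"
  shows "additive_current (k - 1) S (bdry T)"
  unfolding additive_current_def
proof (intro allI impI)
  fix f g \<pi> assume f: "adm (k - 1) S f \<pi>" and g: "Lipb S g"
  have upd: "(\<lambda>j. if j = 0 then h else \<pi> (j - 1)) = (\<lambda>j. \<pi> (j - 1))(0 := h)" for h by auto
  have "adm k S (\<lambda>_. 1) ((\<lambda>j. \<pi> (j - 1))(0 := f))"
    using f by (auto simp: adm_def Lipb_const Lipf_of_Lipb)
  then have "T (\<lambda>_. 1) ((\<lambda>j. \<pi> (j - 1))(0 := f, 0 := (\<lambda>x. f x + g x))) =
      T (\<lambda>_. 1) ((\<lambda>j. \<pi> (j - 1))(0 := f, 0 := f)) + T (\<lambda>_. 1) ((\<lambda>j. \<pi> (j - 1))(0 := f, 0 := g))"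
    using f g assms by (intro slot_add) (auto simp: adm_def Lipf_of_Lipb)
  then show "bdry T (\<lambda>x. f x + g x) \<pi> = bdry T f \<pi> + bdry T g \<pi>"
    by (simp add: bdry_def upd)
qed

lemma exists_integral_mass_bound: obtains M where "integral_mass_bound k S T M"
proof -
  have "has_finite_mass k S T" using current by (simp add: metric_current_def)
  then show thesis
    using that by (auto simp: has_finite_mass_def mass_bound_iff_integral_mass_bound[OF borel_S])
qed

text \<open>The gap between \<open>\<delta>\<close> and \<open>\<delta>'\<close> provides the
  neighbourhood which locality demands: the support of \<open>f\<close> stays in the closed band,
  while the slot is constant on a larger, relatively open one.\<close>

lemma T_local_band:
  fixes h :: "'a \<Rightarrow> real"
  assumes adm: "adm k S f \<pi>" and j: "j < k" and h: "continuous_on S h"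
    and supp: "\<And>x. x \<in> S \<Longrightarrow> f x \<noteq> 0 \<Longrightarrow> \<bar>h x\<bar> \<le> \<delta>" and "\<delta> < \<delta>'"
    and c: "\<And>x. x \<in> S \<Longrightarrow> \<bar>h x\<bar> < \<delta>' \<Longrightarrow> \<pi> j x = c"
  shows "T f \<pi> = 0"
proof -
  have "continuous_on S (\<lambda>x. \<bar>h x\<bar>)" using h by (intro continuous_intros)
  then obtain U where U: "open U" "U \<inter> S = (\<lambda>x. \<bar>h x\<bar>) -` {..<\<delta>'} \<inter> S"
    using open_lessThan unfolding continuous_on_open_invariant by blast
  have "closed {x\<in>S. \<bar>h x\<bar> \<le> \<delta>}"
    using h closed by (intro continuous_on_closed_Collect_le continuous_intros) auto
  then have "closure {x\<in>S. f x \<noteq> 0} \<subseteq> {x\<in>S. \<bar>h x\<bar> \<le> \<delta>}"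
    using supp by (intro closure_minimal) auto
  then have "closure {x\<in>S. f x \<noteq> 0} \<inter> S \<subseteq> U \<inter> S" unfolding U(2) using \<open>\<delta> < \<delta>'\<close> by auto
  then show ?thesis using U c by (intro T_local[OF adm j U(1), of c]) auto
qed

section \<open>Chain rule for one real function\<close>

text \<open>Where \<open>g\<close> is within \<open>\<delta>\<close> of \<open>a\<close>,
  \<open>\<phi>\<close> is affine up to a remainder whose Lipschitz constant is of order
  \<open>\<delta>\<close>. The error thus carries a factor \<open>\<delta>\<close> besides the
  integral of \<open>cmod (f x)\<close>, and this factor survives the summation over a partition of
  unity.\<close>

lemma chain_rule_local:
  fixes g :: "'a \<Rightarrow> real" and \<phi> \<phi>' :: "real \<Rightarrow> real"
  assumes M: "integral_mass_bound k S T M" and adm: "adm k S f \<pi>" and j: "j < k"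
    and g: "G-lipschitz_on S g" and b: "\<And>x. x \<in> S \<Longrightarrow> \<bar>g x\<bar> \<le> b"
    and d: "\<And>y. (\<phi> has_real_derivative \<phi>' y) (at y)" and K: "K-lipschitz_on UNIV \<phi>'"
    and supp: "\<And>x. x \<in> S \<Longrightarrow> f x \<noteq> 0 \<Longrightarrow> \<bar>g x - a\<bar> \<le> \<delta>" and \<delta>: "\<delta> > 0"
  shows "cmod (T f (\<pi>(j := (\<lambda>x. complex_of_real (\<phi> (g x))))) -
      T (\<lambda>x. f x * complex_of_real (\<phi>' (g x))) (\<pi>(j := (\<lambda>x. complex_of_real (g x)))))
    \<le> (3 * K * G * (\<Prod>i\<in>{..<k} - {j}. lipconst S (\<pi> i))) * \<delta> * (LINT x:S|M. cmod (f x))"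
proof -
  let ?P = "\<Prod>i\<in>{..<k} - {j}. lipconst S (\<pi> i)" and ?I = "LINT x:S|M. cmod (f x)"
  let ?g = "\<lambda>x. complex_of_real (g x)"
  have K0: "0 \<le> K" "0 \<le> G" using K g lipschitz_on_nonneg by auto
  have KD: "\<bar>\<phi>' y - \<phi>' z\<bar> \<le> K * \<bar>y - z\<bar>" for y z
    using lipschitz_onD[OF K, of y z] by (simp add: dist_real_def)
  obtain L B where B: "L-lipschitz_on S f" "0 \<le> B" "\<And>x. x \<in> S \<Longrightarrow> cmod (f x) \<le> B"
    using LipbE[OF admD(1)[OF adm]] by blast
  have fin: "finite_measure M" "sets M = sets borel" using M by (auto simp: integral_mass_bound_def)
  have fi: "set_integrable M S (\<lambda>x. cmod (f x))"
    using B adm fin borel_S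
    by (intro set_integrable_bounded_continuous[where B = B] continuous_intros Lipf_continuous_on Lipf_of_Lipb)
      (auto simp: admD)
  have g': "Lipf S ?g" using g by (intro LipfI[of G]) simp
  have \<phi>'b: "Lipb S (\<lambda>x. complex_of_real (\<phi>' (g x)))"
  proof (rule LipbI[of "K * G"])
    show "(K * G)-lipschitz_on S (\<lambda>x. complex_of_real (\<phi>' (g x)))"
      using lipschitz_on_compose2[OF g, of K \<phi>'] lipschitz_on_subset[OF K] by simp
    fix x assume "x \<in> S"
    then have "K * \<bar>g x\<bar> \<le> K * b" using b K0 by (intro mult_left_mono) auto
    then show "cmod (complex_of_real (\<phi>' (g x))) \<le> \<bar>\<phi>' 0\<bar> + K * b"
      using KD[of "g x" 0] by simp
  qed
  \<comment> \<open>First-order Taylor remainder of \<open>\<phi>\<close> at \<open>a\<close>. Its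
    derivative is at most \<open>2 * K * \<delta>\<close> in absolute value within distance
    \<open>2 * \<delta>\<close> of \<open>a\<close>.\<close>
  define R where "R y = \<phi> y - \<phi> a - \<phi>' a * (y - a)" for y
  have dR: "(R has_real_derivative (\<phi>' y - \<phi>' a)) (at y)" for y
    unfolding R_def by (auto intro!: derivative_eq_intros d)
  \<comment> \<open>Clamping \<open>g\<close> confines \<open>R\<close> to the interval on which its
    Lipschitz constant is small. The radius \<open>2 * \<delta>\<close>, twice that of the band
    carrying \<open>f\<close>, leaves room for locality.\<close>
  define \<kappa> where "\<kappa> x = max (a - 2 * \<delta>) (min (a + 2 * \<delta>) (g x))" for x
  have "G-lipschitz_on S \<kappa>"
  proof (rule lipschitz_onI)
    fix x y assume "x \<in> S" "y \<in> S"
    then have "\<bar>g x - g y\<bar> \<le> G * dist x y" using lipschitz_onD[OF g] by (auto simp: dist_real_def)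
    then show "dist (\<kappa> x) (\<kappa> y) \<le> G * dist x y" by (auto simp: \<kappa>_def dist_real_def)
  qed (use K0 in simp)
  moreover have "(2 * K * \<delta>)-lipschitz_on {a - 2 * \<delta>..a + 2 * \<delta>} R"
  proof (rule lipschitz_on_interval_deriv[OF dR])
    fix y assume "y \<in> {a - 2 * \<delta>..a + 2 * \<delta>}"
    then have "K * \<bar>y - a\<bar> \<le> K * (2 * \<delta>)" using K0 by (intro mult_left_mono) auto
    then show "\<bar>\<phi>' y - \<phi>' a\<bar> \<le> 2 * K * \<delta>" using KD[of y a] by simp
  qed (use K0 \<delta> in auto)
  moreover have "\<kappa> ` S \<subseteq> {a - 2 * \<delta>..a + 2 * \<delta>}" using \<delta> by (auto simp: \<kappa>_def)
  ultimately have u: "(2 * K * \<delta> * G)-lipschitz_on S (\<lambda>x. complex_of_real (R (\<kappa> x)))"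
    unfolding lipschitz_on_of_real_iff
    by (intro lipschitz_on_compose2[of G S \<kappa> "2 * K * \<delta>" R]) (auto intro: lipschitz_on_subset)
  \<comment> \<open>The derivative of \<open>R\<close> grows at most linearly, so \<open>R\<close>
    is Lipschitz on the bounded range of \<open>g\<close>; this is where the bound \<open>b\<close>
    enters.\<close>
  have r: "Lipf S (\<lambda>x. complex_of_real (R (g x)))"
  proof -
    have "(\<bar>\<phi>' 0 - \<phi>' a\<bar> + K * b)-lipschitz_on {-b..b} R" if "0 \<le> b"
    proof (rule lipschitz_on_interval_deriv[OF dR])
      fix y assume "y \<in> {-b..b}"
      then have "K * \<bar>y\<bar> \<le> K * b" using K0 by (intro mult_left_mono) auto
      then show "\<bar>\<phi>' y - \<phi>' a\<bar> \<le> \<bar>\<phi>' 0 - \<phi>' a\<bar> + K * b" using KD[of y 0] by simp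
    qed (use K0 that in auto)
    moreover have "g ` S \<subseteq> {-b..b}" using b by (auto simp: abs_le_iff minus_le_iff)
    ultimately show ?thesis
    proof (cases "S = {}")
      case False
      then have "0 \<le> b" using b by force
      then have "((\<bar>\<phi>' 0 - \<phi>' a\<bar> + K * b) * G)-lipschitz_on S (\<lambda>x. R (g x))"
        using \<open>0 \<le> b \<Longrightarrow> _\<close> \<open>g ` S \<subseteq> _\<close> g by (intro lipschitz_on_compose2) (auto intro: lipschitz_on_subset)
      then show ?thesis by (intro LipfI) simp
    qed (auto simp: Lipf_def)
  qed
  note ur = LipfI[OF u] r
  have "T f (\<pi>(j := (\<lambda>x. complex_of_real (R (g x)) - complex_of_real (R (\<kappa> x))))) = 0"
  proof (rule T_local_band[where h = "\<lambda>x. g x - a" and \<delta> = \<delta> and \<delta>' = "2 * \<delta>" and j = j and c = 0])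
    show "continuous_on S (\<lambda>x. g x - a)"
      using lipschitz_on_continuous_on[OF g] by (intro continuous_intros)
    show "(\<pi>(j := (\<lambda>x. complex_of_real (R (g x)) - complex_of_real (R (\<kappa> x))))) j x = 0" if "\<bar>g x - a\<bar> < 2 * \<delta>" for x
      using that by (auto simp: \<kappa>_def)
  qed (use adm ur j supp \<delta> in \<open>auto intro: adm_fun_upd Lipf_diff\<close>)
  then have Tr: "T f (\<pi>(j := (\<lambda>x. complex_of_real (R (g x))))) = T f (\<pi>(j := (\<lambda>x. complex_of_real (R (\<kappa> x)))))"
    using slot_diff[OF adm j r LipfI[OF u]] by simp
  \<comment> \<open>The affine part of \<open>\<phi>\<close> splits into a multiple of
    \<open>g\<close> and a constant, and a constant slot contributes 0.\<close>
  have "(\<lambda>x. complex_of_real (\<phi> (g x))) =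
      (\<lambda>x. (complex_of_real (R (g x)) + complex_of_real (\<phi>' a) * ?g x) + complex_of_real (\<phi> a - \<phi>' a * a))"
    by (auto simp: R_def algebra_simps)
  then have "T f (\<pi>(j := (\<lambda>x. complex_of_real (\<phi> (g x))))) =
      T f (\<pi>(j := (\<lambda>x. complex_of_real (R (\<kappa> x))))) + complex_of_real (\<phi>' a) * T f (\<pi>(j := ?g))"
    using adm j g' r by (simp add: slot_add slot_cmult slot_const Lipf_add Lipf_cmult Lipf_const Tr)
  moreover have "T (\<lambda>x. complex_of_real (\<phi>' a) * f x - f x * complex_of_real (\<phi>' (g x))) (\<pi>(j := ?g)) =
      complex_of_real (\<phi>' a) * T f (\<pi>(j := ?g)) - T (\<lambda>x. f x * complex_of_real (\<phi>' (g x))) (\<pi>(j := ?g))"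
    using admD(1)[OF adm] \<phi>'b adm g'
    by (subst first_diff) (auto simp: first_cmult adm_fun_upd intro!: Lipb_mult Lipb_cmult adm_first[OF adm_fun_upd[OF adm g']])
  ultimately have eq: "T f (\<pi>(j := (\<lambda>x. complex_of_real (\<phi> (g x))))) -
      T (\<lambda>x. f x * complex_of_real (\<phi>' (g x))) (\<pi>(j := ?g)) = T f (\<pi>(j := (\<lambda>x. complex_of_real (R (\<kappa> x))))) +
      T (\<lambda>x. complex_of_real (\<phi>' a) * f x - f x * complex_of_real (\<phi>' (g x))) (\<pi>(j := ?g))" by simp
  have 1: "cmod (T f (\<pi>(j := (\<lambda>x. complex_of_real (R (\<kappa> x)))))) \<le> (2 * K * \<delta> * G) * ?P * ?I"
    by (rule integral_mass_boundD_upd[OF M borel_S adm j u fi]) simp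
  have 2: "cmod (T (\<lambda>x. complex_of_real (\<phi>' a) * f x - f x * complex_of_real (\<phi>' (g x))) (\<pi>(j := ?g)))
      \<le> G * ?P * (LINT x:S|M. (K * \<delta>) * cmod (f x))"
  proof (rule integral_mass_boundD_upd[OF M borel_S _ j])
    show "adm k S (\<lambda>x. complex_of_real (\<phi>' a) * f x - f x * complex_of_real (\<phi>' (g x))) \<pi>"
      using admD(1)[OF adm] \<phi>'b by (intro adm_first[OF adm] Lipb_diff Lipb_cmult Lipb_mult) auto
    show "G-lipschitz_on S ?g" using g by simp
    show "set_integrable M S (\<lambda>x. (K * \<delta>) * cmod (f x))" using fi by (intro set_integrable_mult_right) auto
    fix x assume x: "x \<in> S"
    have "cmod (complex_of_real (\<phi>' a) * f x - f x * complex_of_real (\<phi>' (g x))) = \<bar>\<phi>' a - \<phi>' (g x)\<bar> * cmod (f x)"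
    proof -
      have "complex_of_real (\<phi>' a) * f x - f x * complex_of_real (\<phi>' (g x)) = complex_of_real (\<phi>' a - \<phi>' (g x)) * f x"
        by (simp add: algebra_simps)
      then show ?thesis by (simp only: norm_mult norm_of_real)
    qed
    also have "\<dots> \<le> (K * \<delta>) * cmod (f x)"
    proof (cases "f x = 0")
      case False
      then have "K * \<bar>a - g x\<bar> \<le> K * \<delta>" using supp[OF x] K0 by (intro mult_left_mono) (auto simp: abs_minus_commute)
      then show ?thesis using KD[of a "g x"] by (intro mult_right_mono) auto
    qed simp
    finally show "cmod (complex_of_real (\<phi>' a) * f x - f x * complex_of_real (\<phi>' (g x))) \<le> (K * \<delta>) * cmod (f x)" .
  qed
  \<comment> \<open>The constant 3 is 2 from the clamped remainder plus 1 from replacing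
    \<open>\<phi>' (g x)\<close> by \<open>\<phi>' a\<close>.\<close>
  have "cmod (T f (\<pi>(j := (\<lambda>x. complex_of_real (\<phi> (g x))))) -
      T (\<lambda>x. f x * complex_of_real (\<phi>' (g x))) (\<pi>(j := ?g))) \<le> (2 * K * \<delta> * G) * ?P * ?I + G * ?P * ((K * \<delta>) * ?I)"
    unfolding eq using order_trans[OF norm_triangle_ineq add_mono[OF 1 2]] by simp
  then show ?thesis by (simp add: algebra_simps)
qed

text \<open>A partition of unity by hat functions of \<^term>\<open>g\<close> reduces an additive functional of
  \<^term>\<open>f\<close> to functions on whose support \<^term>\<open>g\<close> is almost constant.\<close>
lemma bound_by_localization:
  fixes g :: "'a \<Rightarrow> real" and D :: "('a \<Rightarrow> complex) \<Rightarrow> complex"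
  assumes M: "finite_measure M" "sets M = sets borel" and f: "Lipb S f"
    and g: "G-lipschitz_on S g" "\<And>x. x \<in> S \<Longrightarrow> \<bar>g x\<bar> \<le> b" and \<delta>: "\<delta> > 0"
    and add: "\<And>f1 f2. Lipb S f1 \<Longrightarrow> Lipb S f2 \<Longrightarrow> D (\<lambda>x. f1 x + f2 x) = D f1 + D f2"
    and cong: "\<And>f1 f2. Lipb S f1 \<Longrightarrow> (\<And>x. x \<in> S \<Longrightarrow> f1 x = f2 x) \<Longrightarrow> D f1 = D f2"
    and bnd: "\<And>f a. Lipb S f \<Longrightarrow> (\<And>x. x \<in> S \<Longrightarrow> f x \<noteq> 0 \<Longrightarrow> \<bar>g x - a\<bar> \<le> \<delta>) \<Longrightarrow> cmod (D f) \<le> C * (LINT x:S|M. cmod (f x))"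
  shows "cmod (D f) \<le> C * (LINT x:S|M. cmod (f x))"
proof -
  define c :: "real \<Rightarrow> real" where "c y = max 0 (min 1 y)" for y
  define v where "v x = (g x + b) / \<delta>" for x
  \<comment> \<open>The hat centred at \<open>i\<close> in the rescaled variable \<open>v\<close>,
    written as a difference of two clamps so that the sum over \<open>i\<close> telescopes.\<close>
  define \<rho> where "\<rho> i x = c (v x - real i + 1) - c (v x - real i)" for i x
  \<comment> \<open>The values of \<open>v\<close> lie between 0 and
    \<open>2 * b / \<delta>\<close>; the extra 1 ensures \<open>v x \<le> real N - 1\<close>, for
    which the telescoped sum equals 1.\<close>
  define N where "N = nat \<lceil>2 * b / \<delta>\<rceil> + 1"
  have \<rho>0: "0 \<le> \<rho> i x" "\<rho> i x \<le> 1" for i x by (auto simp: \<rho>_def c_def)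
  have v: "(G / \<delta>)-lipschitz_on S v"
  proof (rule lipschitz_onI)
    fix x y assume "x \<in> S" "y \<in> S"
    then have "\<bar>g x - g y\<bar> \<le> G * dist x y" using lipschitz_onD[OF g(1)] by (auto simp: dist_real_def)
    then show "dist (v x) (v y) \<le> G / \<delta> * dist x y"
      using \<delta> by (simp add: v_def dist_real_def divide_right_mono flip: diff_divide_distrib)
  qed (use lipschitz_on_nonneg[OF g(1)] \<delta> in auto)
  have \<rho>L: "Lipb S (\<lambda>x. complex_of_real (\<rho> i x))" for i
  proof (rule LipbI[of "2 * (G / \<delta>)" _ _ 1])
    have "(2 * (G / \<delta>))-lipschitz_on S (\<rho> i)"
    proof (rule lipschitz_onI)
      fix x y assume "x \<in> S" "y \<in> S"
      then have "\<bar>v x - v y\<bar> \<le> G / \<delta> * dist x y" using lipschitz_onD[OF v] by (auto simp: dist_real_def)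
      moreover have "\<bar>\<rho> i x - \<rho> i y\<bar> \<le> 2 * \<bar>v x - v y\<bar>" 
      proof -
        have "\<bar>c z - c w\<bar> \<le> \<bar>z - w\<bar>" for z w by (auto simp: c_def)
        then have "\<bar>c (v x - real i + 1) - c (v y - real i + 1)\<bar> + \<bar>c (v x - real i) - c (v y - real i)\<bar>
            \<le> \<bar>(v x - real i + 1) - (v y - real i + 1)\<bar> + \<bar>(v x - real i) - (v y - real i)\<bar>"
          by (intro add_mono)
        moreover have "\<rho> i x - \<rho> i y = (c (v x - real i + 1) - c (v y - real i + 1)) - (c (v x - real i) - c (v y - real i))"
          by (simp add: \<rho>_def)
        ultimately show ?thesis
          using abs_triangle_ineq4[of "c (v x - real i + 1) - c (v y - real i + 1)" "c (v x - real i) - c (v y - real i)"]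
          by simp
      qed
      ultimately show "dist (\<rho> i x) (\<rho> i y) \<le> 2 * (G / \<delta>) * dist x y" by (simp add: dist_real_def)
    qed (use lipschitz_on_nonneg[OF v] in auto)
    then show "(2 * (G / \<delta>))-lipschitz_on S (\<lambda>x. complex_of_real (\<rho> i x))" by simp
  qed (use \<rho>0 in auto)
  have part: "(\<Sum>i<N. \<rho> i x) = 1" if x: "x \<in> S" for x
  proof -
    have "(\<Sum>i<n. \<rho> i x) = c (v x + 1) - c (v x - real n + 1)" for n
      by (induction n) (auto simp: \<rho>_def algebra_simps)
    moreover have "0 \<le> v x" using g(2)[OF x] \<delta> by (auto simp: v_def)
    moreover have "v x \<le> real N - 1"
    proof -
      have "v x \<le> 2 * b / \<delta>" using g(2)[OF x] \<delta> by (auto simp: v_def intro!: divide_right_mono)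
      also have "\<dots> \<le> real (nat \<lceil>2 * b / \<delta>\<rceil>)" by (rule real_nat_ceiling_ge)
      finally show ?thesis by (simp add: N_def)
    qed
    ultimately show ?thesis by (simp add: c_def)
  qed
  have fL: "Lipb S (\<lambda>x. f x * complex_of_real (\<rho> i x))" for i by (rule Lipb_mult[OF f \<rho>L])
  have sumL: "Lipb S (\<lambda>x. \<Sum>i<n. f x * complex_of_real (\<rho> i x)) \<and>
      D (\<lambda>x. \<Sum>i<n. f x * complex_of_real (\<rho> i x)) = (\<Sum>i<n. D (\<lambda>x. f x * complex_of_real (\<rho> i x)))" for n
  proof (induction n)
    case 0
    have "D (\<lambda>x. 0) = 0" using add[OF Lipb_const[of S 0] Lipb_const[of S 0]] by simp
    then show ?case by (simp add: Lipb_const)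
  next
    case (Suc n)
    then show ?case using fL[of n] by (simp add: add Lipb_add)
  qed
  have "D (\<lambda>x. \<Sum>i<N. f x * complex_of_real (\<rho> i x)) = D f"
    using sumL part by (intro cong) (auto simp flip: sum_distrib_left of_real_sum)
  then have "D f = (\<Sum>i<N. D (\<lambda>x. f x * complex_of_real (\<rho> i x)))" using sumL by simp
  then have "cmod (D f) \<le> (\<Sum>i<N. cmod (D (\<lambda>x. f x * complex_of_real (\<rho> i x))))" by (simp add: norm_sum)
  also have "\<dots> \<le> (\<Sum>i<N. C * (LINT x:S|M. cmod (f x * complex_of_real (\<rho> i x))))"
  proof (intro sum_mono bnd fL)
    \<comment> \<open>The \<open>i\<close>-th hat is supported where \<open>g\<close> is within
      \<open>\<delta>\<close> of the centre \<open>real i * \<delta> - b\<close>.\<close>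
    fix i x assume "f x * complex_of_real (\<rho> i x) \<noteq> 0"
    then have "\<rho> i x \<noteq> 0" by auto
    then have "\<bar>v x - real i\<bar> \<le> 1" by (auto simp: \<rho>_def c_def split: if_splits)
    moreover have "v x - real i = (g x - (real i * \<delta> - b)) / \<delta>" using \<delta> by (simp add: v_def field_simps)
    ultimately show "\<bar>g x - (real i * \<delta> - b)\<bar> \<le> \<delta>" using \<delta> by (simp add: field_simps)
  qed
  also have "\<dots> = C * (\<Sum>i<N. LINT x:S|M. cmod (f x * complex_of_real (\<rho> i x)))" by (simp add: sum_distrib_left)
  also have "(\<Sum>i<N. LINT x:S|M. cmod (f x * complex_of_real (\<rho> i x))) =
      (LINT x:S|M. (\<Sum>i<N. cmod (f x * complex_of_real (\<rho> i x))))"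
  proof -
    have "set_integrable M S (\<lambda>x. cmod (f x * complex_of_real (\<rho> i x)))" for i
    proof -
      obtain L B where B: "0 \<le> B" "\<And>x. x \<in> S \<Longrightarrow> cmod (f x * complex_of_real (\<rho> i x)) \<le> B"
        using LipbE[OF fL[of i]] by blast
      show ?thesis
        using M B borel_S fL[of i]
        by (intro set_integrable_bounded_continuous[where B = B] continuous_on_norm Lipf_continuous_on Lipf_of_Lipb) auto
    qed
    then show ?thesis
      unfolding set_lebesgue_integral_def set_integrable_def scaleR_sum_right
      by (subst Bochner_Integration.integral_sum) auto
  qed
  \<comment> \<open>The hats are nonnegative with sum 1, so the integrals add up to that of
    \<open>cmod (f x)\<close> itself. The number of hats, which grows as \<open>\<delta>\<close>
    shrinks, does not enter the bound.\<close>
  also have "\<dots> = (LINT x:S|M. cmod (f x))"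
    using \<rho>0 part borel_S M(2)
    by (intro set_lebesgue_integral_cong) (auto simp: norm_mult simp flip: sum_distrib_left)
  finally show ?thesis .
qed

text \<open>The defect \<open>D\<close> is additive in its argument. Localization extends the
  estimate of \<open>chain_rule_local\<close> to all of \<open>f\<close> with the same factor
  \<open>\<delta>\<close>, and \<open>\<delta>\<close> is arbitrary.\<close>

lemma chain_rule:
  fixes g :: "'a \<Rightarrow> real" and \<phi> \<phi>' :: "real \<Rightarrow> real"
  assumes adm: "adm k S f \<pi>" and j: "j < k" and g: "Lipb S (\<lambda>x. complex_of_real (g x))"
    and d: "\<And>y. (\<phi> has_real_derivative \<phi>' y) (at y)" and K: "K-lipschitz_on UNIV \<phi>'"
  shows "T f (\<pi>(j := (\<lambda>x. complex_of_real (\<phi> (g x))))) =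
      T (\<lambda>x. f x * complex_of_real (\<phi>' (g x))) (\<pi>(j := (\<lambda>x. complex_of_real (g x))))"
proof -
  obtain M where M: "integral_mass_bound k S T M" by (rule exists_integral_mass_bound)
  obtain G b where "G-lipschitz_on S (\<lambda>x. complex_of_real (g x))"
    and b0: "\<And>x. x \<in> S \<Longrightarrow> cmod (complex_of_real (g x)) \<le> b"
    using LipbE[OF g] by blast
  then have G: "G-lipschitz_on S g" and b: "\<And>x. x \<in> S \<Longrightarrow> \<bar>g x\<bar> \<le> b" by auto
  have gf: "Lipf S (\<lambda>x. complex_of_real (g x))" using g by (rule Lipf_of_Lipb)
  have K0: "0 \<le> K" using K lipschitz_on_nonneg by auto
  have \<phi>'b: "Lipb S (\<lambda>x. complex_of_real (\<phi>' (g x)))"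
  proof (rule LipbI[of "K * G"])
    show "(K * G)-lipschitz_on S (\<lambda>x. complex_of_real (\<phi>' (g x)))"
      using lipschitz_on_compose2[OF G, of K \<phi>'] lipschitz_on_subset[OF K] by simp
    fix x assume "x \<in> S"
    then have "K * \<bar>g x\<bar> \<le> K * b" using b K0 by (intro mult_left_mono) auto
    then show "cmod (complex_of_real (\<phi>' (g x))) \<le> \<bar>\<phi>' 0\<bar> + K * b"
      using lipschitz_onD[OF K, of "g x" 0] by (simp add: dist_real_def)
  qed
  have \<phi>f: "Lipf S (\<lambda>x. complex_of_real (\<phi> (g x)))"
  proof (cases "S = {}")
    case False
    then have "0 \<le> b" using b by force
    have "(\<bar>\<phi>' 0\<bar> + K * b)-lipschitz_on {-b..b} \<phi>"
    proof (rule lipschitz_on_interval_deriv[OF d])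
      fix y assume "y \<in> {-b..b}"
      then have "K * \<bar>y\<bar> \<le> K * b" using K0 by (intro mult_left_mono) auto
      then show "\<bar>\<phi>' y\<bar> \<le> \<bar>\<phi>' 0\<bar> + K * b" using lipschitz_onD[OF K, of y 0] by (simp add: dist_real_def)
    qed (use K0 \<open>0 \<le> b\<close> in auto)
    moreover have "g ` S \<subseteq> {-b..b}" using b by (auto simp: abs_le_iff minus_le_iff)
    ultimately have "((\<bar>\<phi>' 0\<bar> + K * b) * G)-lipschitz_on S (\<lambda>x. \<phi> (g x))"
      using G by (intro lipschitz_on_compose2) (auto intro: lipschitz_on_subset)
    then show ?thesis by (intro LipfI) simp
  qed (auto simp: Lipf_def)
  define D where "D h = T h (\<pi>(j := (\<lambda>x. complex_of_real (\<phi> (g x))))) -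
    T (\<lambda>x. h x * complex_of_real (\<phi>' (g x))) (\<pi>(j := (\<lambda>x. complex_of_real (g x))))" for h
  let ?C = "3 * K * G * (\<Prod>i\<in>{..<k} - {j}. lipconst S (\<pi> i))"
  have A: "adm k S h (\<pi>(j := (\<lambda>x. complex_of_real (\<phi> (g x)))))"
    "adm k S (\<lambda>x. h x * complex_of_real (\<phi>' (g x))) (\<pi>(j := (\<lambda>x. complex_of_real (g x))))" if "Lipb S h" for h
    using that adm \<phi>f gf \<phi>'b by (auto simp: adm_def intro: Lipb_mult)
  have bound: "cmod (D f) \<le> ?C * \<delta> * (LINT x:S|M. cmod (f x))" if \<delta>: "\<delta> > 0" for \<delta>
  proof (rule bound_by_localization[OF _ _ admD(1)[OF adm] G b \<delta>])
    show "finite_measure M" "sets M = sets borel" using M by (auto simp: integral_mass_bound_def)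
    show "D (\<lambda>x. f1 x + f2 x) = D f1 + D f2" if "Lipb S f1" "Lipb S f2" for f1 f2
      using A[OF that(1)] A[OF that(2)] that
      by (simp add: D_def first_add distrib_right admD(1))
    show "D f1 = D f2" if "Lipb S f1" "\<And>x. x \<in> S \<Longrightarrow> f1 x = f2 x" for f1 f2
      unfolding D_def using that(2)
      by (intro arg_cong2[where f = "(-)"] T_cong[OF A(1)[OF that(1)]] T_cong[OF A(2)[OF that(1)]]) auto
    show "cmod (D f) \<le> ?C * \<delta> * (LINT x:S|M. cmod (f x))"
      if "Lipb S f" "\<And>x. x \<in> S \<Longrightarrow> f x \<noteq> 0 \<Longrightarrow> \<bar>g x - a\<bar> \<le> \<delta>" for f a
      unfolding D_def using that adm
      by (intro chain_rule_local[OF M _ j G b d K _ \<delta>, where a = a]) (auto simp: adm_def)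
  qed
  have "((\<lambda>n. ?C * inverse (real (Suc n)) * (LINT x:S|M. cmod (f x))) \<longlonglongrightarrow> ?C * 0 * (LINT x:S|M. cmod (f x)))"
    by (intro tendsto_intros LIMSEQ_inverse_real_of_nat)
  from LIMSEQ_le_const[OF this, of "cmod (D f)"] have "cmod (D f) \<le> 0"
    using bound by auto
  then show ?thesis by (simp add: D_def)
qed

section \<open>Product rule\<close>

text \<open>Expanding the rule for the square of \<open>u + v\<close> and cancelling the squares of
  \<open>u\<close> and \<open>v\<close> leaves twice the mixed terms.\<close>

lemma product_rule_polarize:
  assumes adm: "adm k S f \<pi>" and j: "j < k" and u: "Lipb S u" and v: "Lipb S v"
    and sq: "\<And>w. w \<in> {u, v, \<lambda>x. u x + v x} \<Longrightarrow>
      T f (\<pi>(j := (\<lambda>x. w x * w x))) = 2 * T (\<lambda>x. f x * w x) (\<pi>(j := w))"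
  shows "T f (\<pi>(j := (\<lambda>x. u x * v x))) = T (\<lambda>x. f x * u x) (\<pi>(j := v)) + T (\<lambda>x. f x * v x) (\<pi>(j := u))"
proof -
  note L = u[THEN Lipf_of_Lipb] v[THEN Lipf_of_Lipb]
  have fL: "Lipb S f" using adm by (rule admD)
  have m: "Lipf S (\<lambda>x. u x * u x)" "Lipf S (\<lambda>x. u x * v x)" "Lipf S (\<lambda>x. v x * v x)"
    using u v by (auto intro: Lipf_of_Lipb Lipb_mult)
  have "T f (\<pi>(j := (\<lambda>x. (u x + v x) * (u x + v x)))) =
      T f (\<pi>(j := (\<lambda>x. (u x * u x + v x * v x) + 2 * (u x * v x))))"
    by (simp add: algebra_simps)
  also have "\<dots> = T f (\<pi>(j := (\<lambda>x. u x * u x))) + T f (\<pi>(j := (\<lambda>x. v x * v x))) + 2 * T f (\<pi>(j := (\<lambda>x. u x * v x)))"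
    using adm j m by (simp add: slot_add slot_cmult Lipf_add Lipf_cmult)
  finally have 1: "2 * T (\<lambda>x. f x * (u x + v x)) (\<pi>(j := (\<lambda>x. u x + v x))) =
      2 * T (\<lambda>x. f x * u x) (\<pi>(j := u)) + 2 * T (\<lambda>x. f x * v x) (\<pi>(j := v)) + 2 * T f (\<pi>(j := (\<lambda>x. u x * v x)))"
    using sq by simp
  have ad: "adm k S (\<lambda>x. f x * w x) \<pi>" if "Lipb S w" for w
    using that fL by (intro adm_first[OF adm] Lipb_mult)
  have 2: "T (\<lambda>x. f x * (u x + v x)) (\<pi>(j := (\<lambda>x. u x + v x))) =
      T (\<lambda>x. f x * (u x + v x)) (\<pi>(j := u)) + T (\<lambda>x. f x * (u x + v x)) (\<pi>(j := v))"
    using j L ad[OF Lipb_add[OF u v]] by (intro slot_add) auto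
  have 3: "T (\<lambda>x. f x * (u x + v x)) (\<pi>(j := w)) = T (\<lambda>x. f x * u x) (\<pi>(j := w)) + T (\<lambda>x. f x * v x) (\<pi>(j := w))"
    if "Lipf S w" for w
    unfolding distrib_left using that ad[OF u] ad[OF v] by (intro first_add) (auto intro: adm_fun_upd admD)
  have lin: "2 * (a + b + (c + d)) = 2 * a + 2 * d + 2 * y \<Longrightarrow> y = c + b" for a b c d y :: complex
    by algebra
  show ?thesis by (rule lin) (use 1 in \<open>simp only: 2 3[OF L(1)] 3[OF L(2)]\<close>)
qed

text \<open>The chain rule for \<open>\<lambda>y. y * y\<close> gives the rule for squares of real
  functions; polarization and then \<open>complexify\<close> give the rest.\<close>

lemma product_rule:
  assumes adm: "adm k S f \<pi>" and j: "j < k" and "Lipb S u" and "Lipb S v"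
  shows "T f (\<pi>(j := (\<lambda>x. u x * v x))) = T (\<lambda>x. f x * u x) (\<pi>(j := v)) + T (\<lambda>x. f x * v x) (\<pi>(j := u))"
proof (rule complexify[where Q = "Lipb S" and P = "\<lambda>u v. T f (\<pi>(j := (\<lambda>x. u x * v x))) =
      T (\<lambda>x. f x * u x) (\<pi>(j := v)) + T (\<lambda>x. f x * v x) (\<pi>(j := u))"])
  show "Lipb S (\<lambda>x. complex_of_real (Re (u x))) \<and> Lipb S (\<lambda>x. complex_of_real (Im (u x)))" if "Lipb S u" for u
    using Lipb_Re_Im[OF that] by simp
next
  have sq: "T f (\<pi>(j := (\<lambda>x. complex_of_real (w x) * complex_of_real (w x)))) =
      2 * T (\<lambda>x. f x * complex_of_real (w x)) (\<pi>(j := (\<lambda>x. complex_of_real (w x))))"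
    if w: "Lipb S (\<lambda>x. complex_of_real (w x))" for w
  proof -
    have "T f (\<pi>(j := (\<lambda>x. complex_of_real (w x * w x)))) =
        T (\<lambda>x. f x * complex_of_real (2 * w x)) (\<pi>(j := (\<lambda>x. complex_of_real (w x))))"
    proof (rule chain_rule[OF adm j w, where \<phi> = "\<lambda>y. y * y" and K = 2])
      show "((\<lambda>y. y * y) has_real_derivative 2 * y) (at y)" for y :: real
        by (auto intro!: derivative_eq_intros)
      show "2-lipschitz_on UNIV (\<lambda>y::real. 2 * y)"
        using lipschitz_on_cmult_real[OF lipschitz_on_id, of 2 UNIV] by simp
    qed
    also have "\<dots> = T (\<lambda>x. 2 * (f x * complex_of_real (w x))) (\<pi>(j := (\<lambda>x. complex_of_real (w x))))"
      by (simp add: mult_ac)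
    also have "\<dots> = 2 * T (\<lambda>x. f x * complex_of_real (w x)) (\<pi>(j := (\<lambda>x. complex_of_real (w x))))"
      using w admD(1)[OF adm]
      by (intro first_cmult adm_fun_upd adm_first[OF adm] Lipb_mult Lipf_of_Lipb)
    finally show ?thesis by simp
  qed
  fix u v :: "'a \<Rightarrow> real"
  assume u: "Lipb S (\<lambda>x. complex_of_real (u x))" and v: "Lipb S (\<lambda>x. complex_of_real (v x))"
  have uv: "Lipb S (\<lambda>x. complex_of_real (u x + v x))" using Lipb_add[OF u v] by simp
  show "T f (\<pi>(j := (\<lambda>x. complex_of_real (u x) * complex_of_real (v x)))) =
      T (\<lambda>x. f x * complex_of_real (u x)) (\<pi>(j := (\<lambda>x. complex_of_real (v x)))) +
      T (\<lambda>x. f x * complex_of_real (v x)) (\<pi>(j := (\<lambda>x. complex_of_real (u x))))"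
    using sq[OF u] sq[OF v] sq[OF uv] by (intro product_rule_polarize[OF adm j u v]) auto
next
  fix u v assume "T f (\<pi>(j := (\<lambda>x. u x * v x))) = T (\<lambda>x. f x * u x) (\<pi>(j := v)) + T (\<lambda>x. f x * v x) (\<pi>(j := u))"
  then show "T f (\<pi>(j := (\<lambda>x. v x * u x))) = T (\<lambda>x. f x * v x) (\<pi>(j := u)) + T (\<lambda>x. f x * u x) (\<pi>(j := v))"
    by (simp add: mult.commute)
next
  fix u1 u2 v assume L: "Lipb S u1" "Lipb S u2" "Lipb S v"
    and h1: "T f (\<pi>(j := (\<lambda>x. u1 x * v x))) = T (\<lambda>x. f x * u1 x) (\<pi>(j := v)) + T (\<lambda>x. f x * v x) (\<pi>(j := u1))"
    and h2: "T f (\<pi>(j := (\<lambda>x. u2 x * v x))) = T (\<lambda>x. f x * u2 x) (\<pi>(j := v)) + T (\<lambda>x. f x * v x) (\<pi>(j := u2))"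
  have ad: "adm k S (\<lambda>x. f x * w x) \<pi>" if "Lipb S w" for w
    using that admD(1)[OF adm] by (intro adm_first[OF adm] Lipb_mult)
  have "T f (\<pi>(j := (\<lambda>x. (u1 x + \<i> * u2 x) * v x))) = T f (\<pi>(j := (\<lambda>x. 1 * (u1 x * v x) + \<i> * (u2 x * v x))))"
    by (simp add: algebra_simps)
  also have "\<dots> = 1 * T f (\<pi>(j := (\<lambda>x. u1 x * v x))) + \<i> * T f (\<pi>(j := (\<lambda>x. u2 x * v x)))"
    using L by (intro slot_lin adm j Lipf_of_Lipb Lipb_mult)
  finally have 1: "T f (\<pi>(j := (\<lambda>x. (u1 x + \<i> * u2 x) * v x))) =
    T f (\<pi>(j := (\<lambda>x. u1 x * v x))) + \<i> * T f (\<pi>(j := (\<lambda>x. u2 x * v x)))" by simp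
  have "T (\<lambda>x. f x * (u1 x + \<i> * u2 x)) (\<pi>(j := v)) = T (\<lambda>x. 1 * (f x * u1 x) + \<i> * (f x * u2 x)) (\<pi>(j := v))"
    by (simp add: algebra_simps)
  also have "\<dots> = 1 * T (\<lambda>x. f x * u1 x) (\<pi>(j := v)) + \<i> * T (\<lambda>x. f x * u2 x) (\<pi>(j := v))"
    using L ad by (intro first_lin adm_fun_upd Lipf_of_Lipb) (auto intro: admD)
  finally have 2: "T (\<lambda>x. f x * (u1 x + \<i> * u2 x)) (\<pi>(j := v)) =
    T (\<lambda>x. f x * u1 x) (\<pi>(j := v)) + \<i> * T (\<lambda>x. f x * u2 x) (\<pi>(j := v))" by simp
  have 3: "T (\<lambda>x. f x * v x) (\<pi>(j := (\<lambda>x. u1 x + \<i> * u2 x))) =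
      T (\<lambda>x. f x * v x) (\<pi>(j := u1)) + \<i> * T (\<lambda>x. f x * v x) (\<pi>(j := u2))"
    using slot_lin[OF ad[OF L(3)] j Lipf_of_Lipb[OF L(1)] Lipf_of_Lipb[OF L(2)], of 1 \<i>] by simp
  show "T f (\<pi>(j := (\<lambda>x. (u1 x + \<i> * u2 x) * v x))) =
      T (\<lambda>x. f x * (u1 x + \<i> * u2 x)) (\<pi>(j := v)) + T (\<lambda>x. f x * v x) (\<pi>(j := (\<lambda>x. u1 x + \<i> * u2 x)))"
    unfolding 1 2 3 h1 h2 by (simp add: algebra_simps)
qed (use assms in auto)

section \<open>Alternation\<close>

text \<open>The continuity axiom speaks of all slots at once, so the moving slots and the fixed ones
  need a common Lipschitz constant; the sum of all the constants is one.\<close>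

lemma two_slots_tendsto:
  assumes adm: "adm k S f \<pi>" and g: "Lipf S g" "Lipf S h"
    and L: "\<And>n. L-lipschitz_on S (gs n)" "\<And>n. L-lipschitz_on S (hs n)"
    and lim: "\<And>x. x \<in> S \<Longrightarrow> (\<lambda>n. gs n x) \<longlonglongrightarrow> g x" "\<And>x. x \<in> S \<Longrightarrow> (\<lambda>n. hs n x) \<longlonglongrightarrow> h x"
  shows "(\<lambda>n. T f (\<pi>(i := gs n, j := hs n))) \<longlonglongrightarrow> T f (\<pi>(i := g, j := h))"
proof (rule T_tendsto)
  let ?L = "L + (\<Sum>l<k. lipconst S (\<pi> l))"
  have p: "0 \<le> lipconst S (\<pi> l)" if "l < k" for l using adm that by (intro lipconst_nonneg) (rule admD)
  have L0: "0 \<le> L" using lipschitz_on_nonneg[OF L(1)] .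
  have "0 \<le> (\<Sum>l<k. lipconst S (\<pi> l))" using p by (intro sum_nonneg) auto
  then have gh: "?L-lipschitz_on S (gs n)" "?L-lipschitz_on S (hs n)" for n
    using lipschitz_on_le[OF L(1)] lipschitz_on_le[OF L(2)] by auto
  have "?L-lipschitz_on S (\<pi> l)" if "l < k" for l
  proof (rule lipschitz_on_le[OF lipconst_lipschitz_on])
    show "Lipf S (\<pi> l)" using adm that by (rule admD)
    show "lipconst S (\<pi> l) \<le> ?L" using member_le_sum[of l "{..<k}" "\<lambda>l. lipconst S (\<pi> l)"] p that L0 by auto
  qed
  then show "?L-lipschitz_on S ((\<pi>(i := gs n, j := hs n)) l)" if "l < k" for n l
    using that gh by (cases "l = j"; cases "l = i") auto
  show "adm k S f (\<pi>(i := g, j := h))" using adm g by (intro adm_fun_upd)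
  show "(\<lambda>n. (\<pi>(i := gs n, j := hs n)) l x) \<longlonglongrightarrow> (\<pi>(i := g, j := h)) l x" if "x \<in> S" for l x
    using lim[OF that] by (cases "l = j"; cases "l = i") auto
qed

text \<open>By the chain rule the functions \<open>s\<^sub>n = sin (n g) / n\<close> satisfy
  \<open>T(f, g, g) = 2 T(f, s\<^sub>n, s\<^sub>n) - T(f, g, s\<^bsub>2n\<^esub>)\<close>, since \<open>cos\<^sup>2 y = (1 + cos (2 y)) / 2\<close>.
  Both terms on the right tend to 0 by continuity.\<close>
lemma alternating_real_bounded:
  fixes g :: "'a \<Rightarrow> real"
  assumes adm: "adm k S f \<pi>" and ij: "i < k" "j < k" "i \<noteq> j" and g: "Lipb S (\<lambda>x. complex_of_real (g x))"
  shows "T f (\<pi>(i := (\<lambda>x. complex_of_real (g x)), j := (\<lambda>x. complex_of_real (g x)))) = 0"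
proof -
  let ?g = "\<lambda>x. complex_of_real (g x)"
  define s where "s m x = complex_of_real (sin (m * g x) / m)" for m :: real and x
  define c where "c m x = complex_of_real (cos (m * g x))" for m :: real and x
  have gf: "Lipf S ?g" using g by (rule Lipf_of_Lipb)
  obtain G where G: "G-lipschitz_on S g" using gf by (auto simp: Lipf_def)
  have sinL: "1-lipschitz_on UNIV (sin :: real \<Rightarrow> real)"
    by (rule bounded_derivative_imp_lipschitz[where f' = "\<lambda>x h. cos x * h"])
      (auto intro!: derivative_eq_intros onorm_le mult_left_le_one_le simp: abs_mult)
  have cosL: "1-lipschitz_on UNIV (cos :: real \<Rightarrow> real)"
    by (rule bounded_derivative_imp_lipschitz[where f' = "\<lambda>x h. - sin x * h"])
      (auto intro!: derivative_eq_intros onorm_le mult_left_le_one_le simp: abs_mult)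
  \<comment> \<open>Dividing the sine by \<open>m\<close> keeps the Lipschitz constant at
    \<open>G\<close> for every frequency, while the functions themselves tend to 0: exactly the
    situation that the continuity axiom covers.\<close>
  have sL: "G-lipschitz_on S (s m)" if "m > 0" for m
  proof (rule lipschitz_onI)
    fix x y assume "x \<in> S" "y \<in> S"
    then have "\<bar>g x - g y\<bar> \<le> G * dist x y" using lipschitz_onD[OF G] by (auto simp: dist_real_def)
    moreover have "\<bar>sin (m * g x) - sin (m * g y)\<bar> \<le> m * \<bar>g x - g y\<bar>"
      using lipschitz_onD[OF sinL, of "m * g x" "m * g y"] that
      by (simp add: dist_real_def abs_mult flip: right_diff_distrib)
    then have "dist (s m x) (s m y) \<le> \<bar>g x - g y\<bar>"
    proof -
      have "s m x - s m y = complex_of_real ((sin (m * g x) - sin (m * g y)) / m)"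
        by (simp add: s_def diff_divide_distrib)
      then have "dist (s m x) (s m y) = \<bar>sin (m * g x) - sin (m * g y)\<bar> / m"
        unfolding dist_norm using that by (simp only: norm_of_real abs_divide abs_of_pos)
      then show ?thesis
        using \<open>\<bar>sin (m * g x) - sin (m * g y)\<bar> \<le> m * \<bar>g x - g y\<bar>\<close> that
        by (simp only: pos_divide_le_eq mult.commute)
    qed
    ultimately show "dist (s m x) (s m y) \<le> G * dist x y" by simp
  qed (rule lipschitz_on_nonneg[OF G])
  have cb: "Lipb S (c m)" if "m > 0" for m
  proof (rule LipbI[of "m * G" _ _ 1])
    show "(m * G)-lipschitz_on S (c m)"
    proof (rule lipschitz_onI)
      fix x y assume "x \<in> S" "y \<in> S"
      then have "\<bar>g x - g y\<bar> \<le> G * dist x y" using lipschitz_onD[OF G] by (auto simp: dist_real_def)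
      then have "m * \<bar>g x - g y\<bar> \<le> m * (G * dist x y)" using that by (intro mult_left_mono) auto
      moreover have "dist (c m x) (c m y) \<le> m * \<bar>g x - g y\<bar>"
      proof -
        have "c m x - c m y = complex_of_real (cos (m * g x) - cos (m * g y))" by (simp add: c_def)
        then have "dist (c m x) (c m y) = \<bar>cos (m * g x) - cos (m * g y)\<bar>"
          unfolding dist_norm by (simp only: norm_of_real)
        then show ?thesis
          using lipschitz_onD[OF cosL, of "m * g x" "m * g y"] that
          by (simp add: dist_real_def abs_mult flip: right_diff_distrib)
      qed
      ultimately show "dist (c m x) (c m y) \<le> m * G * dist x y" by simp
    qed (use lipschitz_on_nonneg[OF G] that in auto)
  qed (simp add: c_def)
  have chain: "T h (\<sigma>(l := s m)) = T (\<lambda>x. h x * c m x) (\<sigma>(l := ?g))"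
    if "adm k S h \<sigma>" "l < k" "m > 0" for h \<sigma> l m
    unfolding s_def c_def
  proof (rule chain_rule[OF that(1,2) g, where \<phi> = "\<lambda>y. sin (m * y) / m" and K = m])
    show "((\<lambda>y. sin (m * y) / m) has_real_derivative cos (m * y)) (at y)" for y
      using that by (auto intro!: derivative_eq_intros)
    show "m-lipschitz_on UNIV (\<lambda>y. cos (m * y))"
    proof (rule lipschitz_onI)
      show "dist (cos (m * y)) (cos (m * z)) \<le> m * dist y z" for y z
        using lipschitz_onD[OF cosL, of "m * y" "m * z"] that
        by (simp add: dist_real_def abs_mult flip: right_diff_distrib)
    qed (use that in simp)
  qed
  \<comment> \<open>\<open>chain\<close> used in each slot once produces the factor
    \<open>c m\<close> twice. After the half-angle formula, the term with \<open>c (2 * m)\<close>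
    is folded back by \<open>chain\<close> in slot \<open>j\<close> alone.\<close>
  have key: "T f (\<pi>(i := ?g, j := ?g)) = 2 * T f (\<pi>(i := s m, j := s m)) - T f (\<pi>(i := ?g, j := s (2 * m)))" if m: "m > 0" for m
  proof -
    have sf: "Lipf S (s m)" using sL[OF m] by (rule LipfI)
    have fL: "Lipb S f" using adm by (rule admD)
    have a1: "adm k S (\<lambda>x. f x * c m x) \<pi>" using fL cb[OF m] by (intro adm_first[OF adm] Lipb_mult)
    have a2: "adm k S (\<lambda>x. f x * c (2 * m) x) \<pi>" using fL cb[of "2 * m"] m by (intro adm_first[OF adm] Lipb_mult) auto
    have "T f (\<pi>(i := s m, j := s m)) = T (\<lambda>x. f x * c m x) (\<pi>(i := s m, j := ?g))"
      using adm sf by (intro chain adm_fun_upd ij m)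
    also have "\<dots> = T (\<lambda>x. f x * c m x) (\<pi>(j := ?g, i := s m))" using ij by (simp add: fun_upd_twist)
    also have "\<dots> = T (\<lambda>x. f x * c m x * c m x) (\<pi>(j := ?g, i := ?g))"
      using a1 gf by (intro chain adm_fun_upd ij m)
    also have "(\<lambda>x. f x * c m x * c m x) = (\<lambda>x. (1/2) * f x + (1/2) * (f x * c (2 * m) x))"
    proof
      fix x
      have "cos (2 * m * g x) = 2 * (cos (m * g x))\<^sup>2 - 1" using cos_double_cos[of "m * g x"] by (simp add: mult.assoc)
      then have "c (2 * m) x = 2 * (c m x)\<^sup>2 - 1" by (simp add: c_def)
      then show "f x * c m x * c m x = (1/2) * f x + (1/2) * (f x * c (2 * m) x)"
        by (simp only:) (simp add: power2_eq_square field_simps)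
    qed
    also have "T \<dots> (\<pi>(j := ?g, i := ?g)) =
        (1/2) * T f (\<pi>(j := ?g, i := ?g)) + (1/2) * T (\<lambda>x. f x * c (2 * m) x) (\<pi>(j := ?g, i := ?g))"
      using adm gf a2 by (intro first_lin adm_fun_upd admD(1)[OF a2])
    also have "T (\<lambda>x. f x * c (2 * m) x) (\<pi>(j := ?g, i := ?g)) = T f (\<pi>(i := ?g, j := s (2 * m)))"
      using chain[OF adm_fun_upd[OF adm gf] ij(2), of "2 * m" i] m ij by (simp add: fun_upd_twist)
    finally have "T f (\<pi>(i := s m, j := s m)) =
      (1/2) * T f (\<pi>(j := ?g, i := ?g)) + (1/2) * T f (\<pi>(i := ?g, j := s (2 * m)))" .
    moreover have "\<pi>(j := ?g, i := ?g) = \<pi>(i := ?g, j := ?g)" using ij by (simp add: fun_upd_twist)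
    ultimately show ?thesis by simp
  qed
  have s0: "(\<lambda>n. s (a * real (Suc n)) x) \<longlonglongrightarrow> 0" if "a > 0" for a x
  proof -
    have "(\<lambda>n. sin (a * real (Suc n) * g x) / (a * real (Suc n))) \<longlonglongrightarrow> 0"
    proof (rule Lim_null_comparison)
      show "(\<lambda>n. (1 / a) * inverse (real (Suc n))) \<longlonglongrightarrow> 0"
        using tendsto_mult_left[OF LIMSEQ_inverse_real_of_nat, of "1 / a"] by simp
      show "\<forall>\<^sub>F n in sequentially. norm (sin (a * real (Suc n) * g x) / (a * real (Suc n))) \<le> (1 / a) * inverse (real (Suc n))"
        using that abs_sin_le_one by (auto simp: abs_mult divide_simps intro!: always_eventually)
    qed
    then have "(\<lambda>n. complex_of_real (sin (a * real (Suc n) * g x) / (a * real (Suc n)))) \<longlonglongrightarrow> complex_of_real 0"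
      by (rule tendsto_of_real)
    then show ?thesis by (simp only: s_def of_real_0)
  qed
  have "(\<lambda>n. T f (\<pi>(i := s (1 * real (Suc n)), j := s (1 * real (Suc n))))) \<longlonglongrightarrow> T f (\<pi>(i := (\<lambda>_. 0), j := (\<lambda>_. 0)))"
    by (rule two_slots_tendsto[OF adm Lipf_const Lipf_const sL sL s0 s0]) auto
  moreover have "(\<lambda>n. T f (\<pi>(i := ?g, j := s (2 * real (Suc n))))) \<longlonglongrightarrow> T f (\<pi>(i := ?g, j := (\<lambda>_. 0)))"
    by (rule two_slots_tendsto[OF adm gf Lipf_const _ sL tendsto_const s0]) (use G in auto)
  moreover have "T f (\<pi>(i := (\<lambda>_. 0), j := (\<lambda>_. 0))) = 0" "T f (\<pi>(i := ?g, j := (\<lambda>_. 0))) = 0"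
    using adm gf ij by (auto intro!: slot_const adm_fun_upd Lipf_const)
  ultimately have "(\<lambda>n. 2 * T f (\<pi>(i := s (1 * real (Suc n)), j := s (1 * real (Suc n)))) - T f (\<pi>(i := ?g, j := s (2 * real (Suc n))))) \<longlonglongrightarrow> 2 * 0 - 0"
    by (intro tendsto_diff tendsto_mult tendsto_const) simp_all
  moreover have "(\<lambda>n. 2 * T f (\<pi>(i := s (1 * real (Suc n)), j := s (1 * real (Suc n)))) - T f (\<pi>(i := ?g, j := s (2 * real (Suc n))))) =
      (\<lambda>n. T f (\<pi>(i := ?g, j := ?g)))"
  proof
    show "2 * T f (\<pi>(i := s (1 * real (Suc n)), j := s (1 * real (Suc n)))) - T f (\<pi>(i := ?g, j := s (2 * real (Suc n)))) =
      T f (\<pi>(i := ?g, j := ?g))" for n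
      using key[of "real (Suc n)"] by simp
  qed
  ultimately have "(\<lambda>n::nat. T f (\<pi>(i := ?g, j := ?g))) \<longlonglongrightarrow> 0" by simp
  then show ?thesis by (simp add: LIMSEQ_const_iff)
qed

text \<open>Truncation of \<open>g\<close> at height \<open>n\<close> preserves its Lipschitz
  constant and converges pointwise, so continuity reduces the claim to bounded functions.\<close>

lemma alternating_real:
  fixes g :: "'a \<Rightarrow> real"
  assumes adm: "adm k S f \<pi>" and ij: "i < k" "j < k" "i \<noteq> j" and g: "Lipf S (\<lambda>x. complex_of_real (g x))"
  shows "T f (\<pi>(i := (\<lambda>x. complex_of_real (g x)), j := (\<lambda>x. complex_of_real (g x)))) = 0"
proof -
  define h where "h n x = complex_of_real (max (- real n) (min (real n) (g x)))" for n x
  obtain G where G: "G-lipschitz_on S g" using g by (auto simp: Lipf_def)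
  have hL: "G-lipschitz_on S (h n)" for n
    unfolding h_def lipschitz_on_of_real_iff
  proof (rule lipschitz_onI)
    fix x y assume "x \<in> S" "y \<in> S"
    then have "\<bar>g x - g y\<bar> \<le> G * dist x y" using lipschitz_onD[OF G] by (auto simp: dist_real_def)
    then show "dist (max (- real n) (min (real n) (g x))) (max (- real n) (min (real n) (g y))) \<le> G * dist x y"
      by (auto simp: dist_real_def)
  qed (rule lipschitz_on_nonneg[OF G])
  have lim: "(\<lambda>n. h n x) \<longlonglongrightarrow> complex_of_real (g x)" for x
  proof (rule tendsto_eventually)
    obtain N where "\<bar>g x\<bar> \<le> real N" using real_arch_simple by blast
    then have "h n x = complex_of_real (g x)" if "n \<ge> N" for n using that by (auto simp: h_def)
    then show "\<forall>\<^sub>F n in sequentially. h n x = complex_of_real (g x)" by (auto simp: eventually_sequentially)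
  qed
  have "T f (\<pi>(i := h n, j := h n)) = 0" for n
    unfolding h_def
  proof (rule alternating_real_bounded[OF adm ij])
    show "Lipb S (\<lambda>x. complex_of_real (max (- real n) (min (real n) (g x))))"
      using hL[of n] by (intro LipbI[of G _ _ "real n"]) (auto simp: h_def)
  qed
  moreover have "(\<lambda>n. T f (\<pi>(i := h n, j := h n))) \<longlonglongrightarrow>
      T f (\<pi>(i := (\<lambda>x. complex_of_real (g x)), j := (\<lambda>x. complex_of_real (g x))))"
    by (rule two_slots_tendsto[OF adm g g hL hL lim lim])
  ultimately show ?thesis by (simp add: LIMSEQ_const_iff)
qed

text \<open>For real functions, putting \<open>u + v\<close> into both slots and expanding leaves
  the two mixed terms, which therefore sum to 0; \<open>complexify\<close> does the rest.\<close>

lemma alternating: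
  assumes adm: "adm k S f \<pi>" and ij: "i < k" "j < k" "i \<noteq> j" and "Lipf S u" "Lipf S v"
  shows "T f (\<pi>(i := u, j := v)) = - T f (\<pi>(i := v, j := u))"
proof -
  have slot_i: "T f (\<pi>(i := (\<lambda>x. u1 x + c * u2 x), j := w)) = T f (\<pi>(i := u1, j := w)) + c * T f (\<pi>(i := u2, j := w))"
    if "Lipf S u1" "Lipf S u2" "Lipf S w" for u1 u2 w c
    using slot_lin[OF adm_fun_upd[OF adm that(3)] ij(1) that(1,2), of j 1 c] ij by (simp add: fun_upd_twist)
  have slot_j: "T f (\<pi>(i := w, j := (\<lambda>x. u1 x + c * u2 x))) = T f (\<pi>(i := w, j := u1)) + c * T f (\<pi>(i := w, j := u2))"
    if "Lipf S u1" "Lipf S u2" "Lipf S w" for u1 u2 w c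
    using slot_lin[OF adm_fun_upd[OF adm that(3)] ij(2) that(1,2), of i 1 c] by simp
  show ?thesis
  proof (rule complexify[where Q = "Lipf S" and P = "\<lambda>u v. T f (\<pi>(i := u, j := v)) = - T f (\<pi>(i := v, j := u))"])
    show "Lipf S (\<lambda>x. complex_of_real (Re (u x))) \<and> Lipf S (\<lambda>x. complex_of_real (Im (u x)))" if "Lipf S u" for u
      using Lipf_Re_Im[OF that] by simp
  next
    fix u v :: "'a \<Rightarrow> real"
    assume u: "Lipf S (\<lambda>x. complex_of_real (u x))" and v: "Lipf S (\<lambda>x. complex_of_real (v x))"
    let ?u = "\<lambda>x. complex_of_real (u x)" and ?v = "\<lambda>x. complex_of_real (v x)"
    have uv: "Lipf S (\<lambda>x. ?u x + 1 * ?v x)" using Lipf_add[OF u v] by simp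
    have "T f (\<pi>(i := (\<lambda>x. ?u x + 1 * ?v x), j := (\<lambda>x. ?u x + 1 * ?v x))) = 0"
      using alternating_real[OF adm ij, of "\<lambda>x. u x + v x"] uv by simp
    then show "T f (\<pi>(i := ?u, j := ?v)) = - T f (\<pi>(i := ?v, j := ?u))"
      unfolding slot_i[OF u v uv] slot_j[OF u v u] slot_j[OF u v v]
      using alternating_real[OF adm ij u] alternating_real[OF adm ij v]
      by (simp add: eq_neg_iff_add_eq_0)
  next
    fix u1 u2 v assume L: "Lipf S u1" "Lipf S u2" "Lipf S v"
      and "T f (\<pi>(i := u1, j := v)) = - T f (\<pi>(i := v, j := u1))" "T f (\<pi>(i := u2, j := v)) = - T f (\<pi>(i := v, j := u2))"
    then show "T f (\<pi>(i := (\<lambda>x. u1 x + \<i> * u2 x), j := v)) = - T f (\<pi>(i := v, j := (\<lambda>x. u1 x + \<i> * u2 x)))"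
      by (simp add: slot_i slot_j)
  qed (use assms in auto)
qed

section \<open>Integration by parts and estimates by truncated values\<close>

text \<open>The integration by parts \<open>T(f, \<sigma>, \<pi>) = dT(f \<sigma>, \<pi>) - T(\<sigma>, f, \<pi>)\<close> needs bounded \<^term>\<open>\<sigma>\<close>,
  so the part of \<^term>\<open>f\<close> living where \<^term>\<open>\<sigma>\<close> is large is cut off first.\<close>
lemma slot_zero_bound:
  assumes M: "integral_mass_bound k S T M" and N: "integral_mass_bound (k - 1) S (bdry T) N" and k: "0 < k"
    and f: "L-lipschitz_on S f" "\<And>x. x \<in> S \<Longrightarrow> cmod (f x) \<le> B" and B: "0 \<le> B" and L1: "1 \<le> L"
    and \<pi>: "\<And>j. j < k \<Longrightarrow> L-lipschitz_on S (\<pi> j)"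
  shows "cmod (T f \<pi>) \<le> L ^ k * (2 * B + 1) *
    ((LINT x:S|M. min (cmod (\<pi> 0 x)) 3) + (LINT x:S|N. min (cmod (\<pi> 0 x)) 3))"
proof -
  let ?\<sigma> = "\<pi> 0"
  define m where "m x = min (cmod (?\<sigma> x)) 3" for x
  \<comment> \<open>Equal to 1 where the slot has modulus at most 1 and to 0 where it is at least 2.
    Hence \<open>1 - \<eta>\<close> vanishes unless the modulus exceeds 1, and is dominated by
    \<open>m\<close>.\<close>
  define \<eta> where "\<eta> x = max 0 (min 1 (2 - cmod (?\<sigma> x)))" for x
  \<comment> \<open>Projection of the slot onto the ball of radius 3. It is bounded by
    \<open>m\<close>, and it agrees with the slot well beyond radius 2, where the cut-off
    \<open>f\<close> vanishes, so locality allows the replacement.\<close>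
  define s where "s x = closest_point (cball 0 3) (?\<sigma> x)" for x
  have L0: "0 \<le> L" using L1 by simp
  have \<sigma>: "L-lipschitz_on S ?\<sigma>" using \<pi>[OF k] .
  have m0: "0 \<le> m x" "m x \<le> 3" for x by (auto simp: m_def)
  have \<eta>01: "0 \<le> \<eta> x" "\<eta> x \<le> 1" "1 - \<eta> x \<le> m x" for x by (auto simp: \<eta>_def m_def max_def min_def)
  have s_eq: "s x = ?\<sigma> x" if "cmod (?\<sigma> x) \<le> 3" for x
    using that unfolding s_def by (intro closest_point_self) auto
  have s3: "cmod (s x) \<le> 3" for x
    using closest_point_in_set[of "cball (0::complex) 3" "?\<sigma> x"] by (simp add: s_def)
  have sm: "cmod (s x) \<le> m x" for x
    using s3[of x] s_eq[of x] by (cases "cmod (?\<sigma> x) \<le> 3") (auto simp: m_def)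
  have sL: "L-lipschitz_on S s"
  proof (rule lipschitz_onI)
    fix x y assume xy: "x \<in> S" "y \<in> S"
    have "dist (s x) (s y) \<le> dist (?\<sigma> x) (?\<sigma> y)"
      unfolding s_def by (intro closest_point_lipschitz) auto
    then show "dist (s x) (s y) \<le> L * dist x y" using lipschitz_onD[OF \<sigma> xy] by simp
  qed (rule L0)
  have \<eta>L: "L-lipschitz_on S (\<lambda>x. complex_of_real (\<eta> x))"
    unfolding lipschitz_on_of_real_iff
  proof (rule lipschitz_onI)
    fix x y assume xy: "x \<in> S" "y \<in> S"
    have "\<bar>cmod (?\<sigma> x) - cmod (?\<sigma> y)\<bar> \<le> L * dist x y"
      using lipschitz_onD[OF \<sigma> xy] norm_triangle_ineq3[of "?\<sigma> x" "?\<sigma> y"] by (simp add: dist_norm)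
    then show "dist (\<eta> x) (\<eta> y) \<le> L * dist x y" by (auto simp: \<eta>_def dist_real_def)
  qed (rule L0)
  have fb: "Lipb S f" and sb: "Lipb S s" and \<eta>b: "Lipb S (\<lambda>x. complex_of_real (\<eta> x))"
    using f sL s3 \<eta>L \<eta>01 by (auto intro: LipbI[of L _ _ B] LipbI[of L _ _ 3] LipbI[of L _ _ 1])
  have adm: "adm k S f \<pi>" using fb \<pi> by (auto simp: adm_def intro: LipfI)
  define g where "g x = f x * complex_of_real (\<eta> x)" for x
  have gL: "(B * L + L)-lipschitz_on S g"
    unfolding g_def using lipschitz_on_mult_bounded[OF f(1) \<eta>L f(2), of 1] B \<eta>01 by simp
  have gb: "Lipb S g" unfolding g_def by (rule Lipb_mult[OF fb \<eta>b])
  have gB: "cmod (g x) \<le> B" if "x \<in> S" for x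
    using f(2)[OF that] \<eta>01[of x] mult_mono[of "cmod (f x)" B "\<eta> x" 1] B by (simp add: g_def norm_mult)
  have mc: "continuous_on S m"
    unfolding m_def using lipschitz_on_continuous_on[OF \<sigma>] by (intro continuous_intros)
  have mi: "set_integrable M' S m" if "finite_measure M'" "sets M' = sets borel" for M'
    using that mc m0 borel_S by (intro set_integrable_bounded_continuous[where B = 3]) auto
  have mM: "set_integrable M S m" and mN: "set_integrable N S m"
    using M N by (auto intro!: mi simp: integral_mass_bound_def)
  let ?I = "LINT x:S|M. m x" and ?J = "LINT x:S|N. m x"
  have I0: "0 \<le> ?I" "0 \<le> ?J"
    unfolding set_lebesgue_integral_def using m0 by (auto intro!: integral_nonneg_AE)
  have pw: "L ^ (k - 1) * L = L ^ k" using k by (simp add: power_eq_if)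
  have split: "T f \<pi> = T g \<pi> + T (\<lambda>x. f x * complex_of_real (1 - \<eta> x)) \<pi>"
  proof -
    have "Lipb S (\<lambda>x. f x - g x)" using fb gb by (rule Lipb_diff)
    then have "T (\<lambda>x. g x + (f x - g x)) \<pi> = T g \<pi> + T (\<lambda>x. f x - g x) \<pi>"
      using adm_first[OF adm gb] by (intro first_add)
    moreover have "(\<lambda>x. f x - g x) = (\<lambda>x. f x * complex_of_real (1 - \<eta> x))" by (auto simp: g_def algebra_simps)
    ultimately show ?thesis by simp
  qed
  have b1: "cmod (T (\<lambda>x. f x * complex_of_real (1 - \<eta> x)) \<pi>) \<le> L ^ k * (B * ?I)"
  proof -
    have "cmod (T (\<lambda>x. f x * complex_of_real (1 - \<eta> x)) \<pi>) \<le> (\<Prod>j<k. L) * (LINT x:S|M. B * m x)"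
    proof (rule integral_mass_boundD[OF M borel_S _ \<pi>])
      have "Lipb S (\<lambda>x. complex_of_real (1 - \<eta> x))" using Lipb_diff[OF Lipb_const[of S 1] \<eta>b] by simp
      then show "adm k S (\<lambda>x. f x * complex_of_real (1 - \<eta> x)) \<pi>" using fb by (intro adm_first[OF adm] Lipb_mult)
      show "set_integrable M S (\<lambda>x. B * m x)" using mM by (intro set_integrable_mult_right) auto
      fix x assume x: "x \<in> S"
      have "cmod (f x * complex_of_real (1 - \<eta> x)) = cmod (f x) * (1 - \<eta> x)"
        using \<eta>01[of x] by (simp only: norm_mult norm_of_real)
      also have "\<dots> \<le> B * m x" using f(2)[OF x] \<eta>01[of x] m0[of x] B by (intro mult_mono) auto
      finally show "cmod (f x * complex_of_real (1 - \<eta> x)) \<le> B * m x" .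
    qed
    then show ?thesis by simp
  qed
  have "T g \<pi> = T g (\<pi>(0 := s))"
  proof -
    have "T g (\<pi>(0 := (\<lambda>x. ?\<sigma> x - s x))) = 0"
    proof (rule T_local_band[where h = "\<lambda>x. cmod (?\<sigma> x)" and \<delta> = 2 and \<delta>' = 3 and j = 0 and c = 0])
      show "adm k S g (\<pi>(0 := (\<lambda>x. ?\<sigma> x - s x)))"
        using adm_first[OF adm gb] \<sigma> sL by (intro adm_fun_upd Lipf_diff LipfI)
      show "continuous_on S (\<lambda>x. cmod (?\<sigma> x))"
        using lipschitz_on_continuous_on[OF \<sigma>] by (intro continuous_intros)
      show "\<bar>cmod (?\<sigma> x)\<bar> \<le> 2" if "g x \<noteq> 0" for x
        using that by (auto simp: g_def \<eta>_def split: if_splits)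
    qed (use k s_eq in auto)
    moreover have "T g (\<pi>(0 := (\<lambda>x. ?\<sigma> x - s x))) = T g (\<pi>(0 := ?\<sigma>)) - T g (\<pi>(0 := s))"
      using adm_first[OF adm gb] k \<sigma> sL by (intro slot_diff LipfI)
    ultimately show ?thesis by simp
  qed
  \<comment> \<open>The product rule with first argument 1: the term whose slot 0 holds the product
    \<open>g * s\<close> is a value of the boundary.\<close>
  also have "\<dots> = T (\<lambda>_. 1) (\<pi>(0 := (\<lambda>x. g x * s x))) - T s (\<pi>(0 := g))"
    using product_rule[OF adm_first[OF adm Lipb_const[of S 1]] k gb sb] by simp
  finally have by_parts: "T g \<pi> = T (\<lambda>_. 1) (\<pi>(0 := (\<lambda>x. g x * s x))) - T s (\<pi>(0 := g))" .
  have b2: "cmod (T (\<lambda>_. 1) (\<pi>(0 := (\<lambda>x. g x * s x)))) \<le> L ^ k * (B * ?J)"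
  proof -
    have upd: "T (\<lambda>_. 1) (\<pi>(0 := (\<lambda>x. g x * s x))) = bdry T (\<lambda>x. g x * s x) (\<lambda>j. \<pi> (Suc j))"
      unfolding bdry_def by (rule arg_cong[where f = "T (\<lambda>_. 1)"]) (auto simp: fun_eq_iff)
    have "cmod (bdry T (\<lambda>x. g x * s x) (\<lambda>j. \<pi> (Suc j))) \<le> (\<Prod>j<k - 1. L) * (LINT x:S|N. B * m x)"
    proof (rule integral_mass_boundD[OF N borel_S])
      show "adm (k - 1) S (\<lambda>x. g x * s x) (\<lambda>j. \<pi> (Suc j))"
        using gb sb \<pi> by (auto simp: adm_def intro!: Lipb_mult LipfI[of L])
      show "L-lipschitz_on S (\<pi> (Suc j))" if "j < k - 1" for j using that by (intro \<pi>) auto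
      show "set_integrable N S (\<lambda>x. B * m x)" using mN by (intro set_integrable_mult_right) auto
      show "cmod (g x * s x) \<le> B * m x" if "x \<in> S" for x
        using gB[OF that] sm[of x] B m0 by (auto simp: norm_mult intro!: mult_mono)
    qed
    also have "\<dots> = L ^ (k - 1) * (B * ?J)" by simp
    \<comment> \<open>The boundary has one slot fewer; \<open>1 \<le> L\<close> brings its estimate
      to the common power.\<close>
    also have "\<dots> \<le> L ^ k * (B * ?J)"
      using L1 B I0 by (intro mult_right_mono power_increasing) auto
    finally show ?thesis unfolding upd .
  qed
  have b3: "cmod (T s (\<pi>(0 := g))) \<le> L ^ k * ((B + 1) * ?I)"
  proof -
    have "cmod (T s (\<pi>(0 := g))) \<le> (\<Prod>j<k. if j = 0 then B * L + L else L) * ?I"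
    proof (rule integral_mass_boundD[OF M borel_S])
      show "adm k S s (\<pi>(0 := g))" using adm_first[OF adm sb] gL by (intro adm_fun_upd LipfI)
      show "(if j = 0 then B * L + L else L)-lipschitz_on S ((\<pi>(0 := g)) j)" if "j < k" for j
        using gL \<pi>[OF that] by auto
    qed (use mM sm in auto)
    also have "(\<Prod>j<k. if j = 0 then B * L + L else L) = (B * L + L) * L ^ (k - 1)"
      using k by (subst prod.remove[of _ 0]) auto
    also have "\<dots> = L ^ k * (B + 1)" unfolding pw[symmetric] by (simp add: algebra_simps)
    finally have "cmod (T s (\<pi>(0 := g))) \<le> L ^ k * (B + 1) * ?I" .
    then show ?thesis by (simp only: mult.assoc)
  qed
  have "cmod (T f \<pi>) \<le> L ^ k * (B * ?I) + L ^ k * (B * ?J) + L ^ k * ((B + 1) * ?I)"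
  proof -
    have "T f \<pi> = T (\<lambda>_. 1) (\<pi>(0 := (\<lambda>x. g x * s x))) - T s (\<pi>(0 := g)) + T (\<lambda>x. f x * complex_of_real (1 - \<eta> x)) \<pi>"
      using split by_parts by simp
    then have "cmod (T f \<pi>) \<le> cmod (T (\<lambda>_. 1) (\<pi>(0 := (\<lambda>x. g x * s x)))) + cmod (T s (\<pi>(0 := g)))
        + cmod (T (\<lambda>x. f x * complex_of_real (1 - \<eta> x)) \<pi>)"
      by (metis add_mono_thms_linordered_semiring(3) norm_triangle_ineq norm_triangle_ineq4 order_trans)
    then show ?thesis using b1 b2 b3 by linarith
  qed
  also have "\<dots> = L ^ k * (B * ?I + B * ?J + (B + 1) * ?I)" by (simp add: algebra_simps)
  \<comment> \<open>The \<open>M\<close>-integral has total weight \<open>B + (B + 1)\<close> and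
    the \<open>N\<close>-integral weight \<open>B\<close>.\<close>
  also have "\<dots> \<le> L ^ k * ((2 * B + 1) * (?I + ?J))"
    using L0 B I0 by (intro mult_left_mono) (auto simp: algebra_simps)
  finally show ?thesis by (simp add: m_def mult.assoc)
qed

text \<open>Exchanging slots 0 and \<open>j\<close> changes only the sign, and \<open>L\<close>
  serves all slots alike.\<close>

lemma slot_bound:
  assumes M: "integral_mass_bound k S T M" and N: "integral_mass_bound (k - 1) S (bdry T) N" and j: "j < k"
    and f: "L-lipschitz_on S f" "\<And>x. x \<in> S \<Longrightarrow> cmod (f x) \<le> B" and B: "0 \<le> B" and L1: "1 \<le> L"
    and \<pi>: "\<And>j. j < k \<Longrightarrow> L-lipschitz_on S (\<pi> j)"
  shows "cmod (T f \<pi>) \<le> L ^ k * (2 * B + 1) *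
    ((LINT x:S|M. min (cmod (\<pi> j x)) 3) + (LINT x:S|N. min (cmod (\<pi> j x)) 3))"
proof (cases "j = 0")
  case True
  then show ?thesis using slot_zero_bound[OF M N _ f B L1 \<pi>] j by simp
next
  case False
  have adm: "adm k S f \<pi>" using f \<pi> by (auto simp: adm_def intro: LipfI LipbI)
  have "T f \<pi> = T f (\<pi>(0 := \<pi> 0, j := \<pi> j))" by simp
  also have "\<dots> = - T f (\<pi>(0 := \<pi> j, j := \<pi> 0))"
    using False j \<pi> by (intro alternating[OF adm]) (auto intro: LipfI)
  finally have "cmod (T f \<pi>) = cmod (T f (\<pi>(0 := \<pi> j, j := \<pi> 0)))" by simp
  also have "\<dots> \<le> L ^ k * (2 * B + 1) *
    ((LINT x:S|M. min (cmod ((\<pi>(0 := \<pi> j, j := \<pi> 0)) 0 x)) 3) + (LINT x:S|N. min (cmod ((\<pi>(0 := \<pi> j, j := \<pi> 0)) 0 x)) 3))"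
    using j \<pi> by (intro slot_zero_bound[OF M N _ f B L1]) (auto intro: \<pi>)
  finally show ?thesis using False by simp
qed

text \<open>The hybrids \<open>\<tau> n\<close> replace one slot at a time, and each step puts
  \<open>\<pi> n - \<sigma> n\<close> into slot \<open>n\<close>. This difference has Lipschitz
  constant \<open>2 * L\<close>, whence the power of \<open>2 * L\<close>. For \<open>k = 0\<close>
  there is no slot to replace and both sides are 0.\<close>

lemma difference_bound:
  assumes M: "integral_mass_bound k S T M"
    and N: "0 < k \<Longrightarrow> integral_mass_bound (k - 1) S (bdry T) N"
    and f: "L-lipschitz_on S f" "\<And>x. x \<in> S \<Longrightarrow> cmod (f x) \<le> B" and B: "0 \<le> B" and L1: "1 \<le> L"
    and \<pi>: "\<And>j. j < k \<Longrightarrow> L-lipschitz_on S (\<pi> j)" and \<sigma>: "\<And>j. j < k \<Longrightarrow> L-lipschitz_on S (\<sigma> j)"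
  shows "cmod (T f \<pi> - T f \<sigma>) \<le> (2 * L) ^ k * (2 * B + 1) * (\<Sum>j<k.
    (LINT x:S|M. min (cmod (\<pi> j x - \<sigma> j x)) 3) + (LINT x:S|N. min (cmod (\<pi> j x - \<sigma> j x)) 3))"
proof -
  let ?C = "(2 * L) ^ k * (2 * B + 1)"
  let ?e = "\<lambda>j. (LINT x:S|M. min (cmod (\<pi> j x - \<sigma> j x)) 3) + (LINT x:S|N. min (cmod (\<pi> j x - \<sigma> j x)) 3)"
  define \<tau> where "\<tau> n = (\<lambda>j. if j < n then \<sigma> j else \<pi> j)" for n
  have fb: "Lipb S f" using f by (auto intro: LipbI)
  have adm: "adm k S f (\<tau> n)" for n using fb \<pi> \<sigma> by (auto simp: adm_def \<tau>_def intro: LipfI)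
  have step: "cmod (T f (\<tau> n) - T f (\<tau> (Suc n))) \<le> ?C * ?e n" if n: "n < k" for n
  proof -
    have u: "\<tau> n = (\<tau> n)(n := \<pi> n)" "\<tau> (Suc n) = (\<tau> n)(n := \<sigma> n)" by (auto simp: \<tau>_def fun_eq_iff)
    have "T f ((\<tau> n)(n := (\<lambda>x. \<pi> n x - \<sigma> n x))) = T f ((\<tau> n)(n := \<pi> n)) - T f ((\<tau> n)(n := \<sigma> n))"
      using n \<pi> \<sigma> by (intro slot_diff adm) (auto intro: LipfI)
    then have "T f (\<tau> n) - T f (\<tau> (Suc n)) = T f ((\<tau> n)(n := (\<lambda>x. \<pi> n x - \<sigma> n x)))"
      by (simp only: u(1)[symmetric] u(2)[symmetric])
    also have "cmod \<dots> \<le> ?C * ((LINT x:S|M. min (cmod (((\<tau> n)(n := (\<lambda>x. \<pi> n x - \<sigma> n x))) n x)) 3)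
        + (LINT x:S|N. min (cmod (((\<tau> n)(n := (\<lambda>x. \<pi> n x - \<sigma> n x))) n x)) 3))"
    proof (rule slot_bound[OF M N n _ f(2) B])
      show "0 < k" using n by simp
      show "(2 * L)-lipschitz_on S f" using f(1) L1 by (auto intro: lipschitz_on_le)
      show "1 \<le> 2 * L" using L1 by simp
      fix j assume j: "j < k"
      have "(L + L)-lipschitz_on S (\<lambda>x. \<pi> n x - \<sigma> n x)" using \<pi>[OF n] \<sigma>[OF n] by (rule lipschitz_on_diff)
      moreover have "(2 * L)-lipschitz_on S (\<tau> n j)"
        using \<pi>[OF j] \<sigma>[OF j] L1 by (auto simp: \<tau>_def intro: lipschitz_on_le)
      ultimately show "(2 * L)-lipschitz_on S (((\<tau> n)(n := (\<lambda>x. \<pi> n x - \<sigma> n x))) j)" by simp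
    qed
    finally show ?thesis by simp
  qed
  have tel: "T f (\<tau> 0) - T f (\<tau> n) = (\<Sum>j<n. T f (\<tau> j) - T f (\<tau> (Suc j)))" for n
    by (rule sum_lessThan_telescope'[symmetric])
  have "T f \<pi> - T f \<sigma> = T f (\<tau> 0) - T f (\<tau> k)"
  proof -
    have "T f (\<tau> k) = T f \<sigma>" by (rule T_cong[OF adm]) (auto simp: \<tau>_def)
    moreover have "\<tau> 0 = \<pi>" by (simp add: \<tau>_def)
    ultimately show ?thesis by simp
  qed
  then have "cmod (T f \<pi> - T f \<sigma>) \<le> (\<Sum>j<k. cmod (T f (\<tau> j) - T f (\<tau> (Suc j))))"
    by (simp add: tel norm_sum)
  also have "\<dots> \<le> (\<Sum>j<k. ?C * ?e j)" by (intro sum_mono step) auto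
  finally show ?thesis by (simp add: sum_distrib_left)
qed

end

section \<open>Limits of projective systems of currents\<close>

text \<open>Carries the bound from the mass measure of a current over to the image measure that
  dominates it.\<close>

lemma integral_mass_bound_mono:
  assumes T: "integral_mass_bound k S T M" and le: "measure_le M M'" and S: "S \<in> sets borel"
    and M': "finite_measure M'" "sets M' = sets borel"
  shows "integral_mass_bound k S T M'"
  unfolding integral_mass_bound_def
proof (intro conjI allI impI M')
  fix f \<pi> assume adm: "adm k S f \<pi>"
  have M: "finite_measure M" "sets M = sets borel" using T by (auto simp: integral_mass_bound_def)
  have "M \<le> M'" using le M(2) M'(2) by (subst le_measure) (auto simp: measure_le_def)
  then have "(\<integral>\<^sup>+ x. ennreal (cmod (f x)) * indicator S x \<partial>M) \<le> (\<integral>\<^sup>+ x. ennreal (cmod (f x)) * indicator S x \<partial>M')"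
    using M(2) M'(2) by (intro nn_integral_mono_measure) auto
  then have "(LINT x:S|M. cmod (f x)) \<le> (LINT x:S|M'. cmod (f x))"
    unfolding nn_integral_cmod_eq_set_integral[OF M S admD(1)[OF adm]] nn_integral_cmod_eq_set_integral[OF M' S admD(1)[OF adm]]
    by (simp add: ennreal_le_iff set_integral_cmod_nonneg)
  moreover have "0 \<le> (\<Prod>j<k. lipconst S (\<pi> j))"
    using adm by (intro prod_nonneg) (auto simp: admD intro: lipconst_nonneg)
  moreover have "cmod (T f \<pi>) \<le> (\<Prod>j<k. lipconst S (\<pi> j)) * (LINT x:S|M. cmod (f x))"
    using T adm by (auto simp: integral_mass_bound_def)
  ultimately show "cmod (T f \<pi>) \<le> (\<Prod>j<k. lipconst S (\<pi> j)) * (LINT x:S|M'. cmod (f x))"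
    by (meson mult_left_mono order_trans)
qed

lemma Cauchy_if_bounded_by_null:
  fixes X :: "nat \<Rightarrow> 'a::real_normed_vector"
  assumes "\<And>m n. m \<le> n \<Longrightarrow> norm (X m - X n) \<le> \<delta> m + \<delta> n" "\<delta> \<longlonglongrightarrow> (0::real)"
  shows "Cauchy X"
proof (rule metric_CauchyI)
  fix e :: real assume e: "0 < e"
  then have "\<forall>\<^sub>F n in sequentially. \<delta> n < e / 2" using assms(2) by (intro order_tendstoD) auto
  then obtain N where N: "\<And>n. n \<ge> N \<Longrightarrow> \<delta> n < e / 2" by (auto simp: eventually_sequentially)
  have "dist (X m) (X n) < e" if "m \<ge> N" "n \<ge> N" for m n
  proof (cases "m \<le> n")
    case True
    then show ?thesis using assms(1)[OF True] N[OF that(1)] N[OF that(2)] by (simp add: dist_norm)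
  next
    case False
    then show ?thesis using assms(1)[of n m] N[OF that(1)] N[OF that(2)] by (simp add: dist_norm norm_minus_commute)
  qed
  then show "\<exists>N. \<forall>m\<ge>N. \<forall>n\<ge>N. dist (X m) (X n) < e" by blast
qed

lemma finite_radon_on_finite_measure:
  assumes "finite_radon_on S M"
  shows "finite_measure M"
proof -
  have M: "sets M = sets borel" "emeasure M UNIV < \<infinity>" using assms by (auto simp: finite_radon_on_def)
  then have "space M = UNIV" using sets_eq_imp_space_eq[OF M(1)] by simp
  with M(2) show ?thesis by (intro finite_measureI) auto
qed

lemma borel_measurable_continuous_sets_eq:
  fixes v :: "'a::topological_space \<Rightarrow> 'b::topological_space"
  assumes "sets M = sets borel" "continuous_on UNIV v"
  shows "v \<in> borel_measurable M"
  by (subst measurable_cong_sets[OF assms(1) refl]) (rule borel_measurable_continuous_onI[OF assms(2)])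

section \<open>Limit of a system indexed by the natural numbers\<close>

text \<open>The situation along a cofinal sequence of indices, possibly with repetitions. Density of
  the union of the subspaces appears as the pointwise convergence \<open>P_tendsto\<close>, and the
  hypotheses on mass measures appear as integral bounds.\<close>

locale projective_current_system =
  fixes V :: "nat \<Rightarrow> 'a::real_normed_vector set" and P :: "nat \<Rightarrow> 'a \<Rightarrow> 'a" and a :: real
    and k :: nat and C :: "nat \<Rightarrow> 'a current" and \<mu> \<nu> :: "'a measure"
  assumes P_linear: "bounded_linear (P n)" and P_bound: "norm (P n x) \<le> a * norm x" and a1: "1 \<le> a"
    and P_in: "P n x \<in> V n" and P_id: "x \<in> V n \<Longrightarrow> P n x = x"
    and P_comp: "n \<le> m \<Longrightarrow> P n (P m x) = P n x"
    and P_tendsto: "(\<lambda>n. P n x) \<longlonglongrightarrow> x"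
    and current: "metric_current k (V n) (C n)"
    and compat: "n \<le> m \<Longrightarrow> adm k (V n) f \<pi> \<Longrightarrow> C m (f \<circ> P n) (\<lambda>j. \<pi> j \<circ> P n) = C n f \<pi>"
    and radon: "finite_radon_on UNIV \<mu>" "finite_radon_on UNIV \<nu>"
    and mass: "integral_mass_bound k (V n) (C n) (distr \<mu> borel (P n))"
    and mass_bdry: "0 < k \<Longrightarrow> integral_mass_bound (k - 1) (V n) (bdry (C n)) (distr \<nu> borel (P n))"
begin

lemma P_cont: "continuous_on A (P n)"
  using P_linear by (rule linear_continuous_on)

lemma P_lipschitz: "a-lipschitz_on UNIV (P n)"
proof (rule lipschitz_onI)
  interpret bounded_linear "P n" by (rule P_linear)
  show "dist (P n x) (P n y) \<le> a * dist x y" for x y using P_bound[of n "x - y"] by (simp add: dist_norm diff)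
qed (use a1 in simp)

lemma closed_V: "closed (V n)"
proof -
  have "V n = {x. P n x = x}" by (auto simp: P_id) (metis P_in)
  moreover have "closed {x. P n x = x}" by (intro closed_Collect_eq P_cont continuous_on_id)
  ultimately show ?thesis by simp
qed

lemma sets_mu [simp, measurable_cong]: "sets \<mu> = sets borel" "sets \<nu> = sets borel"
  using radon by (auto simp: finite_radon_on_def)

lemmas finite_mu = finite_radon_on_finite_measure[OF radon(1)] finite_radon_on_finite_measure[OF radon(2)]

lemma closed_current: "closed_current k (V n) (C n)"
  using current closed_V by unfold_locales

lemma lipschitz_compose_P:
  fixes f :: "'a \<Rightarrow> 'b::metric_space"
  assumes "L-lipschitz_on (V n) f"
  shows "(L * a)-lipschitz_on UNIV (\<lambda>x. f (P n x))"
proof (rule lipschitz_on_compose2[OF P_lipschitz])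
  show "L-lipschitz_on (range (P n)) f" by (rule lipschitz_on_subset[OF assms]) (use P_in in auto)
qed

text \<open>\<open>P n\<close> maps into \<open>V n\<close>, so the indicator of \<open>V n\<close>
  becomes 1 after the change of variables.\<close>

lemma set_integral_distr:
  fixes u :: "'a \<Rightarrow> real"
  assumes "sets M = sets borel" "continuous_on (V n) u"
  shows "(LINT x:V n|distr M borel (P n). u x) = (\<integral>x. u (P n x) \<partial>M)"
proof -
  have [measurable]: "P n \<in> measurable M borel"
    by (rule borel_measurable_continuous_sets_eq[OF assms(1) P_cont])
  have "(\<lambda>x. indicator (V n) x *\<^sub>R u x) \<in> borel_measurable borel"
    using assms(2) closed_V by (intro borel_measurable_continuous_on_indicator) auto
  then show ?thesis
    unfolding set_lebesgue_integral_def using P_in by (subst integral_distr) auto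
qed

lemma integrable_bounded_continuous:
  fixes u :: "'a \<Rightarrow> real"
  assumes "finite_measure M" "sets M = sets borel" "continuous_on UNIV u" "\<And>x. \<bar>u x\<bar> \<le> B"
  shows "integrable M u"
proof -
  have "set_integrable M UNIV u"
    by (rule set_integrable_bounded_continuous[OF assms(1,2) _ assms(3,4)]) auto
  then show ?thesis by (simp add: set_integrable_def)
qed

lemma tendsto_compose_P: "continuous_on UNIV u \<Longrightarrow> (\<lambda>n. u (P n x)) \<longlonglongrightarrow> u x"
  by (rule continuous_on_tendsto_compose[OF _ P_tendsto]) auto

lemma integral_P_tendsto:
  fixes u :: "'a \<Rightarrow> real"
  assumes "finite_measure M" "sets M = sets borel" "continuous_on UNIV u" "\<And>x. \<bar>u x\<bar> \<le> B"
  shows "(\<lambda>n. \<integral>x. u (P n x) \<partial>M) \<longlonglongrightarrow> (\<integral>x. u x \<partial>M)"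
proof (rule integral_dominated_convergence)
  interpret finite_measure M by fact
  note m = borel_measurable_continuous_sets_eq[OF assms(2)]
  show "u \<in> borel_measurable M" using m assms by blast
  show "(\<lambda>x. u (P n x)) \<in> borel_measurable M" for n
    using continuous_on_compose2[OF assms(3) P_cont[of UNIV n]] by (intro m) auto
  show "integrable M (\<lambda>_. B)" by simp
  show "AE x in M. (\<lambda>n. u (P n x)) \<longlonglongrightarrow> u x"
    by (intro AE_I2 tendsto_compose_P assms(3))
qed (use assms in auto)

text \<open>The truncation provides a constant majorant, which is integrable for a finite measure;
  this makes dominated convergence available for unbounded \<open>u\<close>.\<close>

lemma integral_P_diff_null:
  fixes u :: "'a \<Rightarrow> complex"
  assumes "finite_measure M" "sets M = sets borel" "continuous_on UNIV u"
  shows "(\<lambda>n. \<integral>x. min (cmod (u (P n x) - u x)) 3 \<partial>M) \<longlonglongrightarrow> 0"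
proof -
  interpret finite_measure M by fact
  note m = borel_measurable_continuous_sets_eq[OF assms(2)]
  have uP: "continuous_on UNIV (\<lambda>x. u (P n x))" for n
    using continuous_on_compose2[OF assms(3) P_cont[of UNIV n]] by auto
  have "(\<lambda>n. \<integral>x. min (cmod (u (P n x) - u x)) 3 \<partial>M) \<longlonglongrightarrow> (\<integral>x. 0 \<partial>M)"
  proof (rule integral_dominated_convergence)
    show "(\<lambda>x. min (cmod (u (P n x) - u x)) 3) \<in> borel_measurable M" for n
      using uP assms(3) by (intro m continuous_intros)
    show "integrable M (\<lambda>_. 3 :: real)" by simp
    show "AE x in M. (\<lambda>n. min (cmod (u (P n x) - u x)) 3) \<longlonglongrightarrow> 0"
    proof (intro AE_I2)
      fix x
      have "(\<lambda>n. u (P n x)) \<longlonglongrightarrow> u x"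
        by (rule tendsto_compose_P[OF assms(3)])
      then have "(\<lambda>n. min (cmod (u (P n x) - u x)) 3) \<longlonglongrightarrow> min (cmod (u x - u x)) 3"
        by (intro tendsto_intros)
      then show "(\<lambda>n. min (cmod (u (P n x) - u x)) 3) \<longlonglongrightarrow> 0" by simp
    qed
  qed auto
  then show ?thesis by simp
qed

text \<open>Pulled back along \<open>P m\<close>, the integrand compares \<open>P n x\<close> with
  \<open>P m x\<close>, as \<open>P n (P m x) = P n x\<close>. Inserting \<open>u x\<close>
  separates the two indices, since truncation is subadditive on nonnegative reals.\<close>

lemma integral_P_diff_le:
  fixes u :: "'a \<Rightarrow> complex"
  assumes M: "finite_measure M" "sets M = sets borel" and u: "continuous_on UNIV u" and nm: "n \<le> m"
  shows "(LINT x:V m|distr M borel (P m). min (cmod (u (P n x) - u x)) 3) \<le>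
    (\<integral>x. min (cmod (u (P n x) - u x)) 3 \<partial>M) + (\<integral>x. min (cmod (u (P m x) - u x)) 3 \<partial>M)"
proof -
  have uP: "continuous_on A (\<lambda>x. u (P n x))" for n A
    using continuous_on_compose2[OF u P_cont[of A n]] by auto
  have uA: "continuous_on A u" for A using u continuous_on_subset by blast
  have i: "integrable M (\<lambda>x. min (cmod (u (P n x) - u x)) 3)" for n
    using uP uA by (intro integrable_bounded_continuous[OF M, where B = 3] continuous_intros) auto
  have i': "integrable M (\<lambda>x. min (cmod (u (P n x) - u (P m x))) 3)"
    using uP uA by (intro integrable_bounded_continuous[OF M, where B = 3] continuous_intros) auto
  have "(LINT x:V m|distr M borel (P m). min (cmod (u (P n x) - u x)) 3) = (\<integral>x. min (cmod (u (P n x) - u (P m x))) 3 \<partial>M)"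
    using uP uA P_comp[OF nm] by (subst set_integral_distr[OF M(2)]) (auto intro!: continuous_intros)
  also have "\<dots> \<le> (\<integral>x. min (cmod (u (P n x) - u x)) 3 + min (cmod (u (P m x) - u x)) 3 \<partial>M)"
  proof (intro integral_mono i' Bochner_Integration.integrable_add i)
    fix x
    have "cmod (u (P n x) - u (P m x)) \<le> cmod (u (P n x) - u x) + cmod (u (P m x) - u x)"
      using norm_triangle_ineq4[of "u (P n x) - u x" "u (P m x) - u x"] by simp
    moreover have "min r 3 \<le> min s 3 + min t 3" if "r \<le> s + t" "0 \<le> s" "0 \<le> t" for r s t :: real
      using that by (auto simp: min_def)
    ultimately show "min (cmod (u (P n x) - u (P m x))) 3 \<le> min (cmod (u (P n x) - u x)) 3 + min (cmod (u (P m x) - u x)) 3"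
      using norm_ge_zero by blast
  qed
  also have "\<dots> = (\<integral>x. min (cmod (u (P n x) - u x)) 3 \<partial>M) + (\<integral>x. min (cmod (u (P m x) - u x)) 3 \<partial>M)"
    by (intro Bochner_Integration.integral_add i)
  finally show ?thesis .
qed

lemma common_lipschitz:
  assumes "adm k UNIV f \<pi>"
  obtains L B where "1 \<le> L" "0 \<le> B" "L-lipschitz_on UNIV f" "\<And>x. cmod (f x) \<le> B" "\<And>j. j < k \<Longrightarrow> L-lipschitz_on UNIV (\<pi> j)"
proof -
  obtain L B where L: "L-lipschitz_on UNIV f" "0 \<le> B" "\<And>x. cmod (f x) \<le> B" using LipbE[OF admD(1)[OF assms]] by auto
  define L' where "L' = 1 + L + (\<Sum>j<k. lipconst UNIV (\<pi> j))"
  have p: "0 \<le> lipconst UNIV (\<pi> j)" if "j < k" for j using admD(2)[OF assms that] by (rule lipconst_nonneg)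
  have s: "0 \<le> (\<Sum>j<k. lipconst UNIV (\<pi> j))" using p by (intro sum_nonneg) auto
  have L0: "0 \<le> L" using lipschitz_on_nonneg[OF L(1)] .
  show thesis
  proof (rule that[of L' B])
    show "1 \<le> L'" using s L0 by (simp add: L'_def)
    show "L'-lipschitz_on UNIV f" by (rule lipschitz_on_le[OF L(1)]) (use s in \<open>simp add: L'_def\<close>)
    show "L'-lipschitz_on UNIV (\<pi> j)" if j: "j < k" for j
    proof (rule lipschitz_on_le[OF lipconst_lipschitz_on[OF admD(2)[OF assms j]]])
      show "lipconst UNIV (\<pi> j) \<le> L'"
        using member_le_sum[of j "{..<k}" "\<lambda>j. lipconst UNIV (\<pi> j)"] p j L0 by (auto simp: L'_def)
    qed
  qed (use L in auto)
qed

text \<open>Compatibility expresses the value at \<open>n\<close> through the later current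
  \<open>C m\<close> with arguments composed with \<open>P n\<close>. The change in the first
  argument is controlled by the mass directly, that in the slots by \<open>difference_bound\<close>;
  both errors split into a null sequence at \<open>n\<close> plus one at \<open>m\<close>.\<close>

lemma C_Cauchy:
  assumes adm: "adm k UNIV f \<pi>"
  shows "Cauchy (\<lambda>n. C n f \<pi>)"
proof -
  obtain L B where L1: "1 \<le> L" and B: "0 \<le> B" and f: "L-lipschitz_on UNIV f" "\<And>x. cmod (f x) \<le> B"
    and \<pi>: "\<And>j. j < k \<Longrightarrow> L-lipschitz_on UNIV (\<pi> j)"
    using common_lipschitz[OF adm] by blast
  \<comment> \<open>A Lipschitz constant of the composites with \<open>P n\<close>; since
    \<open>1 \<le> a\<close>, it serves the original functions as well.\<close>
  let ?L = "L * a"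
  have LL: "L \<le> ?L" "1 \<le> ?L" using L1 a1 mult_mono[of 1 L 1 a] by auto
  have fc: "continuous_on UNIV f" and \<pi>c: "\<And>j. j < k \<Longrightarrow> continuous_on UNIV (\<pi> j)"
    using f \<pi> by (auto intro: lipschitz_on_continuous_on)
  define e where "e u n = (\<integral>x. min (cmod (u (P n x) - u x)) 3 \<partial>\<mu>) + (\<integral>x. min (cmod (u (P n x) - u x)) 3 \<partial>\<nu>)"
    for u :: "'a \<Rightarrow> complex" and n
  have e0: "e u \<longlonglongrightarrow> 0" if "continuous_on UNIV u" for u
    unfolding e_def using tendsto_add[OF integral_P_diff_null[OF finite_mu(1) sets_mu(1) that]
        integral_P_diff_null[OF finite_mu(2) sets_mu(2) that]] by simp
  \<comment> \<open>Here \<open>2 * B\<close> is an integrable majorant, because \<open>f\<close> is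
    bounded, so this difference is integrated as it stands.\<close>
  define d where "d n = (\<integral>x. cmod (f (P n x) - f x) \<partial>\<mu>)" for n
  have fP: "continuous_on A (\<lambda>x. f (P n x))" for n A
    using continuous_on_compose2[OF fc P_cont[of A n]] by auto
  have fA: "continuous_on A f" for A using fc continuous_on_subset by blast
  have diff2: "cmod (f x - f y) \<le> 2 * B" for x y
    using norm_triangle_ineq4[of "f x" "f y"] f(2)[of x] f(2)[of y] by simp
  have d0: "d \<longlonglongrightarrow> 0"
  proof -
    interpret finite_measure \<mu> by (rule finite_mu)
    have "d \<longlonglongrightarrow> (\<integral>x. 0 \<partial>\<mu>)"
      unfolding d_def
    proof (rule integral_dominated_convergence)
      show "(\<lambda>x. cmod (f (P n x) - f x)) \<in> borel_measurable \<mu>" for n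
        by (intro borel_measurable_continuous_sets_eq sets_mu continuous_on_norm continuous_on_diff fP fA)
      show "integrable \<mu> (\<lambda>_. 2 * B)" by simp
      show "AE x in \<mu>. (\<lambda>n. cmod (f (P n x) - f x)) \<longlonglongrightarrow> 0"
      proof (intro AE_I2)
        fix x
        have "(\<lambda>n. f (P n x)) \<longlonglongrightarrow> f x"
          by (rule tendsto_compose_P[OF fc])
        then show "(\<lambda>n. cmod (f (P n x) - f x)) \<longlonglongrightarrow> 0"
          by (intro tendsto_norm_zero LIM_zero)
      qed
    qed (use diff2 in auto)
    then show ?thesis by simp
  qed
  let ?K = "(2 * ?L) ^ k * (2 * B + 1)"
  define \<delta> where "\<delta> n = ?L ^ k * d n + ?K * (\<Sum>j<k. e (\<pi> j) n)" for n
  have "\<delta> \<longlonglongrightarrow> ?L ^ k * 0 + ?K * (\<Sum>j<k. 0)"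
    unfolding \<delta>_def using e0 \<pi>c d0 by (intro tendsto_intros) auto
  then have \<delta>0: "\<delta> \<longlonglongrightarrow> 0" by simp
  have "cmod (C n f \<pi> - C m f \<pi>) \<le> \<delta> n + \<delta> m" if nm: "n \<le> m" for n m
  proof -
    interpret closed_current k "V m" "C m" by (rule closed_current)
    let ?fn = "\<lambda>x. f (P n x)" and ?\<pi>n = "\<lambda>j x. \<pi> j (P n x)"
    have LP: "?L-lipschitz_on (V m) (\<lambda>x. u (P n x))" "?L-lipschitz_on (V m) u" if "L-lipschitz_on UNIV u" for u :: "'a \<Rightarrow> complex"
      using lipschitz_on_subset[OF lipschitz_compose_P[OF lipschitz_on_subset[OF that], of n]] lipschitz_on_mono[OF that _ LL(1)] by auto
    have a1: "adm k (V m) ?fn ?\<pi>n" and a2: "adm k (V m) f ?\<pi>n"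
      using LP f \<pi> by (auto simp: adm_def intro!: LipbI[of ?L _ _ B] LipfI[of ?L])
    have "C n f \<pi> = C m ?fn ?\<pi>n"
      using compat[OF nm adm_subset[OF adm subset_UNIV]] by (simp add: o_def)
    then have split: "C n f \<pi> - C m f \<pi> = C m (\<lambda>x. ?fn x - f x) ?\<pi>n + (C m f ?\<pi>n - C m f \<pi>)"
      using first_diff[OF a1 admD(1)[OF a2]] by simp
    have int: "set_integrable (distr \<mu> borel (P m)) (V m) (\<lambda>x. cmod (?fn x - f x))"
      using mass fP fA diff2 borel_S
      by (intro set_integrable_bounded_continuous[where B = "2 * B"] continuous_intros) (auto simp: integral_mass_bound_def)
    have "cmod (C m (\<lambda>x. ?fn x - f x) ?\<pi>n) \<le> (\<Prod>j<k. ?L) * (LINT x:V m|distr \<mu> borel (P m). cmod (?fn x - f x))"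
      using LP \<pi> admD(1)[OF a1] admD(1)[OF a2] int
      by (intro integral_mass_boundD[OF mass borel_S] adm_first[OF a1] Lipb_diff) auto
    also have "(LINT x:V m|distr \<mu> borel (P m). cmod (?fn x - f x)) = (\<integral>x. cmod (f (P n x) - f (P m x)) \<partial>\<mu>)"
      using fP fA P_comp[OF nm] by (subst set_integral_distr[OF sets_mu(1)]) (auto intro!: continuous_intros)
    also have "\<dots> \<le> d n + d m"
    proof -
      have i: "integrable \<mu> (\<lambda>x. cmod (f (P n x) - f x))" for n
        using fP fA diff2
        by (intro integrable_bounded_continuous[OF finite_mu(1) sets_mu(1), where B = "2 * B"] continuous_intros) auto
      have i': "integrable \<mu> (\<lambda>x. cmod (f (P n x) - f (P m x)))"
        using fP fA diff2
        by (intro integrable_bounded_continuous[OF finite_mu(1) sets_mu(1), where B = "2 * B"] continuous_intros) auto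
      have "(\<integral>x. cmod (f (P n x) - f (P m x)) \<partial>\<mu>) \<le> (\<integral>x. cmod (f (P n x) - f x) + cmod (f (P m x) - f x) \<partial>\<mu>)"
      proof (intro integral_mono i' Bochner_Integration.integrable_add i)
        show "cmod (f (P n x) - f (P m x)) \<le> cmod (f (P n x) - f x) + cmod (f (P m x) - f x)" for x
          using norm_triangle_ineq4[of "f (P n x) - f x" "f (P m x) - f x"] by simp
      qed
      also have "\<dots> = d n + d m" unfolding d_def by (intro Bochner_Integration.integral_add i)
      finally show ?thesis .
    qed
    finally have b1: "cmod (C m (\<lambda>x. ?fn x - f x) ?\<pi>n) \<le> ?L ^ k * (d n + d m)"
      using LL by simp
    have "cmod (C m f ?\<pi>n - C m f \<pi>) \<le> ?K * (\<Sum>j<k.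
        (LINT x:V m|distr \<mu> borel (P m). min (cmod (?\<pi>n j x - \<pi> j x)) 3) +
        (LINT x:V m|distr \<nu> borel (P m). min (cmod (?\<pi>n j x - \<pi> j x)) 3))"
      using LP f \<pi> LL by (intro difference_bound mass mass_bdry B) auto
    also have "\<dots> \<le> ?K * (\<Sum>j<k. e (\<pi> j) n + e (\<pi> j) m)"
    proof (intro mult_left_mono sum_mono)
      fix j assume "j \<in> {..<k}"
      then have "continuous_on UNIV (\<pi> j)" using \<pi>c by auto
      from integral_P_diff_le[OF finite_mu(1) sets_mu(1) this nm] integral_P_diff_le[OF finite_mu(2) sets_mu(2) this nm]
      show "(LINT x:V m|distr \<mu> borel (P m). min (cmod (?\<pi>n j x - \<pi> j x)) 3) +
        (LINT x:V m|distr \<nu> borel (P m). min (cmod (?\<pi>n j x - \<pi> j x)) 3) \<le> e (\<pi> j) n + e (\<pi> j) m"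
        by (simp add: e_def)
    qed (use LL B in auto)
    finally have b2: "cmod (C m f ?\<pi>n - C m f \<pi>) \<le> ?K * (\<Sum>j<k. e (\<pi> j) n + e (\<pi> j) m)" .
    have "cmod (C n f \<pi> - C m f \<pi>) \<le> ?L ^ k * (d n + d m) + ?K * (\<Sum>j<k. e (\<pi> j) n + e (\<pi> j) m)"
      unfolding split using b1 b2 by (intro norm_triangle_le add_mono)
    also have "\<dots> = \<delta> n + \<delta> m" by (simp only: \<delta>_def sum.distrib distrib_left add_ac)
    finally show ?thesis .
  qed
  then show ?thesis by (rule Cauchy_if_bounded_by_null[OF _ \<delta>0])
qed

text \<open>Outside admissible arguments \<open>lim\<close> may be an arbitrary value; the axioms of
  a metric current only speak of admissible ones.\<close>

definition limit_current :: "'a current" where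
  "limit_current f \<pi> = lim (\<lambda>n. C n f \<pi>)"

lemma C_tendsto: "adm k UNIV f \<pi> \<Longrightarrow> (\<lambda>n. C n f \<pi>) \<longlonglongrightarrow> limit_current f \<pi>"
  using C_Cauchy Cauchy_convergent convergent_LIMSEQ_iff unfolding limit_current_def by blast

text \<open>Integrating against the image measure amounts to composing with \<open>P n\<close>, and
  these integrals converge to the one against \<open>M\<close>, so the bound survives the limit.
  \<open>D\<close> and \<open>l\<close> are kept general to cover currents with \<open>\<mu>\<close>
  and boundaries with \<open>\<nu>\<close>.\<close>

lemma integral_mass_bound_limit:
  assumes M: "finite_measure M" "sets M = sets borel"
    and bound: "\<And>n. integral_mass_bound l (V n) (D n) (distr M borel (P n))"
    and lim: "\<And>f \<pi>. adm l UNIV f \<pi> \<Longrightarrow> (\<lambda>n. D n f \<pi>) \<longlonglongrightarrow> D' f \<pi>"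
  shows "integral_mass_bound l UNIV D' M"
  unfolding integral_mass_bound_def
proof (intro conjI allI impI M)
  fix f :: "'a \<Rightarrow> complex" and \<pi> :: "nat \<Rightarrow> 'a \<Rightarrow> complex"
  assume adm: "adm l UNIV f \<pi>"
  obtain L B where "L-lipschitz_on UNIV f" and B0: "0 \<le> B" "\<And>x. x \<in> UNIV \<Longrightarrow> cmod (f x) \<le> B"
    using LipbE[OF admD(1)[OF adm]] by blast
  have B: "\<bar>cmod (f x)\<bar> \<le> B" for x using B0(2)[of x] by simp
  have fc: "continuous_on A (\<lambda>x. cmod (f x))" for A
    by (rule continuous_on_norm[OF continuous_on_subset[OF Lipf_continuous_on[OF Lipf_of_Lipb[OF admD(1)[OF adm]]] subset_UNIV]])
  have "cmod (D n f \<pi>) \<le> (\<Prod>j<l. lipconst UNIV (\<pi> j)) * (\<integral>x. cmod (f (P n x)) \<partial>M)" for n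
  proof -
    have "cmod (D n f \<pi>) \<le> (\<Prod>j<l. lipconst UNIV (\<pi> j)) * (LINT x:V n|distr M borel (P n). cmod (f x))"
    proof (rule integral_mass_boundD[OF bound, where L = "\<lambda>j. lipconst UNIV (\<pi> j)" and u = "\<lambda>x. cmod (f x)"])
      show "V n \<in> sets borel" using closed_V by simp
      show "adm l (V n) f \<pi>" using adm by (rule adm_subset) simp
      show "(lipconst UNIV (\<pi> j))-lipschitz_on (V n) (\<pi> j)" if "j < l" for j
        using lipconst_lipschitz_on[OF admD(2)[OF adm that]] by (rule lipschitz_on_subset) simp
      show "set_integrable (distr M borel (P n)) (V n) (\<lambda>x. cmod (f x))"
        using bound[of n] fc B0 closed_V
        by (intro set_integrable_bounded_continuous[where B = B]) (auto simp: integral_mass_bound_def)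
    qed simp
    then show ?thesis by (simp add: set_integral_distr[OF M(2) fc])
  qed
  moreover have "(\<lambda>n. (\<Prod>j<l. lipconst UNIV (\<pi> j)) * (\<integral>x. cmod (f (P n x)) \<partial>M)) \<longlonglongrightarrow>
      (\<Prod>j<l. lipconst UNIV (\<pi> j)) * (\<integral>x. cmod (f x) \<partial>M)"
    by (intro tendsto_mult_left integral_P_tendsto[OF M fc B])
  ultimately show "cmod (D' f \<pi>) \<le> (\<Prod>j<l. lipconst UNIV (\<pi> j)) * (LINT x:UNIV|M. cmod (f x))"
    using LIMSEQ_le[OF tendsto_norm[OF lim[OF adm]]] by (auto simp: set_lebesgue_integral_def)
qed

lemma limit_finite_mass: "has_finite_mass k UNIV limit_current"
proof -
  have "integral_mass_bound k UNIV limit_current \<mu>"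
    by (rule integral_mass_bound_limit[OF finite_mu(1) sets_mu(1) mass C_tendsto])
  then have "mass_bound k UNIV limit_current \<mu>" using radon by (simp add: mass_bound_iff_integral_mass_bound)
  then show ?thesis unfolding has_finite_mass_def by (rule exI)
qed

text \<open>\<open>bdry\<close> merely evaluates at other arguments and so commutes with the
  pointwise limit.\<close>

lemma limit_bdry_finite_mass:
  assumes "0 < k"
  shows "has_finite_mass (k - 1) UNIV (bdry limit_current)"
proof -
  have "(\<lambda>n. bdry (C n) f \<pi>) \<longlonglongrightarrow> bdry limit_current f \<pi>" if "adm (k - 1) UNIV f \<pi>" for f \<pi>
    unfolding bdry_def using that by (intro C_tendsto) (auto simp: adm_def Lipb_const Lipf_of_Lipb)
  then have "integral_mass_bound (k - 1) UNIV (bdry limit_current) \<nu>"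
    using mass_bdry[OF assms] by (intro integral_mass_bound_limit[OF finite_mu(2) sets_mu(2)])
  then have "mass_bound (k - 1) UNIV (bdry limit_current) \<nu>" using radon by (simp add: mass_bound_iff_integral_mass_bound)
  then show ?thesis unfolding has_finite_mass_def by (rule exI)
qed

text \<open>For fixed \<open>n\<close>, the estimate \<open>difference_bound\<close> holds for every
  \<open>C i\<close> with the same constant. Letting \<open>i\<close> tend to infinity first yields
  an estimate of the limit current by integrals against \<open>\<mu>\<close> and
  \<open>\<nu>\<close>; these then vanish as \<open>n\<close> grows, by dominated
  convergence.\<close>

lemma limit_continuity:
  assumes adm: "adm k UNIV f \<pi>" and \<pi>s: "\<And>n j. j < k \<Longrightarrow> Lipf UNIV (\<pi>s n j)"
    and lim: "\<And>j x. j < k \<Longrightarrow> (\<lambda>n. \<pi>s n j x) \<longlonglongrightarrow> \<pi> j x"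
    and L0: "\<And>n j. j < k \<Longrightarrow> lipconst UNIV (\<pi>s n j) \<le> L0"
  shows "(\<lambda>n. limit_current f (\<pi>s n)) \<longlonglongrightarrow> limit_current f \<pi>"
proof -
  obtain L1 B where L1: "1 \<le> L1" and B: "0 \<le> B" and f1: "L1-lipschitz_on UNIV f" and fB: "\<And>x. cmod (f x) \<le> B"
    and \<pi>1: "\<And>j. j < k \<Longrightarrow> L1-lipschitz_on UNIV (\<pi> j)"
    using common_lipschitz[OF adm] by blast
  define L where "L = max L0 L1"
  have f: "L-lipschitz_on UNIV f" and \<pi>: "\<And>j. j < k \<Longrightarrow> L-lipschitz_on UNIV (\<pi> j)"
    and s: "\<And>n j. j < k \<Longrightarrow> L-lipschitz_on UNIV (\<pi>s n j)"
    using lipschitz_on_le[OF f1] lipschitz_on_le[OF \<pi>1] lipschitz_on_le[OF lipconst_lipschitz_on[OF \<pi>s]] L0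
    by (auto simp: L_def le_max_iff_disj)
  have L1': "1 \<le> L" using L1 by (simp add: L_def)
  have adms: "adm k UNIV f (\<pi>s n)" for n using adm \<pi>s by (auto simp: adm_def)
  let ?K = "(2 * L) ^ k * (2 * B + 1)"
  let ?m = "\<lambda>n j x. min (cmod (\<pi>s n j x - \<pi> j x)) 3"
  have mc: "continuous_on A (?m n j)" if "j < k" for n j A
    using lipschitz_on_continuous_on[OF lipschitz_on_subset[OF s[OF that], of A n]]
      lipschitz_on_continuous_on[OF lipschitz_on_subset[OF \<pi>[OF that], of A]] by (intro continuous_intros) auto
  have bnd: "cmod (limit_current f (\<pi>s n) - limit_current f \<pi>) \<le> ?K * (\<Sum>j<k. (\<integral>x. ?m n j x \<partial>\<mu>) + (\<integral>x. ?m n j x \<partial>\<nu>))" for n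
  proof -
    have "cmod (C i f (\<pi>s n) - C i f \<pi>) \<le> ?K * (\<Sum>j<k. (\<integral>x. ?m n j (P i x) \<partial>\<mu>) + (\<integral>x. ?m n j (P i x) \<partial>\<nu>))" for i
    proof -
      interpret closed_current k "V i" "C i" by (rule closed_current)
      have "cmod (C i f (\<pi>s n) - C i f \<pi>) \<le> ?K * (\<Sum>j<k.
          (LINT x:V i|distr \<mu> borel (P i). ?m n j x) + (LINT x:V i|distr \<nu> borel (P i). ?m n j x))"
        using fB L1'
        by (intro difference_bound mass mass_bdry B lipschitz_on_subset[OF f subset_UNIV]
            lipschitz_on_subset[OF \<pi> subset_UNIV] lipschitz_on_subset[OF s subset_UNIV])
      also have "(\<Sum>j<k. (LINT x:V i|distr \<mu> borel (P i). ?m n j x) + (LINT x:V i|distr \<nu> borel (P i). ?m n j x)) =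
          (\<Sum>j<k. (\<integral>x. ?m n j (P i x) \<partial>\<mu>) + (\<integral>x. ?m n j (P i x) \<partial>\<nu>))"
        by (intro sum.cong refl arg_cong2[where f = "(+)"] set_integral_distr sets_mu mc) auto
      finally show ?thesis .
    qed
    moreover have "(\<lambda>i. ?K * (\<Sum>j<k. (\<integral>x. ?m n j (P i x) \<partial>\<mu>) + (\<integral>x. ?m n j (P i x) \<partial>\<nu>))) \<longlonglongrightarrow>
        ?K * (\<Sum>j<k. (\<integral>x. ?m n j x \<partial>\<mu>) + (\<integral>x. ?m n j x \<partial>\<nu>))"
      using mc
      by (intro tendsto_mult_left tendsto_sum tendsto_add integral_P_tendsto[where B = 3] finite_mu sets_mu) auto
    ultimately show ?thesis
      using LIMSEQ_le[OF tendsto_norm[OF tendsto_diff[OF C_tendsto[OF adms[of n]] C_tendsto[OF adm]]]] by auto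
  qed
  have int0: "(\<lambda>n. \<integral>x. ?m n j x \<partial>M) \<longlonglongrightarrow> 0" if M: "finite_measure M" "sets M = sets borel" and j: "j < k" for M j
  proof -
    interpret finite_measure M by fact
    have "(\<lambda>n. \<integral>x. ?m n j x \<partial>M) \<longlonglongrightarrow> (\<integral>x. 0 \<partial>M)"
    proof (rule integral_dominated_convergence)
      show "?m n j \<in> borel_measurable M" for n
        by (rule borel_measurable_continuous_sets_eq[OF M(2) mc[OF j]])
      show "integrable M (\<lambda>_. 3 :: real)" by simp
      show "AE x in M. (\<lambda>n. ?m n j x) \<longlonglongrightarrow> 0"
      proof (intro AE_I2)
        fix x
        have "(\<lambda>n. ?m n j x) \<longlonglongrightarrow> min (cmod (\<pi> j x - \<pi> j x)) 3" using lim[OF j] by (intro tendsto_intros)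
        then show "(\<lambda>n. ?m n j x) \<longlonglongrightarrow> 0" by simp
      qed
    qed auto
    then show ?thesis by simp
  qed
  have "(\<lambda>n. ?K * (\<Sum>j<k. (\<integral>x. ?m n j x \<partial>\<mu>) + (\<integral>x. ?m n j x \<partial>\<nu>))) \<longlonglongrightarrow> ?K * (\<Sum>j<k. 0 + 0)"
    by (intro tendsto_mult_left tendsto_sum tendsto_add int0 finite_mu sets_mu) auto
  then have "(\<lambda>n. ?K * (\<Sum>j<k. (\<integral>x. ?m n j x \<partial>\<mu>) + (\<integral>x. ?m n j x \<partial>\<nu>))) \<longlonglongrightarrow> 0" by simp
  then have "(\<lambda>n. limit_current f (\<pi>s n) - limit_current f \<pi>) \<longlonglongrightarrow> 0"
    by (rule Lim_null_comparison[OF always_eventually[OF allI[OF bnd]]])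
  then show ?thesis by (simp add: LIM_zero_iff)
qed

lemma normal_limit_current: "normal_current k UNIV limit_current"
  unfolding normal_current_def metric_current_def
proof (intro conjI allI impI limit_finite_mass limit_bdry_finite_mass)
  fix f g :: "'a \<Rightarrow> complex" and \<pi> \<sigma> :: "nat \<Rightarrow> 'a \<Rightarrow> complex"
  assume adm: "adm k UNIV f \<pi>" and eq: "\<forall>x\<in>UNIV. f x = g x" "\<forall>j<k. \<forall>x\<in>UNIV. \<pi> j x = \<sigma> j x"
  have "C n f \<pi> = C n g \<sigma>" for n
    using eq by (intro closed_current.T_cong[OF closed_current] adm_subset[OF adm]) auto
  then show "limit_current f \<pi> = limit_current g \<sigma>" by (simp add: limit_current_def)
next
  fix f g :: "'a \<Rightarrow> complex" and \<pi> :: "nat \<Rightarrow> 'a \<Rightarrow> complex" and a b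
  assume adm: "adm k UNIV f \<pi>" and g: "Lipb UNIV g"
  have 1: "(\<lambda>n. C n (\<lambda>x. a * f x + b * g x) \<pi>) = (\<lambda>n. a * C n f \<pi> + b * C n g \<pi>)"
    using Lipb_subset[OF g]
    by (intro ext closed_current.first_lin[OF closed_current] adm_subset[OF adm]) auto
  have 2: "(\<lambda>n. a * C n f \<pi> + b * C n g \<pi>) \<longlonglongrightarrow> a * limit_current f \<pi> + b * limit_current g \<pi>"
    by (intro tendsto_add tendsto_mult_left C_tendsto adm adm_first[OF adm g])
  have 3: "(\<lambda>n. C n (\<lambda>x. a * f x + b * g x) \<pi>) \<longlonglongrightarrow> limit_current (\<lambda>x. a * f x + b * g x) \<pi>"
    using admD(1)[OF adm] g by (intro C_tendsto adm_first[OF adm] Lipb_add Lipb_cmult)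
  show "limit_current (\<lambda>x. a * f x + b * g x) \<pi> = a * limit_current f \<pi> + b * limit_current g \<pi>"
    by (rule LIMSEQ_unique[OF 3 2[folded 1]])
next
  fix f :: "'a \<Rightarrow> complex" and \<pi> :: "nat \<Rightarrow> 'a \<Rightarrow> complex" and g h :: "'a \<Rightarrow> complex" and j a b
  assume adm: "adm k UNIV f \<pi>" and j: "j < k" and g: "Lipf UNIV g" and h: "Lipf UNIV h"
  have 1: "(\<lambda>n. C n f (\<pi>(j := \<lambda>x. a * g x + b * h x))) = (\<lambda>n. a * C n f (\<pi>(j := g)) + b * C n f (\<pi>(j := h)))"
    using Lipf_subset[OF g] Lipf_subset[OF h] j
    by (intro ext closed_current.slot_lin[OF closed_current] adm_subset[OF adm]) auto
  have 2: "(\<lambda>n. a * C n f (\<pi>(j := g)) + b * C n f (\<pi>(j := h))) \<longlonglongrightarrow> a * limit_current f (\<pi>(j := g)) + b * limit_current f (\<pi>(j := h))"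
    by (intro tendsto_add tendsto_mult_left C_tendsto adm_fun_upd adm g h)
  have 3: "(\<lambda>n. C n f (\<pi>(j := \<lambda>x. a * g x + b * h x))) \<longlonglongrightarrow> limit_current f (\<pi>(j := \<lambda>x. a * g x + b * h x))"
    using g h by (intro C_tendsto adm_fun_upd adm Lipf_add Lipf_cmult)
  show "limit_current f (\<pi>(j := \<lambda>x. a * g x + b * h x)) = a * limit_current f (\<pi>(j := g)) + b * limit_current f (\<pi>(j := h))"
    by (rule LIMSEQ_unique[OF 3 2[folded 1]])
next
  fix f :: "'a \<Rightarrow> complex" and \<pi> :: "nat \<Rightarrow> 'a \<Rightarrow> complex" and \<pi>s :: "nat \<Rightarrow> nat \<Rightarrow> 'a \<Rightarrow> complex"
  assume adm: "adm k UNIV f \<pi>" and Lip: "\<forall>n. \<forall>j<k. Lipf UNIV (\<pi>s n j)"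
    and lim: "\<forall>j<k. \<forall>x\<in>UNIV. (\<lambda>n. \<pi>s n j x) \<longlonglongrightarrow> \<pi> j x"
    and "\<exists>L. \<forall>n. \<forall>j<k. lipconst UNIV (\<pi>s n j) \<le> L"
  then obtain L where L: "\<And>n j. j < k \<Longrightarrow> lipconst UNIV (\<pi>s n j) \<le> L" by blast
  show "(\<lambda>n. limit_current f (\<pi>s n)) \<longlonglongrightarrow> limit_current f \<pi>"
    by (rule limit_continuity[OF adm _ _ L]) (use Lip lim in auto)
next
  fix f :: "'a \<Rightarrow> complex" and \<pi> :: "nat \<Rightarrow> 'a \<Rightarrow> complex" and j
  assume adm: "adm k UNIV f \<pi>" and j: "j < k"
    and "\<exists>U c. open U \<and> closure {x \<in> UNIV. f x \<noteq> 0} \<inter> UNIV \<subseteq> U \<and> (\<forall>x\<in>U \<inter> UNIV. \<pi> j x = c)"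
  then obtain U c where U: "open U" "closure {x. f x \<noteq> 0} \<subseteq> U" "\<And>x. x \<in> U \<Longrightarrow> \<pi> j x = c" by auto
  have "C n f \<pi> = 0" for n
  proof (rule closed_current.T_local[OF closed_current adm_subset[OF adm subset_UNIV] j U(1)])
    \<comment> \<open>Restriction to \<open>V n\<close> only shrinks the support, so locality of
      each \<open>C n\<close> applies with the same open set.\<close>
    have "closure {x \<in> V n. f x \<noteq> 0} \<subseteq> closure {x. f x \<noteq> 0}" by (intro closure_mono) auto
    then show "closure {x \<in> V n. f x \<noteq> 0} \<inter> V n \<subseteq> U" using U(2) by auto
  qed (use U in auto)
  then show "limit_current f \<pi> = 0" by (simp add: limit_current_def)
qed

end

section \<open>Passage from the given index set to a cofinal sequence\<close>

text \<open>Running maxima of an enumeration. A finite index set is covered too, with an enumeration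
  that repeats elements.\<close>

lemma cofinal_sequence:
  fixes A :: "'i::linorder set"
  assumes "countable A" "A \<noteq> {}"
  obtains t :: "nat \<Rightarrow> 'i" where "\<And>n. t n \<in> A" "mono t" "\<And>s. s \<in> A \<Longrightarrow> \<exists>N. \<forall>n\<ge>N. s \<le> t n"
proof -
  define t where "t n = Max (from_nat_into A ` {..n})" for n
  have "t n \<in> from_nat_into A ` {..n}" for n unfolding t_def by (intro Max_in) auto
  then have "t n \<in> A" for n using from_nat_into[OF assms(2)] by (metis imageE)
  moreover have "mono t" unfolding t_def by (intro monoI Max_mono) auto
  moreover have "\<exists>N. \<forall>n\<ge>N. s \<le> t n" if "s \<in> A" for s
  proof -
    obtain N where "from_nat_into A N = s" using from_nat_into_surj[OF assms(1) \<open>s \<in> A\<close>] by blast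
    then show ?thesis by (intro exI[of _ N]) (auto simp: t_def intro!: Max_ge)
  qed
  ultimately show thesis using that by blast
qed

theorem theorem5p3:
  fixes J :: "'a::banach \<Rightarrow> 'a"
    and Ts :: "'i::linorder set"
    and E :: "'i \<Rightarrow> 'a set"
    and p :: "'i \<Rightarrow> 'a \<Rightarrow> 'a"
    and Tc :: "'i \<Rightarrow> 'a current"
    and k :: nat
  assumes "complex_structure J"
    and "proj_approx_seq J Ts E p"
    and "\<forall>t\<in>Ts. normal_current k (E t) (Tc t)"
    and "\<forall>t\<in>Ts. \<forall>t'\<in>Ts. t < t' \<longrightarrow>
           (\<forall>f \<pi>. adm k (E t) f \<pi> \<longrightarrow> push (p t) (Tc t') f \<pi> = Tc t f \<pi>)"
    and "\<exists>\<mu> \<nu>. finite_radon_on UNIV \<mu> \<and> finite_radon_on UNIV \<nu> \<and>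
           (\<forall>t\<in>Ts. measure_le (current_mass k (E t) (Tc t)) (distr \<mu> borel (p t)) \<and>
              (0 < k \<longrightarrow> measure_le (current_mass (k - 1) (E t) (bdry (Tc t))) (distr \<nu> borel (p t))))"
  shows "\<exists>T. normal_current k UNIV T \<and>
           (\<forall>t\<in>Ts. \<forall>f \<pi>. adm k (E t) f \<pi> \<longrightarrow> push (p t) T f \<pi> = Tc t f \<pi>)"
proof -
  note pas = assms(2)[unfolded proj_approx_seq_def]
  have "countable Ts" and dense: "closure (\<Union>t\<in>Ts. E t) = UNIV"
    and E_mono: "\<And>s t. s \<in> Ts \<Longrightarrow> t \<in> Ts \<Longrightarrow> s \<le> t \<longleftrightarrow> E s \<subseteq> E t"
    and comp: "\<And>s t. s \<in> Ts \<Longrightarrow> t \<in> Ts \<Longrightarrow> p t \<circ> p s = p (min s t)"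
    using pas by blast+
  obtain a0 where "\<forall>t\<in>Ts. bounded_linear (p t) \<and> complex_linear J (p t) \<and>
          range (p t) = E t \<and> (\<forall>x\<in>E t. p t x = x) \<and> (\<forall>x. norm (p t x) \<le> a0 * norm x)"
    using pas[THEN conjunct2, THEN conjunct2, THEN conjunct2, THEN conjunct2, THEN conjunct2, THEN conjunct1] by (rule exE)
  then have lin: "\<And>t. t \<in> Ts \<Longrightarrow> bounded_linear (p t)" and range: "\<And>t. t \<in> Ts \<Longrightarrow> range (p t) = E t"
    and id: "\<And>t x. t \<in> Ts \<Longrightarrow> x \<in> E t \<Longrightarrow> p t x = x" and bound0: "\<And>t x. t \<in> Ts \<Longrightarrow> norm (p t x) \<le> a0 * norm x"
    by auto
  \<comment> \<open>Raised to at least 1, so that composing with a projection never calls for a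
    smaller Lipschitz constant than the original.\<close>
  define a where "a = max 1 a0"
  have bound: "norm (p t x) \<le> a * norm x" if "t \<in> Ts" for t x
  proof -
    have "a0 * norm x \<le> a * norm x" by (intro mult_right_mono) (auto simp: a_def)
    then show ?thesis using bound0[OF that, of x] by simp
  qed
  have in_E: "p t x \<in> E t" if "t \<in> Ts" for t x using range[OF that] by auto
  have "Ts \<noteq> {}" using dense by auto
  obtain t :: "nat \<Rightarrow> 'i" where t: "\<And>n. t n \<in> Ts" "mono t" "\<And>s. s \<in> Ts \<Longrightarrow> \<exists>N. \<forall>n\<ge>N. s \<le> t n"
    by (rule cofinal_sequence[OF \<open>countable Ts\<close> \<open>Ts \<noteq> {}\<close>]) (rule that)
  obtain \<mu> \<nu> where munu: "finite_radon_on UNIV \<mu> \<and> finite_radon_on UNIV \<nu> \<and>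
           (\<forall>t\<in>Ts. measure_le (current_mass k (E t) (Tc t)) (distr \<mu> borel (p t)) \<and>
              (0 < k \<longrightarrow> measure_le (current_mass (k - 1) (E t) (bdry (Tc t))) (distr \<nu> borel (p t))))"
    using assms(5) by (elim exE)
  then have radon: "finite_radon_on UNIV \<mu>" "finite_radon_on UNIV \<nu>"
    and le: "\<And>t. t \<in> Ts \<Longrightarrow> measure_le (current_mass k (E t) (Tc t)) (distr \<mu> borel (p t))"
      "\<And>t. t \<in> Ts \<Longrightarrow> 0 < k \<Longrightarrow> measure_le (current_mass (k - 1) (E t) (bdry (Tc t))) (distr \<nu> borel (p t))"
    by simp_all
  have closed_E: "closed (E s)" if "s \<in> Ts" for s
  proof -
    have "E s = {x. p s x = x}" by (auto simp: id[OF that]) (metis in_E[OF that])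
    moreover have "closed {x. p s x = x}"
      by (intro closed_Collect_eq linear_continuous_on[OF lin[OF that]] continuous_on_id)
    ultimately show ?thesis by simp
  qed
  have cur: "closed_current k (E s) (Tc s)" if "s \<in> Ts" for s
    using assms(3) that closed_E by (auto simp: normal_current_def intro: closed_current.intro)
  \<comment> \<open>The hypothesis covers \<open>s < s'\<close>. For equal indices
    \<open>p s\<close> is the identity on \<open>E s\<close>, and a current sees only the
    restrictions of its arguments.\<close>
  have push_eq: "push (p s) (Tc s') f \<pi> = Tc s f \<pi>" if "s \<in> Ts" "s' \<in> Ts" "s \<le> s'" "adm k (E s) f \<pi>" for s s' f \<pi>
  proof (cases "s = s'")
    case True
    have "Tc s f \<pi> = Tc s (f \<circ> p s) (\<lambda>j. \<pi> j \<circ> p s)"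
      using id[OF that(1)] by (intro closed_current.T_cong[OF cur[OF that(1)] that(4)]) auto
    then show ?thesis using True by (simp add: push_def)
  qed (use assms(4) that in auto)
  have radon_distr: "finite_measure (distr M borel (p s))" if "finite_radon_on UNIV M" "s \<in> Ts" for M s
  proof -
    have M: "sets M = sets borel" using that by (auto simp: finite_radon_on_def)
    interpret finite_measure M by (rule finite_radon_on_finite_measure[OF that(1)])
    have "p s \<in> measurable M borel"
      by (rule borel_measurable_continuous_sets_eq[OF M linear_continuous_on[OF lin[OF that(2)]]])
    then show ?thesis by (rule finite_measure_distr)
  qed
  interpret projective_current_system "\<lambda>n. E (t n)" "\<lambda>n. p (t n)" a k "\<lambda>n. Tc (t n)" \<mu> \<nu>
  proof (rule projective_current_system.intro)
    show "bounded_linear (p (t n))" for n using lin t by blast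
    show "norm (p (t n) x) \<le> a * norm x" for n x using bound t by blast
    show "1 \<le> a" by (simp add: a_def)
    show "p (t n) x \<in> E (t n)" for n x using in_E t by blast
    show "p (t n) x = x" if "x \<in> E (t n)" for n x using id t that by blast
    show "p (t n) (p (t m) x) = p (t n) x" if "n \<le> m" for n m x
      using comp[OF t(1)[of m] t(1)[of n]] monoD[OF t(2) that] by (simp add: fun_eq_iff min_absorb2)
    show "(\<lambda>n. p (t n) x) \<longlonglongrightarrow> x" for x
    proof (rule metric_LIMSEQ_I)
      fix r :: real assume r: "0 < r"
      have a1: "1 \<le> a" by (simp add: a_def)
      \<comment> \<open>As soon as \<open>E (t n)\<close> contains \<open>y\<close>, the projection
        fixes it, so the error at \<open>x\<close> is at most \<open>(a + 1) * norm (x - y)\<close>;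
        this dictates the radius.\<close>
      obtain y where y: "y \<in> (\<Union>t\<in>Ts. E t)" "dist y x < r / (a + 1)"
        using dense r a1 closure_approachable[of x "\<Union>t\<in>Ts. E t"] by (metis UNIV_I add_pos_pos divide_pos_pos less_le_trans zero_less_one)
      then obtain s where s: "s \<in> Ts" "y \<in> E s" by auto
      obtain N where N: "\<And>n. n \<ge> N \<Longrightarrow> s \<le> t n" using t(3)[OF s(1)] by blast
      have "dist (p (t n) x) x < r" if "n \<ge> N" for n
      proof -
        interpret bounded_linear "p (t n)" using lin t by blast
        have "y \<in> E (t n)" using E_mono[OF s(1) t(1)] N[OF that] s(2) by blast
        then have "p (t n) x - x = p (t n) (x - y) - (x - y)" using id[OF t(1)] by (simp add: diff)
        then have "dist (p (t n) x) x \<le> norm (p (t n) (x - y)) + norm (x - y)"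
          unfolding dist_norm by (simp only: norm_triangle_ineq4)
        also have "\<dots> \<le> (a + 1) * norm (x - y)" using bound[OF t(1)[of n], of "x - y"] by (simp add: algebra_simps)
        also have "\<dots> < r" using y(2) a1 by (simp add: dist_norm norm_minus_commute field_simps)
        finally show ?thesis .
      qed
      then show "\<exists>N. \<forall>n\<ge>N. dist (p (t n) x) x < r" by blast
    qed
    show "metric_current k (E (t n)) (Tc (t n))" for n using assms(3) t by (auto simp: normal_current_def)
    show "Tc (t m) (f \<circ> p (t n)) (\<lambda>j. \<pi> j \<circ> p (t n)) = Tc (t n) f \<pi>" if "n \<le> m" "adm k (E (t n)) f \<pi>" for n m f \<pi>
      using push_eq[OF t(1) t(1) monoD[OF t(2) that(1)] that(2)] by (simp add: push_def)
    show "finite_radon_on UNIV \<mu>" "finite_radon_on UNIV \<nu>" by (fact radon)+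
    fix n
    have S: "E (t n) \<in> sets borel" using closed_E[OF t(1)] by simp
    interpret closed_current k "E (t n)" "Tc (t n)" using cur t by blast
    \<comment> \<open>Since the mass measure exists, \<open>current_mass\<close> is itself a mass
      bound, and domination by the image of \<open>\<mu>\<close> becomes an estimate for the
      current.\<close>
    have "mass_bound k (E (t n)) (Tc (t n)) (current_mass k (E (t n)) (Tc (t n)))"
      using current by (intro mass_bound_current_mass additive S) (simp add: metric_current_def)
    then show "integral_mass_bound k (E (t n)) (Tc (t n)) (distr \<mu> borel (p (t n)))"
      using le(1)[OF t(1)] radon_distr[OF radon(1) t(1)] S
      by (intro integral_mass_bound_mono[OF _ le(1)[OF t(1)] S]) (auto simp: mass_bound_iff_integral_mass_bound)
    assume k: "0 < k"
    have "mass_bound (k - 1) (E (t n)) (bdry (Tc (t n))) (current_mass (k - 1) (E (t n)) (bdry (Tc (t n))))"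
      using assms(3) t(1) k by (intro mass_bound_current_mass additive_bdry S) (auto simp: normal_current_def)
    then show "integral_mass_bound (k - 1) (E (t n)) (bdry (Tc (t n))) (distr \<nu> borel (p (t n)))"
      using radon_distr[OF radon(2) t(1)] S
      by (intro integral_mass_bound_mono[OF _ le(2)[OF t(1) k] S]) (auto simp: mass_bound_iff_integral_mass_bound)
  qed
  \<comment> \<open>The index \<open>s\<close> may be missing from the sequence. Once
    \<open>t n\<close> has passed \<open>s\<close>, compatibility makes the pushforwards of
    \<open>Tc (t n)\<close> constantly equal to \<open>Tc s\<close>, so their limit is that
    value.\<close>
  have "push (p s) limit_current f \<pi> = Tc s f \<pi>" if s: "s \<in> Ts" and adm: "adm k (E s) f \<pi>" for s f \<pi>
  proof -
    have ps: "a-lipschitz_on UNIV (p s)"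
    proof (rule lipschitz_onI)
      interpret bounded_linear "p s" by (rule lin[OF s])
      show "dist (p s x) (p s y) \<le> a * dist x y" for x y using bound[OF s, of "x - y"] by (simp add: dist_norm diff)
    qed (simp add: a_def)
    have Lip: "Lipf UNIV (u \<circ> p s)" if u: "Lipf (E s) u" for u
    proof -
      obtain L where "L-lipschitz_on (E s) u" using u by (auto simp: Lipf_def)
      then have "(L * a)-lipschitz_on UNIV (u \<circ> p s)"
        using range[OF s] by (intro lipschitz_on_compose[OF ps]) simp
      then show ?thesis by (rule LipfI)
    qed
    have "(f \<circ> p s) ` UNIV = f ` E s" using range[OF s] by (metis image_comp)
    then have "adm k UNIV (f \<circ> p s) (\<lambda>j. \<pi> j \<circ> p s)"
      using adm Lip by (auto simp: adm_def Lipb_def)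
    then have "(\<lambda>n. push (p s) (Tc (t n)) f \<pi>) \<longlonglongrightarrow> push (p s) limit_current f \<pi>"
      unfolding push_def by (rule C_tendsto)
    moreover have "\<forall>\<^sub>F n in sequentially. push (p s) (Tc (t n)) f \<pi> = Tc s f \<pi>"
      using t(3)[OF s] push_eq[OF s t(1) _ adm] by (auto simp: eventually_sequentially)
    then have "(\<lambda>n. push (p s) (Tc (t n)) f \<pi>) \<longlonglongrightarrow> Tc s f \<pi>" by (rule tendsto_eventually)
    ultimately show ?thesis by (rule LIMSEQ_unique)
  qed
  then show ?thesis using normal_limit_current by blast
qed

end
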